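(* Let $K_0, K_1$ be any two circled convex bodies in $\mathbb{C}^n$ and let $\theta \in [0,1)$. Then there exists $T \in \mathrm{PD}_n(\mathbb{C})$ so that $[T(K_0),K_1]_\theta$ is in $\ell$-position. Moreover, if $\bar{\mathcal{G}} < O(2n)$ is the group generated by $U(n)$ and $\bar Z$, and $K_0,K_1$ are invariant under some subgroup $\mathcal{G} < \bar{\mathcal{G}}$ (i.e. $gK_i = K_i$ for all $g \in \mathcal{G}$, $i=0,1$), then a map $T \in \mathrm{PD}_n(\mathbb{C})$ for which $[T(K_0),K_1]_\theta$ is in $\ell$-position may be chosen to commute with all elements of $\mathcal{G}$, and hence $[T(K_0),K_1]_\theta$ is invariant under $\mathcal{G}$ as well.
   Context: A convex body is a convex compact set with non-empty interior; a convex body $K \subset \mathbb{C}^n$ is circled if $e^{it}K = K$ for all $t \in [0,2\pi]$. $\|\cdot\|_K$ denotes the norm with unit ball $K$. $\mathbb{C}^n$ is identified with $\mathbb{R}^{2n}$, with real inner product $\operatorname{Re}\langle\cdot,\cdot\rangle$; $O(2n)$ is the corresponding orthogonal group (acting $\mathbb{R}$-linearly), containing the unitary group $U(n)$. $\bar Z : \mathbb{C}^n \to \mathbb{C}^n$ is the $\mathbb{R}$-linear coordinate-wise conjugation $x+iy \mapsto x-iy$ ($x,y\in\mathbb{R}^n$). $\mathrm{PD}_n(\mathbb{C})$ is the set of positive-definite (Hermitian) $\mathbb{C}$-linear maps on $\mathbb{C}^n$. Complex interpolation: let $S = \{z \in \mathbb{C} : 0 < \operatorname{Re} z < 1\}$,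 and let $\mathcal{F}_n$ be the space of bounded continuous functions $f : \bar S \to \mathbb{C}^n$ which are holomorphic on $S$ (in each coordinate). For circled convex bodies $K_0,K_1$ in $\mathbb{C}^n$ and $\theta \in [0,1]$, $[K_0,K_1]_\theta := \{ f(\theta) \; ; \; f \in \mathcal{F}_n, \ f(it) \in K_0, \ f(1+it) \in K_1 \ \forall t \in \mathbb{R}\}$; it is a circled convex body, the unit ball of the norm obtained by the (Calderón–Lions) complex interpolation method applied to $\|\cdot\|_{K_0}, \|\cdot\|_{K_1}$. $\ell$-position: let $G$ be a standard Gaussian random vector on $\mathbb{C}^n \simeq \mathbb{R}^{2n}$ and $\ell_2(K) := (\mathbb{E}\|G\|_K^2)^{1/2}$. A circled convex body $K \subset \mathbb{C}^n$ is in $\ell$-position if the minimum $\min\{\ell_2(T(K)) \; ; \; T \in \mathrm{GL}_n(\mathbb{C}), \ \det T = 1\}$ is attained at $T = \mathrm{Id}$. *)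

theory Defs
  imports "HOL-Probability.Probability" "HOL-Algebra.Generated_Groups"
begin

definition circled :: "(complex ^ 'n) set \<Rightarrow> bool" where
  "circled K \<longleftrightarrow> (\<forall>t\<in>{0..2*pi}. (\<lambda>x. exp (\<i> * of_real t) *s x) ` K = K)"

definition circled_convex_body :: "(complex ^ 'n) set \<Rightarrow> bool" where
  "circled_convex_body K \<longleftrightarrow> convex K \<and> compact K \<and> interior K \<noteq> {} \<and> circled K"

definition body_norm :: "'a::real_vector set \<Rightarrow> 'a \<Rightarrow> real" where
  "body_norm K x = Inf {r. 0 < r \<and> x \<in> (*\<^sub>R) r ` K}"

text \<open>The real coordinates are independent with law N(0,1). On \<open>complex ^ 'n\<close> these are
  the \<open>2n\<close> real and imaginary parts, so that \<open>E |G|\<^sup>2 = 2n\<close>.\<close>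

definition std_gaussian :: "'a::euclidean_space measure" where
  "std_gaussian = density lborel (\<lambda>x. ennreal (\<Prod>b\<in>Basis. std_normal_density (x \<bullet> b)))"

definition ell2 :: "'a::euclidean_space set \<Rightarrow> real" where
  "ell2 K = sqrt (\<integral>x. (body_norm K x)\<^sup>2 \<partial>std_gaussian)"

text \<open>For compact \<open>K\<close> the first conjunct just says that \<open>K\<close> is a circled convex body. It is
  imposed on the closure because \<open>interp\<close> below is defined through functions continuous up to
  the boundary of the strip, whereas extremal functions for the interpolation norm are a priori
  only bounded and holomorphic. The set \<open>interp K0 K1 \<theta>\<close> contains the open unit ball of that norm
  and is contained in the closed one, but that it contains the whole unit sphere is not clear.
  Neither \<open>body_norm\<close> nor \<open>ell2\<close> distinguishes a convex set with \<open>0\<close> in its interior from its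
  closure.\<close>

definition in_ell_position :: "(complex ^ 'n) set \<Rightarrow> bool" where
  "in_ell_position K \<longleftrightarrow> circled_convex_body (closure K) \<and>
     (\<forall>T :: complex ^ 'n ^ 'n. invertible T \<and> det T = 1 \<longrightarrow> ell2 K \<le> ell2 ((*v) T ` K))"

definition strip :: "complex set" where
  "strip = {z. 0 < Re z \<and> Re z < 1}"

definition strip_functions :: "(complex \<Rightarrow> complex ^ 'n) set" where
  "strip_functions = {f. bounded (f ` closure strip) \<and> continuous_on (closure strip) f \<and>
     (\<forall>i. (\<lambda>z. f z $ i) holomorphic_on strip)}"

definition interp :: "(complex ^ 'n) set \<Rightarrow> (complex ^ 'n) set \<Rightarrow> real \<Rightarrow> (complex ^ 'n) set" where
  "interp K0 K1 \<theta> = {f (of_real \<theta>) | f. f \<in> strip_functions \<and>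
     (\<forall>t::real. f (\<i> * of_real t) \<in> K0 \<and> f (1 + \<i> * of_real t) \<in> K1)}"

definition conj_transpose :: "complex ^ 'n ^ 'n \<Rightarrow> complex ^ 'n ^ 'n" where
  "conj_transpose A = (\<chi> i j. cnj (A $ j $ i))"

text \<open>On \<open>complex ^ 'n\<close> the inner product \<open>\<bullet>\<close> is the real part of the Hermitian one.\<close>

definition PD :: "(complex ^ 'n ^ 'n) set" where
  "PD = {T. conj_transpose T = T \<and> (\<forall>x. x \<noteq> 0 \<longrightarrow> 0 < (T *v x) \<bullet> x)}"

definition unitary_maps :: "(complex ^ 'n \<Rightarrow> complex ^ 'n) set" where
  "unitary_maps = {(*v) U | U. U ** conj_transpose U = mat 1 \<and> conj_transpose U ** U = mat 1}"

definition conj_map :: "complex ^ 'n \<Rightarrow> complex ^ 'n" where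
  "conj_map x = (\<chi> i. cnj (x $ i))"

text \<open>\<open>orthogonal_transformation\<close> is real-linear and refers to the real inner product, so this
  is \<open>O(2n)\<close>.\<close>

definition orthogonal_group :: "(complex ^ 'n \<Rightarrow> complex ^ 'n) monoid" where
  "orthogonal_group = \<lparr>carrier = {g. orthogonal_transformation g}, mult = (\<circ>), one = id\<rparr>"

definition G_bar :: "(complex ^ 'n \<Rightarrow> complex ^ 'n) monoid" where
  "G_bar = orthogonal_group
     \<lparr>carrier := generate orthogonal_group (unitary_maps \<union> {conj_map})\<rparr>"

end

theory Submission
  imports Defs "HOL-Complex_Analysis.Conformal_Mappings"
begin

text \<open>
  Write \<open>K\<^sub>T\<close> for the body \<open>[T K\<^sub>0, K\<^sub>1]\<^sub>\<theta>\<close>, \<open>\<parallel>\<cdot>\<parallel>\<^sub>T\<close> for its norm, and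
  \<open>g\<^sub>T M = E \<parallel>M G\<parallel>\<^sub>T\<^sup>2\<close> for a complex matrix \<open>M\<close>. Since \<open>\<ell>\<^sub>2 (A K\<^sub>T)\<^sup>2 = g\<^sub>T A\<^sup>-\<^sup>1\<close>, the body
  \<open>K\<^sub>T\<close> is in \<open>\<ell>\<close>-position iff the identity minimizes \<open>g\<^sub>T\<close> among the matrices of determinant 1.

  The function \<open>g\<^sub>T\<close> is convex, as the average of convex functions. Its derivative at the
  identity is read off from the Gaussian density: it is \<open>X \<mapsto> Re tr (X W\<^sub>T)\<close> with the Hermitian
  matrix \<open>W\<^sub>T = Cov (\<parallel>G\<parallel>\<^sub>T\<^sup>2, G G\<^sup>*)\<close>, and \<open>tr W\<^sub>T = 2 g\<^sub>T I\<close> because \<open>\<parallel>\<cdot>\<parallel>\<^sub>T\<^sup>2\<close> is homogeneous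
  of degree 2. Hence \<open>g\<^sub>T M \<ge> g\<^sub>T I + Re tr ((M - I) W\<^sub>T)\<close> for all \<open>M\<close>. If \<open>W\<^sub>T\<close> is a multiple of the
  identity, then \<open>K\<^sub>T\<close> is in \<open>\<ell>\<close>-position: multiplying \<open>M\<close> by a unitary matrix from the right
  leaves \<open>g\<^sub>T M\<close> unchanged and can be used to make \<open>M\<close> triangular with positive diagonal, and
  then \<open>det M = 1\<close> gives \<open>Re tr M \<ge> n\<close> by the inequality between the arithmetic and the
  geometric mean (\<open>ell2_minimal_if_cov_matrix_scalar\<close>).

  It remains to find \<open>T\<close> with scalar \<open>W\<^sub>T\<close>. Scaling \<open>T\<close> only scales \<open>K\<^sub>T\<close>, so
  \<open>tr T = 1\<close> may be imposed. Let \<open>D\<close> be the compact convex set of Hermitian \<open>T\<close> with \<open>tr T = 1\<close>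
  and \<open>T \<ge> \<epsilon> I\<close> that commute with \<open>\<G>\<close>. Brouwer's theorem, applied to the projection of
  \<open>T + W\<^sub>T\<close> to \<open>D\<close>, gives \<open>T \<in> D\<close> with \<open>\<langle>W\<^sub>T, S - T\<rangle> \<le> 0\<close> for all \<open>S \<in> D\<close>. The choice
  \<open>S = I/n\<close> and the supporting inequality for \<open>M = n T\<close> give \<open>g\<^sub>T (n T) \<ge> g\<^sub>T I\<close>. If \<open>\<epsilon>\<close> is small
  and \<open>T\<close> has the eigenvalue \<open>\<epsilon>\<close>, this is impossible. On one hand, \<open>T\<close> maps a fixed small ball
  into \<open>T K\<^sub>0 \<inter> K\<^sub>1 \<subseteq> K\<^sub>T\<close>, so that \<open>g\<^sub>T (n T)\<close> is bounded independently of \<open>\<epsilon>\<close>. On the other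
  hand, the three lines theorem bounds the width of \<open>K\<^sub>T\<close> in the direction of the eigenvector by
  a multiple of \<open>\<epsilon>\<^sup>1\<^sup>-\<^sup>\<theta>\<close>, so that \<open>g\<^sub>T I\<close> is at least a multiple of \<open>\<epsilon>\<^sup>-\<^sup>2\<^sup>(\<^sup>1\<^sup>-\<^sup>\<theta>\<^sup>)\<close>; this is where
  \<open>\<theta> < 1\<close> enters. So \<open>T > \<epsilon> I\<close>, and \<open>S = T + \<delta> W\<^sub>0\<close> is admissible for the traceless part \<open>W\<^sub>0\<close>
  of \<open>W\<^sub>T\<close> and small \<open>\<delta> > 0\<close>; it yields \<open>W\<^sub>0 = 0\<close> (\<open>exists_scalar_cov_matrix\<close>).

  Symmetries cost nothing, because they are built into \<open>D\<close>: every element of the group is a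
  real-orthogonal map that is complex linear or conjugate linear, it preserves \<open>K\<^sub>T\<close> as soon as
  it preserves \<open>K\<^sub>0\<close>, \<open>K\<^sub>1\<close> and commutes with \<open>T\<close>, and then it commutes with \<open>W\<^sub>T\<close>.
\<close>

section \<open>The Gaussian measure under linear maps\<close>

lemma linear_borel_measurable:
  fixes f :: "'a::euclidean_space \<Rightarrow> 'b::euclidean_space"
  shows "linear f \<Longrightarrow> f \<in> borel_measurable borel"
  by (intro borel_measurable_continuous_onI linear_continuous_on linear_conv_bounded_linear[THEN iffD1])

text \<open>The usual proof that translation-invariant measures are unique up to a factor: integrate
\<open>1\<^sub>B (f x) h (f x + y)\<close> over \<open>x\<close> and \<open>y\<close> in both orders. The ball \<open>B\<close> is chosen for its symmetry,
which replaces a reflection of the variables.\<close>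

lemma nn_integral_lborel_linear_Fubini:
  fixes f :: "'a::euclidean_space \<Rightarrow> 'a"
  assumes "linear f" "linear g" and fg: "\<And>x. f (g x) = x"
    and [measurable]: "h \<in> borel_measurable borel"
  shows "emeasure lborel (ball (0::'a) 1) * (\<integral>\<^sup>+x. h (f x) \<partial>lborel)
    = emeasure lborel (f -` ball 0 1) * (\<integral>\<^sup>+x. h x \<partial>lborel)"
proof -
  have [measurable]: "f \<in> borel_measurable borel" "g \<in> borel_measurable borel"
    using assms(1,2) by (auto intro: linear_borel_measurable)
  have trans: "(\<integral>\<^sup>+x. k (c + x) \<partial>lborel) = (\<integral>\<^sup>+x. k x \<partial>lborel)"
    if [measurable]: "k \<in> borel_measurable borel" for k :: "'a \<Rightarrow> ennreal" and c
  proof -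
    have "(\<integral>\<^sup>+x. k x \<partial>lborel) = (\<integral>\<^sup>+x. k x \<partial>distr lborel borel ((+) c))"
      by (simp add: lborel_distr_plus)
    also have "\<dots> = (\<integral>\<^sup>+x. k (c + x) \<partial>lborel)"
      by (subst nn_integral_distr) auto
    finally show ?thesis by simp
  qed
  let ?B = "ball (0::'a) 1"
  define b :: "'a \<Rightarrow> ennreal" where "b = indicator ?B"
  have [measurable]: "b \<in> borel_measurable borel" unfolding b_def by (intro borel_measurable_indicator) simp
  have 1: "(\<integral>\<^sup>+y. b (x - y) \<partial>lborel) = emeasure lborel ?B" for x :: 'a
  proof -
    have "(\<integral>\<^sup>+y. b (x - y) \<partial>lborel) = (\<integral>\<^sup>+y. b (x - (x + y)) \<partial>lborel)"
      by (rule trans[symmetric]) simp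
    also have "\<dots> = (\<integral>\<^sup>+y. b y \<partial>(lborel :: 'a measure))"
      by (intro nn_integral_cong) (auto simp: b_def indicator_def)
    finally show ?thesis by (simp add: b_def)
  qed
  have "emeasure lborel (f -` ?B) * (\<integral>\<^sup>+x. h x \<partial>lborel)
      = (\<integral>\<^sup>+x. b (f x) * (\<integral>\<^sup>+y. h (f x + y) \<partial>lborel) \<partial>lborel)"
  proof -
    have "(\<integral>\<^sup>+x. b (f x) * (\<integral>\<^sup>+y. h (f x + y) \<partial>lborel) \<partial>lborel)
      = (\<integral>\<^sup>+x. b (f x) * (\<integral>\<^sup>+y. h y \<partial>lborel) \<partial>lborel)"
      by (simp add: trans)
    also have "\<dots> = (\<integral>\<^sup>+x. b (f x) \<partial>lborel) * (\<integral>\<^sup>+y. h y \<partial>lborel)"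
      by (rule nn_integral_multc) measurable
    also have "(\<integral>\<^sup>+x. b (f x) \<partial>lborel) = (\<integral>\<^sup>+x. indicator (f -` ?B) x \<partial>lborel)"
      by (simp add: b_def indicator_vimage)
    also have "\<dots> = emeasure lborel (f -` ?B)"
      using measurable_sets[of f borel borel ?B] by simp
    finally show ?thesis ..
  qed
  also have "\<dots> = (\<integral>\<^sup>+x. (\<integral>\<^sup>+y. b (f x) * h (f x + y) \<partial>lborel) \<partial>lborel)"
    by (simp add: nn_integral_cmult)
  also have "\<dots> = (\<integral>\<^sup>+y. (\<integral>\<^sup>+x. b (f x) * h (f x + y) \<partial>lborel) \<partial>lborel)"
    by (rule lborel_pair.Fubini') measurable
  also have "\<dots> = (\<integral>\<^sup>+y. (\<integral>\<^sup>+x. b (f (- g y + x)) * h (f (- g y + x) + y) \<partial>lborel) \<partial>lborel)"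
    by (intro nn_integral_cong trans[symmetric]) measurable
  also have "\<dots> = (\<integral>\<^sup>+y. (\<integral>\<^sup>+x. b (f x - y) * h (f x) \<partial>lborel) \<partial>lborel)"
    using assms(1) by (simp add: linear_diff fg)
  also have "\<dots> = (\<integral>\<^sup>+x. (\<integral>\<^sup>+y. b (f x - y) * h (f x) \<partial>lborel) \<partial>lborel)"
    by (rule lborel_pair.Fubini') measurable
  also have "\<dots> = (\<integral>\<^sup>+x. emeasure lborel ?B * h (f x) \<partial>lborel)"
    by (simp add: nn_integral_multc 1)
  also have "\<dots> = emeasure lborel ?B * (\<integral>\<^sup>+x. h (f x) \<partial>lborel)"
    by (simp add: nn_integral_cmult)
  finally show ?thesis ..
qed

text \<open>The factor \<open>c\<close> is \<open>1 / \<bar>det f\<bar>\<close>. It is determined by its effect on one set or one function: on the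
unit ball for isometries, and on the Gaussian density in general.\<close>

lemma distr_lborel_linear:
  fixes f :: "'a::euclidean_space \<Rightarrow> 'a"
  assumes f: "linear f" "linear g" and fg: "\<And>x. f (g x) = x"
  obtains c :: real where "c > 0" "distr lborel borel f = density lborel (\<lambda>_. ennreal c)"
    "ennreal c * emeasure lborel (ball (0::'a) 1) = emeasure lborel (f -` ball 0 1)"
proof -
  let ?B = "ball (0::'a) 1"
  have [measurable]: "f \<in> borel_measurable borel"
    using assms(1) by (auto intro: linear_borel_measurable)
  note main = nn_integral_lborel_linear_Fubini[OF f fg]
  have B: "emeasure lborel ?B = ennreal (measure lborel ?B)" "measure lborel ?B > 0"
    using emeasure_lborel_ball_finite[of "0::'a" 1] 
    by (auto simp: emeasure_eq_ennreal_measure less_top content_ball_pos)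
  obtain K where K: "K > 0" "\<And>x. norm (g x) \<le> K * norm x"
    using linear_bounded_pos[OF f(2)] by blast
  have "inj f" using fg f
    by (metis linear_surjective_imp_injective surjI)
  then have gf: "g (f x) = x" for x using fg by (metis injD)
  have sub: "f -` ?B \<subseteq> ball 0 K"
  proof
    fix x assume "x \<in> f -` ?B"
    then have "norm (f x) < 1" by simp
    then have "K * norm (f x) < K * 1" using K(1) by (intro mult_strict_left_mono) auto
    then have "norm x < K" using K(2)[of "f x"] gf by simp
    then show "x \<in> ball 0 K" by simp
  qed
  have "emeasure lborel (f -` ?B) \<le> emeasure lborel (ball (0::'a) K)"
    by (rule emeasure_mono[OF sub]) auto
  then have fin: "emeasure lborel (f -` ?B) < \<infinity>"
    using emeasure_lborel_ball_finite[of "0::'a" K] by simp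
  have "emeasure lborel (f -` ?B) \<noteq> 0"
  proof
    assume "emeasure lborel (f -` ?B) = 0"
    then have "emeasure lborel ?B * \<infinity> = 0" using main[of "\<lambda>_. 1"] by simp
    then have "emeasure lborel ?B = 0" by (subst (asm) mult_eq_0_iff) simp
    then show False using B by simp
  qed
  then have "measure lborel (f -` ?B) > 0" 
    unfolding measure_def enn2real_positive_iff using fin by (simp add: zero_less_iff_neq_zero)
  define c where "c = measure lborel (f -` ?B) / measure lborel ?B"
  have c: "c > 0" unfolding c_def using \<open>measure lborel (f -` ?B) > 0\<close> B(2) by simp
  have cB: "ennreal c * emeasure lborel ?B = emeasure lborel (f -` ?B)"
  proof -
    have "emeasure lborel (f -` ?B) = ennreal (measure lborel (f -` ?B))"
      using fin by (intro emeasure_eq_ennreal_measure) simp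
    also have "\<dots> = ennreal (c * measure lborel ?B)"
      using B(2) by (simp add: c_def)
    also have "\<dots> = ennreal c * emeasure lborel ?B"
      using c B by (simp add: ennreal_mult)
    finally show ?thesis ..
  qed
  have "distr lborel borel f = density lborel (\<lambda>_. ennreal c)"
  proof (rule measure_eqI)
    fix A assume "A \<in> sets (distr lborel borel f)"
    then have [measurable]: "A \<in> sets borel" by simp
    have "ennreal (measure lborel ?B) * emeasure lborel (f -` A) = ennreal (measure lborel ?B) * (ennreal c * emeasure lborel A)"
      using main[of "indicator A"] measurable_sets[of f borel borel A] 
      by (simp add: indicator_vimage[symmetric] B(1)[symmetric] cB[symmetric] ac_simps)
    then have "emeasure lborel (f -` A) = ennreal c * emeasure lborel A"
      using B(2) by (simp add: ennreal_mult_cancel_left)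
    then show "emeasure (distr lborel borel f) A = emeasure (density lborel (\<lambda>_. ennreal c)) A"
      by (simp add: emeasure_distr emeasure_density nn_integral_cmult_indicator)
  qed simp
  then show thesis using that c cB by blast
qed

lemma distr_lborel_orthogonal:
  fixes f :: "'a::euclidean_space \<Rightarrow> 'a"
  assumes "orthogonal_transformation f"
  shows "distr lborel borel f = lborel"
proof -
  obtain g where "linear f" "linear g" "\<And>x. f (g x) = x"
    using orthogonal_transformation_inv[OF assms] orthogonal_transformation_linear
      orthogonal_transformation_surj[OF assms] surj_f_inv_f assms by metis
  then obtain c where c: "c > 0" "distr lborel borel f = density lborel (\<lambda>_. ennreal c)"
    "ennreal c * emeasure lborel (ball (0::'a) 1) = emeasure lborel (f -` ball 0 1)"
    using distr_lborel_linear by blast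
  have "f -` ball 0 1 = ball 0 1"
    using assms by (auto simp: orthogonal_transformation)
  moreover have B: "emeasure lborel (ball (0::'a) 1) = ennreal (measure lborel (ball (0::'a) 1))" 
      "measure lborel (ball (0::'a) 1) > 0"
    using emeasure_lborel_ball_finite[of "0::'a" 1] 
    by (auto simp: emeasure_eq_ennreal_measure less_top content_ball_pos)
  ultimately have "ennreal (c * measure lborel (ball (0::'a) 1)) = ennreal (measure lborel (ball (0::'a) 1))"
    using c(1,3) by (metis ennreal_mult less_imp_le)
  then have "c = 1" using c(1) B(2) by (subst (asm) ennreal_inj) auto
  then show ?thesis using c(2) by (simp add: density_1)
qed

definition gauss_density :: "'a::euclidean_space \<Rightarrow> real" where
  "gauss_density x = (\<Prod>b\<in>Basis. std_normal_density (x \<bullet> b))"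

lemma std_gaussian_eq: "std_gaussian = density lborel (\<lambda>x. ennreal (gauss_density x))"
  by (simp add: std_gaussian_def gauss_density_def)

lemma borel_measurable_gauss_density [measurable]: "gauss_density \<in> borel_measurable borel"
  unfolding gauss_density_def by measurable

lemma gauss_density_exp:
  "gauss_density (x::'a::euclidean_space) = gauss_density (0::'a) * exp (- (norm x)\<^sup>2 / 2)"
proof -
  have "gauss_density x = (\<Prod>b\<in>(Basis::'a set). std_normal_density 0 * exp (- (x \<bullet> b)\<^sup>2 / 2))"
    unfolding gauss_density_def by (intro prod.cong) (auto simp: std_normal_density_def)
  also have "\<dots> = gauss_density (0::'a) * exp (\<Sum>b\<in>Basis. - (x \<bullet> b)\<^sup>2 / 2)"
    by (simp add: prod.distrib gauss_density_def exp_sum)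
  also have "(\<Sum>b\<in>Basis. - (x \<bullet> b)\<^sup>2 / 2) = - (norm x)\<^sup>2 / 2"
    by (simp add: norm_eq_sqrt_inner euclidean_inner[of x x] sum_negf sum_divide_distrib power2_eq_square inner_ge_zero sum_nonneg)
  finally show ?thesis .
qed

lemma gauss_density_pos: "gauss_density x > 0"
  unfolding gauss_density_def by (intro prod_pos) (simp add: normal_density_pos)

lemma gauss_density_mult_exp:
  "gauss_density (y::'a::euclidean_space) = gauss_density (x::'a) * exp (((norm x)\<^sup>2 - (norm y)\<^sup>2) / 2)"
proof -
  have "exp (- (norm y)\<^sup>2 / 2) = exp (- (norm x)\<^sup>2 / 2) * exp (((norm x)\<^sup>2 - (norm y)\<^sup>2) / 2)"
    by (subst exp_add[symmetric]) (simp add: diff_divide_distrib)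
  then show ?thesis
    unfolding gauss_density_exp[of x] gauss_density_exp[of y] by simp
qed

lemma nn_integral_gauss_density:
  "(\<integral>\<^sup>+x. ennreal (gauss_density x) \<partial>lborel) = 1"
proof -
  have "(\<integral>\<^sup>+x. ennreal (gauss_density (x::'a)) \<partial>lborel) 
      = (\<integral>\<^sup>+x. (\<Prod>b\<in>Basis. ennreal (std_normal_density (x \<bullet> b))) \<partial>(lborel :: 'a measure))"
    unfolding gauss_density_def by (simp add: prod_ennreal)
  also have "\<dots> = (\<Prod>b\<in>(Basis::'a set). (\<integral>\<^sup>+x. ennreal (std_normal_density x) \<partial>lborel))"
    by (rule nn_integral_lborel_prod) auto
  also have "(\<integral>\<^sup>+x. ennreal (std_normal_density x) \<partial>lborel) = 1"
    by (subst nn_integral_eq_integral) (auto simp: integral_normal_density)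
  finally show ?thesis by simp
qed

lemma prob_space_std_gaussian: "prob_space (std_gaussian :: 'a::euclidean_space measure)"
  by (intro prob_spaceI) (simp add: std_gaussian_eq emeasure_density nn_integral_gauss_density)

lemma sets_std_gaussian [simp, measurable_cong]: "sets std_gaussian = sets borel"
  by (simp add: std_gaussian_eq)

lemma space_std_gaussian [simp]: "space std_gaussian = UNIV"
  by (simp add: std_gaussian_eq)

lemma distr_std_gaussian_orthogonal:
  fixes f :: "'a::euclidean_space \<Rightarrow> 'a"
  assumes f: "orthogonal_transformation f"
  shows "distr std_gaussian borel f = std_gaussian"
proof -
  have [measurable]: "f \<in> borel_measurable borel"
    using orthogonal_transformation_linear[OF f]
    by (auto intro: linear_borel_measurable)
  have "gauss_density (f x) = gauss_density x" for x
    using f by (subst (1 2) gauss_density_exp) (simp add: orthogonal_transformation_norm)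
  then have "distr std_gaussian borel f = distr (density lborel (\<lambda>x. ennreal (gauss_density (f x)))) borel f"
    by (simp add: std_gaussian_eq)
  also have "\<dots> = density (distr lborel borel f) (\<lambda>x. ennreal (gauss_density x))"
    by (subst density_distr) auto
  finally show ?thesis by (simp add: distr_lborel_orthogonal[OF f] std_gaussian_eq)
qed

lemma std_gaussian_integral_orthogonal:
  fixes f :: "'a::euclidean_space \<Rightarrow> 'a" and h :: "'a \<Rightarrow> 'b::{banach, second_countable_topology}"
  assumes "orthogonal_transformation f" "h \<in> borel_measurable borel"
  shows "(\<integral>x. h (f x) \<partial>std_gaussian) = (\<integral>x. h x \<partial>std_gaussian)"
proof -
  have "f \<in> borel_measurable borel"
    using orthogonal_transformation_linear[OF assms(1)]
    by (auto intro: linear_borel_measurable)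
  then have "(\<integral>x. h x \<partial>distr std_gaussian borel f) = (\<integral>x. h (f x) \<partial>std_gaussian)"
    using assms(2) by (intro integral_distr) (auto cong: measurable_cong_sets)
  then show ?thesis by (simp add: distr_std_gaussian_orthogonal[OF assms(1)])
qed

text \<open>A polynomial of degree 4 is dominated by \<open>exp (\<bar>x\<bar>\<^sup>2 / 4)\<close>, and its product with the density by the
density of a wider Gaussian.\<close>

lemma std_gaussian_integrable_poly:
  fixes h :: "'a::euclidean_space \<Rightarrow> 'b::{banach, second_countable_topology}"
  assumes [measurable]: "h \<in> borel_measurable borel" and h: "\<And>x. norm (h x) \<le> C * (1 + norm x ^ 4)"
  shows "integrable std_gaussian h"
proof -
  define f :: "'a \<Rightarrow> 'a" where "f x = (1 / sqrt 2) *\<^sub>R x" for x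
  define g :: "'a \<Rightarrow> 'a" where "g x = sqrt 2 *\<^sub>R x" for x
  have lf: "linear f" and lg: "linear g" and fg: "\<And>x. f (g x) = x" 
    unfolding f_def g_def by (auto intro!: linearI simp: scaleR_add_right)
  obtain c where c: "c > 0" "distr lborel borel f = density lborel (\<lambda>_. ennreal c)"
    using distr_lborel_linear[OF lf lg fg] by blast
  have [measurable]: "f \<in> borel_measurable borel" unfolding f_def by measurable
  have "(\<integral>\<^sup>+x. ennreal (gauss_density x) \<partial>distr lborel borel f) = ennreal c * (\<integral>\<^sup>+x. ennreal (gauss_density x) \<partial>(lborel::'a measure))"
    unfolding c by (subst nn_integral_density) (auto simp: nn_integral_cmult)
  then have "(\<integral>\<^sup>+x. ennreal (gauss_density (f x)) \<partial>lborel) = ennreal c"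
    by (simp add: nn_integral_distr nn_integral_gauss_density)
  then have int: "integrable lborel (\<lambda>x. gauss_density (f x))"
    by (intro integrableI_nonneg) (auto simp: gauss_density_pos less_imp_le)
  have "integrable lborel (\<lambda>x. gauss_density x *\<^sub>R h x)"
  proof (rule Bochner_Integration.integrable_bound)
    show "integrable lborel (\<lambda>x. (33 * \<bar>C\<bar>) * gauss_density (f x))"
      using int by simp
    show "AE x in lborel. norm (gauss_density x *\<^sub>R h x) \<le> norm ((33 * \<bar>C\<bar>) * gauss_density (f x))"
    proof (rule AE_I2)
      fix x :: 'a
      define t where "t = (norm x)\<^sup>2 / 4"
      have "1 + t + t\<^sup>2 / 2 \<le> exp t" by (rule exp_lower_Taylor_quadratic) (simp add: t_def)
      moreover have "t \<ge> 0" by (simp add: t_def)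
      moreover have "t\<^sup>2 = norm x ^ 4 / 16" by (simp add: t_def power_divide flip: power_mult)
      moreover have "norm x ^ 4 \<ge> 0" by simp
      ultimately have *: "1 + norm x ^ 4 \<le> 33 * exp t" by linarith
      have fx: "gauss_density (f x) = gauss_density x * exp t"
        by (subst gauss_density_mult_exp[of "f x" x]) (simp add: t_def f_def power_mult_distrib power_divide field_simps)
      have "norm (h x) \<le> \<bar>C\<bar> * (1 + norm x ^ 4)"
        using h[of x] by (rule order_trans) (intro mult_right_mono, auto)
      also have "\<dots> \<le> \<bar>C\<bar> * (33 * exp t)" using * by (intro mult_left_mono) auto
      finally show "norm (gauss_density x *\<^sub>R h x) \<le> norm ((33 * \<bar>C\<bar>) * gauss_density (f x))"
        using gauss_density_pos[of x] by (simp add: fx abs_mult mult_left_mono ac_simps)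
    qed
  qed auto
  then show ?thesis
    unfolding std_gaussian_eq by (subst integrable_density) (auto simp: gauss_density_pos less_imp_le)
qed

lemma norm_sq_le_one_plus_pow4: "(norm x)\<^sup>2 \<le> 1 + norm x ^ 4" for x :: "'a::real_normed_vector"
proof -
  have "0 \<le> ((norm x)\<^sup>2 - 1)\<^sup>2" by simp
  also have "\<dots> = norm x ^ 4 - 2 * (norm x)\<^sup>2 + 1"
    by (simp add: power2_diff flip: power_mult)
  finally show ?thesis using zero_le_power2[of "norm x"] by linarith
qed

text \<open>After the substitution \<open>y = f x\<close>, the integral of \<open>F \<circ> f\<close> is \<open>c\<close> times the integral of \<open>F\<close> against the
Gaussian density at \<open>g y\<close>. Both \<open>c\<close>, which is the integral of the density along \<open>f\<close>, and the transported
density are bounded below by \<open>exp u \<ge> 1 + u\<close>, so that only Gaussian moments remain.\<close>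

lemma std_gaussian_linear_image_lower:
  fixes F :: "'a::euclidean_space \<Rightarrow> real" and f :: "'a \<Rightarrow> 'a"
  assumes lin: "linear f" "linear g" and fg: "\<And>x. f (g x) = x"
    and meas [measurable]: "F \<in> borel_measurable borel"
    and F0: "\<And>x. 0 \<le> F x" and FC: "\<And>x. F x \<le> C * (norm x)\<^sup>2"
  obtains c where "c > 0" "c \<ge> 1 + (\<integral>x. ((norm x)\<^sup>2 - (norm (f x))\<^sup>2) / 2 \<partial>std_gaussian)"
    "(\<integral>x. F (f x) \<partial>std_gaussian) \<ge>
      c * (\<integral>y. F y * (1 + ((norm y)\<^sup>2 - (norm (g y))\<^sup>2) / 2) \<partial>std_gaussian)"
proof -
  have [measurable]: "f \<in> borel_measurable borel" "g \<in> borel_measurable borel"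
    using lin by (auto intro: linear_borel_measurable)
  obtain c where c: "c > 0" "distr lborel borel f = density lborel (\<lambda>_. ennreal c)"
    using distr_lborel_linear[OF lin fg] by blast
  have "inj f" using fg lin by (metis linear_surjective_imp_injective surjI)
  then have gf: "g (f x) = x" for x using fg by (metis injD)
  obtain L where L: "L > 0" "\<And>x. norm (f x) \<le> L * norm x"
    using linear_bounded_pos[OF lin(1)] by blast
  obtain L' where L': "L' > 0" "\<And>x. norm (g x) \<le> L' * norm x"
    using linear_bounded_pos[OF lin(2)] by blast
  have FC': "F x \<le> \<bar>C\<bar> * (norm x)\<^sup>2" for x
    using FC[of x] by (rule order_trans) (auto intro: mult_right_mono)
  have transfer: "(\<integral>x. h (f x) \<partial>lborel) = c * (\<integral>y. h y \<partial>lborel)"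
      "integrable lborel (\<lambda>x. h (f x)) \<longleftrightarrow> integrable lborel h"
    if [measurable]: "h \<in> borel_measurable borel" for h :: "'a \<Rightarrow> real"
  proof -
    have "(\<integral>x. h (f x) \<partial>lborel) = (\<integral>x. h x \<partial>distr lborel borel f)"
      by (rule integral_distr[symmetric]) auto
    then show "(\<integral>x. h (f x) \<partial>lborel) = c * (\<integral>y. h y \<partial>lborel)"
      unfolding c(2) using c(1) by (subst (asm) integral_density) auto
    have "integrable lborel (\<lambda>x. h (f x)) \<longleftrightarrow> integrable (distr lborel borel f) h"
      by (rule integrable_distr_eq[symmetric]) auto
    then show "integrable lborel (\<lambda>x. h (f x)) \<longleftrightarrow> integrable lborel h"
      unfolding c(2) using c(1) by (subst (asm) integrable_density) auto
  qed
  have gauss: "(\<integral>x. h x \<partial>std_gaussian) = (\<integral>x. gauss_density x * h x \<partial>lborel)"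
      "integrable std_gaussian h \<longleftrightarrow> integrable lborel (\<lambda>x. gauss_density x * h x)"
    if [measurable]: "h \<in> borel_measurable borel" for h :: "'a \<Rightarrow> real"
    unfolding std_gaussian_eq 
    by (subst integral_density integrable_density; auto simp: gauss_density_pos less_imp_le)+
  have gd_int: "integrable lborel (gauss_density :: 'a \<Rightarrow> real)" "(\<integral>x. gauss_density (x::'a) \<partial>lborel) = 1"
    using nn_integral_gauss_density[where 'a='a]
    by (auto intro!: integrableI_nonneg simp: gauss_density_pos less_imp_le integral_eq_nn_integral)
  have ratio: "gauss_density (h x) \<ge> gauss_density x * (1 + ((norm x)\<^sup>2 - (norm (h x))\<^sup>2) / 2)" 
    for h :: "'a \<Rightarrow> 'a" and x
    unfolding gauss_density_mult_exp[of "h x" x] 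
    by (intro mult_left_mono exp_ge_add_one_self less_imp_le gauss_density_pos)
  have aux: "norm ((a - b) / 2) \<le> a + p" if "b \<le> p" "0 \<le> b" "0 \<le> a" for a b p :: real
    using that by (auto simp: abs_le_iff field_simps)
  have b1: "norm (((norm x)\<^sup>2 - (norm (f x))\<^sup>2) / 2) \<le> (1 + L\<^sup>2) * (1 + norm x ^ 4)" for x
  proof -
    have "(norm (f x))\<^sup>2 \<le> L\<^sup>2 * (norm x)\<^sup>2"
      using power_mono[OF L(2)[of x]] by (simp add: power_mult_distrib)
    then have "norm (((norm x)\<^sup>2 - (norm (f x))\<^sup>2) / 2) \<le> (norm x)\<^sup>2 + L\<^sup>2 * (norm x)\<^sup>2"
      by (intro aux) auto
    also have "\<dots> = (1 + L\<^sup>2) * (norm x)\<^sup>2" by (simp add: distrib_right)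
    also have "\<dots> \<le> (1 + L\<^sup>2) * (1 + norm x ^ 4)"
      using norm_sq_le_one_plus_pow4 by (intro mult_left_mono) auto
    finally show ?thesis .
  qed
  have b2: "norm (F y * (1 + ((norm y)\<^sup>2 - (norm (g y))\<^sup>2) / 2)) \<le> (2 * \<bar>C\<bar> * (2 + L'\<^sup>2)) * (1 + norm y ^ 4)" for y
  proof -
    have "(norm (g y))\<^sup>2 \<le> L'\<^sup>2 * (norm y)\<^sup>2"
      using power_mono[OF L'(2)[of y]] by (simp add: power_mult_distrib)
    then have "\<bar>((norm y)\<^sup>2 - (norm (g y))\<^sup>2) / 2\<bar> \<le> (norm y)\<^sup>2 + L'\<^sup>2 * (norm y)\<^sup>2"
      using aux[of "(norm (g y))\<^sup>2" "L'\<^sup>2 * (norm y)\<^sup>2" "(norm y)\<^sup>2"] by simp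
    then have 1: "\<bar>1 + ((norm y)\<^sup>2 - (norm (g y))\<^sup>2) / 2\<bar> \<le> (2 + L'\<^sup>2) * (1 + (norm y)\<^sup>2)"
      unfolding distrib_right distrib_left using zero_le_power2[of L'] zero_le_power2[of "norm y"] by linarith
    have "norm (F y * (1 + ((norm y)\<^sup>2 - (norm (g y))\<^sup>2) / 2))
       \<le> (\<bar>C\<bar> * (norm y)\<^sup>2) * ((2 + L'\<^sup>2) * (1 + (norm y)\<^sup>2))"
      unfolding real_norm_def abs_mult using F0[of y] FC'[of y] by (intro mult_mono 1) auto
    also have "\<dots> = (\<bar>C\<bar> * (2 + L'\<^sup>2)) * ((norm y)\<^sup>2 + norm y ^ 4)"
      by (simp add: algebra_simps flip: power_add)
    also have "\<dots> \<le> (\<bar>C\<bar> * (2 + L'\<^sup>2)) * (2 * (1 + norm y ^ 4))"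
      using norm_sq_le_one_plus_pow4[of y] by (intro mult_left_mono) auto
    finally show ?thesis by (simp add: algebra_simps)
  qed
  have b3: "norm (F (f x)) \<le> (\<bar>C\<bar> * L\<^sup>2) * (1 + norm x ^ 4)" for x
  proof -
    have "F (f x) \<le> \<bar>C\<bar> * (norm (f x))\<^sup>2" by (rule FC')
    also have "\<dots> \<le> \<bar>C\<bar> * (L\<^sup>2 * (norm x)\<^sup>2)"
      using power_mono[OF L(2)[of x]] by (intro mult_left_mono) (auto simp: power_mult_distrib)
    also have "\<dots> = (\<bar>C\<bar> * L\<^sup>2) * (norm x)\<^sup>2" by simp
    also have "\<dots> \<le> (\<bar>C\<bar> * L\<^sup>2) * (1 + norm x ^ 4)"
      using norm_sq_le_one_plus_pow4 by (intro mult_left_mono) auto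
    finally show ?thesis using F0 by simp
  qed
  let ?u = "\<lambda>x. ((norm x)\<^sup>2 - (norm (f x))\<^sup>2) / 2"
  let ?v = "\<lambda>y. F y * (1 + ((norm y)\<^sup>2 - (norm (g y))\<^sup>2) / 2)"
  have i1: "integrable std_gaussian ?u"
    by (rule std_gaussian_integrable_poly[OF _ b1]) measurable
  have i2: "integrable std_gaussian ?v"
    by (rule std_gaussian_integrable_poly[OF _ b2]) measurable
  have i3: "integrable std_gaussian (\<lambda>x. F (f x))"
    by (rule std_gaussian_integrable_poly[OF _ b3]) measurable
  have "1 + (\<integral>x. ?u x \<partial>std_gaussian) = (\<integral>x. gauss_density (x::'a) \<partial>lborel) + (\<integral>x. gauss_density x * ?u x \<partial>lborel)"
    by (simp add: gd_int gauss)
  also have "\<dots> = (\<integral>x. gauss_density x + gauss_density x * ?u x \<partial>lborel)"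
    using i1 gd_int(1) gauss(2)[of ?u] by (subst Bochner_Integration.integral_add) auto
  also have "\<dots> \<le> (\<integral>x. gauss_density (f x) \<partial>lborel)"
    using i1 gd_int(1) gauss(2)[of ?u] ratio[of _ f] transfer(2)[of gauss_density]
    by (intro integral_mono) (auto simp: distrib_left)
  also have "\<dots> = c" using transfer(1)[of gauss_density] gd_int by simp
  finally have 1: "c \<ge> 1 + (\<integral>x. ?u x \<partial>std_gaussian)" .
  let ?w = "\<lambda>y. gauss_density (g y) * F y"
  have iw: "integrable lborel ?w"
    using transfer(2)[of ?w] i3 gauss(2)[of "\<lambda>x. F (f x)"] by (simp add: gf)
  have "(\<integral>y. ?v y \<partial>std_gaussian) = (\<integral>y. gauss_density y * ?v y \<partial>lborel)"
    by (rule gauss) measurable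
  also have "\<dots> \<le> (\<integral>y. ?w y \<partial>lborel)"
  proof (rule integral_mono[OF _ iw])
    show "integrable lborel (\<lambda>y. gauss_density y * ?v y)" using i2 by (subst (asm) gauss) auto
    show "gauss_density y * ?v y \<le> ?w y" for y
      using mult_right_mono[OF ratio[of y g] F0[of y]] by (simp add: ac_simps)
  qed
  finally have "c * (\<integral>y. ?v y \<partial>std_gaussian) \<le> c * (\<integral>y. ?w y \<partial>lborel)"
    using c by (intro mult_left_mono) auto
  also have "\<dots> = (\<integral>x. ?w (f x) \<partial>lborel)" by (rule transfer(1)[symmetric]) measurable
  also have "\<dots> = (\<integral>x. F (f x) \<partial>std_gaussian)" by (subst gauss) (auto simp: gf)
  finally show thesis using that[OF c(1) 1] by simp
qed

text \<open>The right-hand side is the tangent at the identity of the convex function \<open>f \<mapsto> E F(f G)\<close>. To find the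
tangent without differentiating under the integral, move from the identity to \<open>f\<close> along
\<open>x + s X x\<close> with \<open>X = f - id\<close>, bound the value at time \<open>s\<close> above by convexity and below by the previous
lemma up to \<open>O(s\<^sup>2)\<close>, and let \<open>s\<close> tend to 0.\<close>

lemma std_gaussian_convex_supporting_line:
  fixes F :: "'a::euclidean_space \<Rightarrow> real" and f :: "'a \<Rightarrow> 'a"
  assumes lin: "linear f" and conv: "convex_on UNIV F"
    and F0: "\<And>x. 0 \<le> F x" and FC: "\<And>x. F x \<le> C * (norm x)\<^sup>2"
  shows "(\<integral>x. F (f x) \<partial>std_gaussian) \<ge> (\<integral>x. F x \<partial>std_gaussian)
    + (\<integral>x. (F x - (\<integral>z. F z \<partial>std_gaussian)) * ((f x - x) \<bullet> x) \<partial>std_gaussian)"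
proof -
  interpret prob_space "std_gaussian :: 'a measure" by (rule prob_space_std_gaussian)
  have [measurable]: "f \<in> borel_measurable borel"
    using lin by (auto intro: linear_borel_measurable)
  have "continuous_on UNIV F"
    using conv by (intro convex_on_continuous) auto
  then have meas [measurable]: "F \<in> borel_measurable borel"
    by (rule borel_measurable_continuous_onI)
  have FC': "F x \<le> \<bar>C\<bar> * (norm x)\<^sup>2" for x
    using FC[of x] by (rule order_trans) (auto intro: mult_right_mono)
  have quad: "integrable std_gaussian h" if [measurable]: "h \<in> borel_measurable borel" 
    and h: "\<And>x. \<bar>h x\<bar> \<le> D * (norm x)\<^sup>2" for h :: "'a \<Rightarrow> real" and D
  proof (rule std_gaussian_integrable_poly[where C="\<bar>D\<bar>"])
    fix x
    have "\<bar>h x\<bar> \<le> \<bar>D\<bar> * (norm x)\<^sup>2"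
      using h[of x] by (rule order_trans) (auto intro: mult_right_mono)
    also have "\<dots> \<le> \<bar>D\<bar> * (1 + norm x ^ 4)"
      using norm_sq_le_one_plus_pow4 by (intro mult_left_mono) auto
    finally show "norm (h x) \<le> \<bar>D\<bar> * (1 + norm x ^ 4)" by simp
  qed measurable
  have quart: "integrable std_gaussian (\<lambda>x. F x * h x)" if [measurable]: "h \<in> borel_measurable borel" 
    and h: "\<And>x. \<bar>h x\<bar> \<le> D * (norm x)\<^sup>2" for h :: "'a \<Rightarrow> real" and D
  proof (rule std_gaussian_integrable_poly[where C="\<bar>C\<bar> * \<bar>D\<bar>"])
    fix x
    have "\<bar>h x\<bar> \<le> \<bar>D\<bar> * (norm x)\<^sup>2"
      using h[of x] by (rule order_trans) (auto intro: mult_right_mono)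
    then have "norm (F x * h x) \<le> (\<bar>C\<bar> * (norm x)\<^sup>2) * (\<bar>D\<bar> * (norm x)\<^sup>2)"
      unfolding real_norm_def abs_mult using F0[of x] FC'[of x] by (intro mult_mono) auto
    also have "\<dots> = (\<bar>C\<bar> * \<bar>D\<bar>) * norm x ^ 4" by (simp flip: power_add)
    also have "\<dots> \<le> (\<bar>C\<bar> * \<bar>D\<bar>) * (1 + norm x ^ 4)"
      by (intro mult_left_mono) auto
    finally show "norm (F x * h x) \<le> (\<bar>C\<bar> * \<bar>D\<bar>) * (1 + norm x ^ 4)" .
  qed measurable
  define X where "X x = f x - x" for x
  have linX: "linear X" unfolding X_def using lin by (intro linear_compose_sub linear_id[unfolded id_def])
  have [measurable]: "X \<in> borel_measurable borel" unfolding X_def by measurable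
  obtain L where L: "L > 0" "\<And>x. norm (X x) \<le> L * norm x"
    using linear_bounded_pos[OF linX] by blast
  have Xx: "\<bar>X x \<bullet> y\<bar> \<le> L * norm x * norm y" for x y
    using Cauchy_Schwarz_ineq2[of "X x" y] mult_right_mono[OF L(2)[of x], of "norm y"] by simp
  obtain L1 where L1: "L1 > 0" "\<And>x. norm (f x) \<le> L1 * norm x"
    using linear_bounded_pos[OF lin] by blast
  define EF where "EF = (\<integral>x. F x \<partial>std_gaussian)"
  define EFM where "EFM = (\<integral>x. F (f x) \<partial>std_gaussian)"
  define w where "w = (\<integral>x. F x * (X x \<bullet> x) \<partial>std_gaussian)"
  define \<tau> where "\<tau> = (\<integral>x. X x \<bullet> x \<partial>std_gaussian)"
  define a where "a = L\<^sup>2 / 2 * (\<integral>x. (norm (x::'a))\<^sup>2 \<partial>std_gaussian)"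
  define b where "b = 6 * L\<^sup>2 * (\<integral>x. F x * (norm x)\<^sup>2 \<partial>std_gaussian)"
  have iF: "integrable std_gaussian F"
    by (rule quad[of _ "\<bar>C\<bar>"]) (use F0 FC' in auto)
  have iFM: "integrable std_gaussian (\<lambda>x. F (f x))"
  proof (rule quad[of _ "\<bar>C\<bar> * L1\<^sup>2"])
    fix x
    have "F (f x) \<le> \<bar>C\<bar> * (norm (f x))\<^sup>2" by (rule FC')
    also have "\<dots> \<le> \<bar>C\<bar> * (L1 * norm x)\<^sup>2"
      using L1(2)[of x] by (intro mult_left_mono power_mono) auto
    finally show "\<bar>F (f x)\<bar> \<le> \<bar>C\<bar> * L1\<^sup>2 * (norm x)\<^sup>2"
      using F0 by (simp add: power_mult_distrib)
  qed measurable
  have XxL: "\<bar>X x \<bullet> x\<bar> \<le> L * (norm x)\<^sup>2" for x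
    using Xx[of x x] by (simp add: power2_eq_square)
  have iw: "integrable std_gaussian (\<lambda>x. F x * (X x \<bullet> x))"
    by (rule quart[OF _ XxL]) measurable
  have it: "integrable std_gaussian (\<lambda>x. X x \<bullet> x)"
    by (rule quad[OF _ XxL]) measurable
  have ia: "integrable std_gaussian (\<lambda>x::'a. (norm x)\<^sup>2)"
    by (rule quad[of _ 1]) auto
  have ib: "integrable std_gaussian (\<lambda>x. F x * (norm x)\<^sup>2)"
    by (rule quart[of _ 1]) auto
  have key: "(1 - s * \<tau> - s\<^sup>2 * a) * (EF + s * w - s\<^sup>2 * b) \<le> (1 - s) * EF + s * EFM"
    if s: "0 < s" "s \<le> 1" "s * L \<le> 1/2" "1 - s * \<tau> - s\<^sup>2 * a \<ge> 0" for s
  proof -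
    \<comment> \<open>The condition on \<open>s L\<close> makes \<open>id + s X\<close> invertible with \<open>\<bar>x\<bar> \<le> 2 \<bar>m x\<bar>\<close>.\<close>
    define m where "m x = x + s *\<^sub>R X x" for x
    have linm: "linear m" unfolding m_def
      by (intro linear_compose_add linear_compose_scale_right linX linear_id[unfolded id_def])
    have lower: "norm x \<le> 2 * norm (m x)" for x
    proof -
      have "norm (s *\<^sub>R X x) \<le> s * (L * norm x)" using s L(2)[of x] by simp
      also have "\<dots> \<le> 1/2 * norm x" 
        using mult_right_mono[OF s(3), of "norm x"] by (simp add: mult.assoc)
      finally show ?thesis unfolding m_def using norm_diff_ineq[of x "s *\<^sub>R X x"] by linarith
    qed
    have "inj m"
    proof (rule injI)
      fix x y assume "m x = m y"
      then have "norm (x - y) \<le> 0" using lower[of "x - y"] linm by (simp add: linear_diff)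
      then show "x = y" by simp
    qed
    then obtain g where g: "linear g" "\<And>x. g (m x) = x" "\<And>x. m (g x) = x"
      using linear_injective_isomorphism[OF linm] by blast
    obtain c where c: "c > 0" "c \<ge> 1 + (\<integral>x. ((norm x)\<^sup>2 - (norm (m x))\<^sup>2) / 2 \<partial>std_gaussian)"
      "(\<integral>x. F (m x) \<partial>std_gaussian) \<ge>
        c * (\<integral>y. F y * (1 + ((norm y)\<^sup>2 - (norm (g y))\<^sup>2) / 2) \<partial>std_gaussian)"
      using std_gaussian_linear_image_lower[OF linm g(1,3) meas F0 FC] by blast
    have [measurable]: "m \<in> borel_measurable borel" "g \<in> borel_measurable borel"
      using linm g(1) by (auto intro: linear_borel_measurable)
    have nm: "(norm (m x))\<^sup>2 = (norm x)\<^sup>2 + 2 * s * (X x \<bullet> x) + s\<^sup>2 * (norm (X x))\<^sup>2" for x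
      unfolding m_def power2_norm_eq_inner by (simp add: inner_add inner_commute power2_eq_square algebra_simps)
    have nX: "(norm (X x))\<^sup>2 \<le> L\<^sup>2 * (norm x)\<^sup>2" for x
      using power_mono[OF L(2)[of x]] by (simp add: power_mult_distrib)
    have u: "((norm x)\<^sup>2 - (norm (m x))\<^sup>2) / 2 \<ge> - s * (X x \<bullet> x) - s\<^sup>2 * (L\<^sup>2 / 2 * (norm x)\<^sup>2)" for x
      unfolding nm using mult_left_mono[OF nX[of x], of "s\<^sup>2"] by (simp add: field_simps)
    have c0: "1 - s * \<tau> - s\<^sup>2 * a \<le> c"
    proof -
      have "- s * \<tau> - s\<^sup>2 * a = (\<integral>x. - s * (X x \<bullet> x) - s\<^sup>2 * (L\<^sup>2 / 2 * (norm x)\<^sup>2) \<partial>std_gaussian)"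
        using it ia by (simp add: \<tau>_def a_def)
      also have "\<dots> \<le> (\<integral>x. ((norm x)\<^sup>2 - (norm (m x))\<^sup>2) / 2 \<partial>std_gaussian)"
      proof (rule integral_mono[OF _ _ u])
        show "integrable std_gaussian (\<lambda>x. ((norm x)\<^sup>2 - (norm (m x))\<^sup>2) / 2)"
          unfolding nm using ia it
          by (intro Bochner_Integration.integrable_diff Bochner_Integration.integrable_add 
              Bochner_Integration.integrable_divide integrable_mult_right
              quad[of "\<lambda>x. (norm (X x))\<^sup>2" "L\<^sup>2"]) (auto simp: nX)
      qed (use it ia in auto)
      finally show ?thesis using c(2) by linarith
    qed
    have v: "((norm y)\<^sup>2 - (norm (g y))\<^sup>2) / 2 \<ge> s * (X y \<bullet> y) - s\<^sup>2 * (6 * L\<^sup>2 * (norm y)\<^sup>2)" for y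
    proof -
      \<comment> \<open>Since \<open>x - y\<close> is of order \<open>s\<close>, replacing \<open>x\<close> by \<open>y\<close> in \<open>X x \<bullet> x\<close> costs a term of order \<open>s\<close>.\<close>
      define x where "x = g y"
      have y: "y = x + s *\<^sub>R X x" using g(3)[of y] by (simp add: x_def m_def)
      have nx: "norm x \<le> 2 * norm y" using lower[of x] g(3) by (simp add: x_def)
      have "norm (y - x) = s * norm (X x)" using s by (simp add: y)
      also have "\<dots> \<le> s * (L * (2 * norm y))"
        using s L nx by (intro mult_left_mono order_trans[OF L(2)]) auto
      finally have nyx: "norm (y - x) \<le> 2 * s * L * norm y" by simp
      have "X y \<bullet> y - X x \<bullet> x = X (y - x) \<bullet> x + X y \<bullet> (y - x)"
        using linX by (simp add: linear_diff inner_diff)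
      also have "\<dots> \<le> L * norm (y - x) * norm x + L * norm y * norm (y - x)"
        using Xx[of "y - x" x] Xx[of y "y - x"] by linarith
      also have "\<dots> \<le> L * (2 * s * L * norm y) * (2 * norm y) + L * norm y * (2 * s * L * norm y)"
        using s L nx nyx by (intro add_mono mult_mono mult_left_mono) auto
      also have "\<dots> = s * (6 * L\<^sup>2 * (norm y)\<^sup>2)" by (simp add: power2_eq_square algebra_simps)
      finally have "X x \<bullet> x \<ge> X y \<bullet> y - s * (6 * L\<^sup>2 * (norm y)\<^sup>2)" by simp
      then have "s * (X x \<bullet> x) \<ge> s * (X y \<bullet> y - s * (6 * L\<^sup>2 * (norm y)\<^sup>2))"
        using s by (intro mult_left_mono) auto
      moreover have "(norm y)\<^sup>2 - (norm x)\<^sup>2 \<ge> 2 * s * (X x \<bullet> x)"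
        using nm[of x] g(3)[of y] by (simp add: x_def)
      ultimately show ?thesis by (simp add: x_def power2_eq_square algebra_simps)
    qed
    have "EF + s * w - s\<^sup>2 * b = (\<integral>y. F y + s * (F y * (X y \<bullet> y)) - s\<^sup>2 * (6 * L\<^sup>2 * (F y * (norm y)\<^sup>2)) \<partial>std_gaussian)"
      using iF iw ib by (simp add: EF_def w_def b_def)
    also have "\<dots> \<le> (\<integral>y. F y * (1 + ((norm y)\<^sup>2 - (norm (g y))\<^sup>2) / 2) \<partial>std_gaussian)"
    proof (rule integral_mono)
      obtain D where D: "D > 0" "\<And>x. norm (g x) \<le> D * norm x" 
        using linear_bounded_pos[OF g(1)] by blast
      have "integrable std_gaussian (\<lambda>y. F y * (norm (g y))\<^sup>2)"
        using power_mono[OF D(2)] by (intro quart[of _ "D\<^sup>2"]) (auto simp: power_mult_distrib)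
      then show "integrable std_gaussian (\<lambda>y. F y * (1 + ((norm y)\<^sup>2 - (norm (g y))\<^sup>2) / 2))"
        using iF ib by (simp add: distrib_left right_diff_distrib diff_divide_distrib)
      fix y
      show "F y + s * (F y * (X y \<bullet> y)) - s\<^sup>2 * (6 * L\<^sup>2 * (F y * (norm y)\<^sup>2))
          \<le> F y * (1 + ((norm y)\<^sup>2 - (norm (g y))\<^sup>2) / 2)"
        using mult_left_mono[OF v[of y] F0[of y]] unfolding distrib_left right_diff_distrib
          by (simp add: mult.left_commute[of "F y"])
    qed (use iF iw ib in auto)
    finally have J: "EF + s * w - s\<^sup>2 * b \<le> (\<integral>y. F y * (1 + ((norm y)\<^sup>2 - (norm (g y))\<^sup>2) / 2) \<partial>std_gaussian)" (is "_ \<le> ?J") .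
    have le: "(\<integral>x. F (m x) \<partial>std_gaussian) \<le> (1 - s) * EF + s * EFM"
    proof -
      have cv: "F (m x) \<le> (1 - s) * F x + s * F (f x)" for x
      proof -
        have "m x = (1 - s) *\<^sub>R x + s *\<^sub>R f x" by (simp add: m_def X_def algebra_simps)
        then show ?thesis using convex_onD[OF conv, of s x "f x"] s by simp
      qed
      have "(\<integral>x. F (m x) \<partial>std_gaussian) \<le> (\<integral>x. (1 - s) * F x + s * F (f x) \<partial>std_gaussian)"
      proof (rule integral_mono[OF _ _ cv])
        show "integrable std_gaussian (\<lambda>x. (1 - s) * F x + s * F (f x))" using iF iFM by simp
        then show "integrable std_gaussian (\<lambda>x. F (m x))"
          by (rule Bochner_Integration.integrable_bound) (use cv F0 s in \<open>auto simp: abs_of_nonneg\<close>)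
      qed
      also have "\<dots> = (1 - s) * EF + s * EFM" using iF iFM by (simp add: EF_def EFM_def)
      finally show ?thesis .
    qed
    have EF0: "0 \<le> (\<integral>x. F (m x) \<partial>std_gaussian)" using F0 by (intro integral_nonneg_AE) auto
    show ?thesis
    proof (cases "EF + s * w - s\<^sup>2 * b \<ge> 0")
      case True
      have "(1 - s * \<tau> - s\<^sup>2 * a) * (EF + s * w - s\<^sup>2 * b) \<le> c * ?J"
        using True c0 J c(1) by (intro mult_mono) auto
      then show ?thesis using c(3) le by linarith
    next
      case False
      then have "(1 - s * \<tau> - s\<^sup>2 * a) * (EF + s * w - s\<^sup>2 * b) \<le> 0"
        using s(4) by (simp add: mult_nonneg_nonpos)
      then show ?thesis using EF0 le by linarith
    qed
  qed
  have lim: "EF + (w - \<tau> * EF) \<le> EFM"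
  proof -
    \<comment> \<open>The polynomial \<open>q\<close> is what remains of the product in \<open>key\<close> after subtraction of \<open>(1 - s) EF\<close> and division by \<open>s\<close>, up to \<open>EF\<close>.\<close>
    define q where "q s = w - \<tau> * EF - s * (\<tau> * w + a * EF + b) + s\<^sup>2 * (\<tau> * b - a * w) + s^3 * a * b" for s
    have "eventually (\<lambda>s. q s \<le> EFM - EF) (at_right (0::real))"
    proof -
      have "((\<lambda>s. 1 - s * \<tau> - s\<^sup>2 * a) \<longlongrightarrow> 1 - 0 * \<tau> - 0\<^sup>2 * a) (at_right 0)"
        by (intro tendsto_intros)
      then have "eventually (\<lambda>s. 1 - s * \<tau> - s\<^sup>2 * a > 0) (at_right 0)"
        by (intro order_tendstoD(1)) auto
      moreover have "eventually (\<lambda>s. s \<in> {0<..<min 1 (1/(2*L))}) (at_right (0::real))"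
        using L(1) by (intro eventually_at_right_real) auto
      ultimately show ?thesis
      proof eventually_elim
        case (elim s)
        then have "s * L \<le> 1/2" using L(1) by (auto simp: field_simps)
        with elim have "(1 - s * \<tau> - s\<^sup>2 * a) * (EF + s * w - s\<^sup>2 * b) \<le> (1 - s) * EF + s * EFM"
          by (intro key) auto
        moreover have "(1 - s * \<tau> - s\<^sup>2 * a) * (EF + s * w - s\<^sup>2 * b) - (1 - s) * EF = s * (EF + q s)"
          unfolding q_def by (simp add: power2_eq_square power3_eq_cube algebra_simps)
        ultimately have "s * (EF + q s) \<le> s * EFM" by linarith
        then show ?case using elim by (auto simp: mult_le_cancel_left)
      qed
    qed
    moreover have "(q \<longlongrightarrow> w - \<tau> * EF - 0 * (\<tau> * w + a * EF + b) + 0\<^sup>2 * (\<tau> * b - a * w) + 0^3 * a * b) (at_right 0)"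
      unfolding q_def by (intro tendsto_intros)
    ultimately have "w - \<tau> * EF - 0 * (\<tau> * w + a * EF + b) + 0\<^sup>2 * (\<tau> * b - a * w) + 0^3 * a * b \<le> EFM - EF"
      by (intro tendsto_upperbound) auto
    then show ?thesis by simp
  qed
  have "(\<integral>x. (F x - EF) * ((f x - x) \<bullet> x) \<partial>std_gaussian) = w - \<tau> * EF"
    using iw it by (simp add: left_diff_distrib w_def \<tau>_def X_def[symmetric])
  then show ?thesis using lim by (simp add: EF_def EFM_def)
qed

section \<open>Minkowski functionals\<close>

lemma scaleR_image_iff:
  fixes x :: "'a::real_vector"
  shows "s > 0 \<Longrightarrow> x \<in> (*\<^sub>R) s ` K \<longleftrightarrow> (1/s) *\<^sub>R x \<in> K"
  by (auto simp: image_iff intro!: bexI[of _ "(1/s) *\<^sub>R x"])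

lemma body_norm_le:
  assumes "s > 0" "(1/s) *\<^sub>R x \<in> K"
  shows "body_norm K x \<le> s"
  unfolding body_norm_def
  by (rule cInf_lower) (use assms in \<open>auto intro!: bdd_belowI[of _ 0] simp: scaleR_image_iff simp del: image_iff\<close>)

lemma body_norm_set_nonempty:
  fixes x :: "'a::real_normed_vector"
  assumes "r > 0" "ball 0 r \<subseteq> K"
  shows "{s. 0 < s \<and> x \<in> (*\<^sub>R) s ` K} \<noteq> {}"
proof -
  define s where "s = norm x / r + 1"
  have s: "s > 0" using assms by (auto simp: s_def add_nonneg_pos)
  have "norm ((1/s) *\<^sub>R x) < r" using s assms(1) by (simp add: s_def field_simps)
  then have "(1/s) *\<^sub>R x \<in> K" using assms(2) by auto
  with s show ?thesis using scaleR_image_iff[of s x K] by blast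
qed

text \<open>Convexity and \<open>0 \<in> K\<close> make the set of admissible dilation factors upward closed, so the infimum may be
replaced by any larger number.\<close>

lemma body_norm_lessD:
  fixes x :: "'a::real_normed_vector"
  assumes "r > 0" "ball 0 r \<subseteq> K" "convex K" "body_norm K x < s"
  shows "s > 0" "(1/s) *\<^sub>R x \<in> K"
proof -
  obtain t where t: "0 < t" "x \<in> (*\<^sub>R) t ` K" "t < s"
    using cInf_lessD[OF body_norm_set_nonempty[OF assms(1,2)], of x s] assms(4)
    unfolding body_norm_def by auto
  then show "s > 0" by simp
  have "0 \<in> K" "(1/t) *\<^sub>R x \<in> K" using assms(1,2) t scaleR_image_iff[of t x K] by auto
  then have "(1 - t/s) *\<^sub>R 0 + (t/s) *\<^sub>R (1/t) *\<^sub>R x \<in> K"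
    using t by (intro convexD[OF assms(3)]) auto
  then show "(1/s) *\<^sub>R x \<in> K" using t by simp
qed

lemma body_norm_nonneg:
  fixes x :: "'a::real_normed_vector"
  assumes "r > 0" "ball 0 r \<subseteq> K"
  shows "0 \<le> body_norm K x"
  unfolding body_norm_def by (rule cInf_greatest[OF body_norm_set_nonempty[OF assms]]) auto

lemma body_norm_le_norm:
  fixes x :: "'a::real_normed_vector"
  assumes "r > 0" "ball 0 r \<subseteq> K"
  shows "body_norm K x \<le> norm x / r"
proof (rule dense_ge)
  fix s assume s: "norm x / r < s"
  then have s0: "s > 0" using assms(1) by (meson divide_nonneg_pos norm_ge_zero order_le_less_trans)
  have "norm ((1/s) *\<^sub>R x) < r" using s s0 assms(1) by (simp add: field_simps)
  then show "body_norm K x \<le> s" using s0 assms(2) by (intro body_norm_le) auto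
qed

text \<open>Lower bounds for the Minkowski functional come from functionals bounded on the body.\<close>

lemma body_norm_ge:
  fixes x :: "'a::real_normed_vector"
  assumes "r > 0" "ball 0 r \<subseteq> K" "\<And>k. k \<in> K \<Longrightarrow> p k \<le> a" 
    and hom: "\<And>c x. c > 0 \<Longrightarrow> p (c *\<^sub>R x) = c * p x"
  shows "p x \<le> a * body_norm K x"
proof -
  have *: "p x \<le> a * s" if "0 < s" "x \<in> (*\<^sub>R) s ` K" for s
    using that assms(3) hom by (auto simp: mult.commute)
  have a: "a \<ge> 0"
  proof -
    have "p 0 = 0" using hom[of 2 0] by simp
    moreover have "0 \<in> K" using assms(1,2) by (meson centre_in_ball subsetD)
    ultimately show ?thesis using assms(3)[of 0] by simp
  qed
  show ?thesis
  proof (cases "a = 0")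
    case True
    then show ?thesis using * body_norm_set_nonempty[OF assms(1,2), of x] by fastforce
  next
    case False
    with a have "p x / a \<le> body_norm K x"
      unfolding body_norm_def
      by (intro cInf_greatest[OF body_norm_set_nonempty[OF assms(1,2)]]) (use * in \<open>auto simp: field_simps\<close>)
    then show ?thesis using False a by (simp add: field_simps)
  qed
qed

lemma body_norm_add:
  fixes x y :: "'a::real_normed_vector"
  assumes K: "r > 0" "ball 0 r \<subseteq> K" "convex K"
  shows "body_norm K (x + y) \<le> body_norm K x + body_norm K y"
proof (rule field_le_epsilon)
  fix e :: real assume e: "e > 0"
  define s t where "s = body_norm K x + e/2" and "t = body_norm K y + e/2"
  have s: "s > 0" "(1/s) *\<^sub>R x \<in> K" using body_norm_lessD[OF K, of x s] e by (auto simp: s_def)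
  have t: "t > 0" "(1/t) *\<^sub>R y \<in> K" using body_norm_lessD[OF K, of y t] e by (auto simp: t_def)
  have "(s/(s+t)) *\<^sub>R (1/s) *\<^sub>R x + (t/(s+t)) *\<^sub>R (1/t) *\<^sub>R y \<in> K"
    using s t by (intro convexD[OF K(3)]) (auto simp: add_divide_distrib[symmetric])
  then have "(1/(s+t)) *\<^sub>R (x + y) \<in> K" using s t by (simp add: scaleR_add_right)
  then have "body_norm K (x + y) \<le> s + t" using s t by (intro body_norm_le) auto
  then show "body_norm K (x + y) \<le> body_norm K x + body_norm K y + e" by (simp add: s_def t_def)
qed

lemma body_norm_scaleR:
  fixes x :: "'a::real_normed_vector"
  assumes K: "r > 0" "ball 0 r \<subseteq> K" "convex K" and c: "c > 0"
  shows "body_norm K (c *\<^sub>R x) = c * body_norm K x"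
proof -
  have le: "body_norm K (c *\<^sub>R x) \<le> c * body_norm K x" if "c > 0" for c x
  proof (rule dense_ge)
    fix s assume "c * body_norm K x < s"
    then have "body_norm K x < s / c" using that by (simp add: field_simps)
    from body_norm_lessD[OF K this] that show "body_norm K (c *\<^sub>R x) \<le> s"
      by (intro body_norm_le) (auto simp: field_simps)
  qed
  have "body_norm K x \<le> (1/c) * body_norm K (c *\<^sub>R x)"
    using le[of "1/c" "c *\<^sub>R x"] c by simp
  then show ?thesis using le[OF c, of x] c by (simp add: field_simps)
qed

lemma body_norm_convex:
  fixes K :: "'a::real_normed_vector set"
  assumes K: "r > 0" "ball 0 r \<subseteq> K" "convex K"
  shows "convex_on UNIV (\<lambda>x. (body_norm K x)\<^sup>2)"
proof (rule convex_onI)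
  fix t :: real and x y :: 'a assume t: "0 < t" "t < 1"
  let ?p = "body_norm K"
  have "?p ((1 - t) *\<^sub>R x + t *\<^sub>R y) \<le> (1 - t) * ?p x + t * ?p y"
    using body_norm_add[OF K, of "(1 - t) *\<^sub>R x" "t *\<^sub>R y"] t by (simp add: body_norm_scaleR[OF K])
  then have "(?p ((1 - t) *\<^sub>R x + t *\<^sub>R y))\<^sup>2 \<le> ((1 - t) * ?p x + t * ?p y)\<^sup>2"
    using body_norm_nonneg[OF K(1,2)] by (intro power_mono) auto
  also have "\<dots> = (1 - t) * (?p x)\<^sup>2 + t * (?p y)\<^sup>2 - t * (1 - t) * (?p x - ?p y)\<^sup>2"
    by (simp add: power2_eq_square algebra_simps)
  also have "\<dots> \<le> (1 - t) * (?p x)\<^sup>2 + t * (?p y)\<^sup>2" using t by simp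
  finally show "(?p ((1 - t) *\<^sub>R x + t *\<^sub>R y))\<^sup>2 \<le> (1 - t) * (?p x)\<^sup>2 + t * (?p y)\<^sup>2" .
qed simp

lemma body_norm_antimono:
  fixes x :: "'a::real_normed_vector"
  assumes "r > 0" "ball 0 r \<subseteq> K" "K \<subseteq> L"
  shows "body_norm L x \<le> body_norm K x"
  unfolding body_norm_def
  using body_norm_set_nonempty[OF assms(1,2), of x] assms(3)
  by (intro cInf_superset_mono) (auto intro!: bdd_belowI[of _ 0])

lemma body_norm_scaled_body:
  fixes x :: "'a::real_normed_vector"
  assumes K: "r > 0" "ball 0 r \<subseteq> K" "convex K" and c: "c > 0"
  shows "body_norm ((*\<^sub>R) c ` K) x = body_norm K x / c"
proof -
  have "{s. 0 < s \<and> x \<in> (*\<^sub>R) s ` (*\<^sub>R) c ` K} = {s. 0 < s \<and> (1/c) *\<^sub>R x \<in> (*\<^sub>R) s ` K}"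
  proof (intro Collect_cong conj_cong refl)
    fix s :: real assume s: "0 < s"
    show "x \<in> (*\<^sub>R) s ` (*\<^sub>R) c ` K \<longleftrightarrow> (1/c) *\<^sub>R x \<in> (*\<^sub>R) s ` K"
      using s c by (simp add: scaleR_image_iff mult.commute)
  qed
  then have "body_norm ((*\<^sub>R) c ` K) x = body_norm K ((1/c) *\<^sub>R x)"
    by (simp add: body_norm_def)
  then show ?thesis using body_norm_scaleR[OF K, of "1/c" x] c by simp
qed

lemma body_norm_linear_image:
  assumes "linear g" "inj g"
  shows "body_norm (g ` K) (g x) = body_norm K x"
proof -
  have "g x \<in> (*\<^sub>R) s ` g ` K \<longleftrightarrow> x \<in> (*\<^sub>R) s ` K" for s
  proof -
    have "(*\<^sub>R) s ` g ` K = g ` (*\<^sub>R) s ` K"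
      using assms(1) by (simp add: image_image linear_cmul)
    then show ?thesis using assms(2) by (simp add: inj_image_mem_iff)
  qed
  then show ?thesis by (simp add: body_norm_def)
qed

section \<open>Complex interpolation on the strip\<close>

lemma closure_strip: "closure strip = {z. 0 \<le> Re z \<and> Re z \<le> 1}"
proof
  have "closed {z. 0 \<le> Re z \<and> Re z \<le> 1}"
    by (intro closed_Collect_conj closed_halfspace_Re_ge closed_halfspace_Re_le)
  then show "closure strip \<subseteq> {z. 0 \<le> Re z \<and> Re z \<le> 1}"
    by (intro closure_minimal) (auto simp: strip_def)
  show "{z. 0 \<le> Re z \<and> Re z \<le> 1} \<subseteq> closure strip"
  proof
    fix z assume z: "z \<in> {z. 0 \<le> Re z \<and> Re z \<le> 1}"
    show "z \<in> closure strip"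
      unfolding closure_approachable
    proof (intro allI impI)
      fix e :: real assume e: "e > 0"
      define d where "d = min 1 e"
      have d: "0 < d" "d \<le> 1" "d \<le> e" using e by (auto simp: d_def)
      define w where "w = z + of_real (d * (1/2 - Re z))"
      have "Re w = (1 - d) * Re z + d / 2" by (simp add: w_def algebra_simps)
      moreover have "0 \<le> (1 - d) * Re z" "(1 - d) * Re z \<le> 1 - d" 
        using d z mult_left_mono[of "Re z" 1 "1 - d"] by auto
      ultimately have "w \<in> strip" using d by (auto simp: strip_def)
      moreover have "dist w z < e"
      proof -
        have "dist w z = d * \<bar>1/2 - Re z\<bar>" using d by (simp add: w_def dist_norm abs_mult del: of_real_mult of_real_diff)
        also have "\<dots> \<le> d * (1/2)" using d z by (intro mult_left_mono) (auto simp: abs_if)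
        finally show ?thesis using d by simp
      qed
      ultimately show "\<exists>w\<in>strip. dist w z < e" by blast
    qed
  qed
qed

lemma open_strip: "open strip"
  unfolding strip_def by (intro open_Collect_conj open_halfspace_Re_gt open_halfspace_Re_lt)

text \<open>Hadamard's three lines theorem. After normalization to the bound 1 by \<open>a\<^sup>z\<^sup>-\<^sup>1 b\<^sup>-\<^sup>z\<close>, the factor
\<open>exp (\<delta> (z\<^sup>2 - 1))\<close> decays at infinity in the strip and has modulus at most 1 there. So the maximum
principle on a long rectangle applies, and \<open>\<delta>\<close> tends to 0.\<close>

theorem three_lines:
  assumes hol: "f holomorphic_on strip" and cont: "continuous_on (closure strip) f"
    and bdd: "bounded (f ` closure strip)"
    and a: "a > 0" "\<And>t::real. cmod (f (\<i> * of_real t)) \<le> a"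
    and b: "b > 0" "\<And>t::real. cmod (f (1 + \<i> * of_real t)) \<le> b"
    and \<theta>: "0 \<le> \<theta>" "\<theta> \<le> 1"
  shows "cmod (f (of_real \<theta>)) \<le> a powr (1 - \<theta>) * b powr \<theta>"
proof -
  obtain M where M: "M > 0" "\<And>z. z \<in> closure strip \<Longrightarrow> cmod (f z) \<le> M"
    using bdd unfolding bounded_pos by auto
  define A where "A = exp (\<bar>ln a\<bar> + \<bar>ln b\<bar>)"
  have bound: "cmod (f (of_real \<theta>)) \<le> a powr (1 - \<theta>) * b powr \<theta> * exp (\<delta> * (1 - \<theta>\<^sup>2))" if \<delta>: "\<delta> > 0" for \<delta> :: real
  proof -
    define h where "h z = exp ((z - 1) * of_real (ln a) - z * of_real (ln b) + of_real \<delta> * (z\<^sup>2 - 1))" for z :: complex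
    have nh: "cmod (h z) = exp ((Re z - 1) * ln a - Re z * ln b + \<delta> * ((Re z)\<^sup>2 - (Im z)\<^sup>2 - 1))" for z
      by (simp add: h_def norm_exp_eq_Re power2_eq_square)
    \<comment> \<open>The height of the rectangle makes the decaying factor beat the crude bound \<open>M A\<close>.\<close>
    define R where "R = sqrt (\<bar>ln (M * A)\<bar> / \<delta>) + 1"
    have R: "R > 0" by (simp add: R_def add_nonneg_pos \<delta> less_imp_le)
    have "\<bar>ln (M * A)\<bar> / \<delta> \<le> R\<^sup>2"
      using \<delta> by (simp add: R_def power2_sum)
    then have R2: "M * A * exp (- (\<delta> * R\<^sup>2)) \<le> 1"
    proof -
      assume "\<bar>ln (M * A)\<bar> / \<delta> \<le> R\<^sup>2"
      then have "ln (M * A) \<le> \<delta> * R\<^sup>2" using \<delta> by (simp add: field_simps)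
      then have "exp (ln (M * A)) \<le> exp (\<delta> * R\<^sup>2)" by simp
      then have "M * A \<le> exp (\<delta> * R\<^sup>2)" using M(1) by (simp add: A_def)
      then show ?thesis by (simp add: exp_minus field_simps)
    qed
    let ?S = "cbox (Complex 0 (-R)) (Complex 1 R)"
    have S: "z \<in> ?S \<longleftrightarrow> 0 \<le> Re z \<and> Re z \<le> 1 \<and> -R \<le> Im z \<and> Im z \<le> R" for z
      by (auto simp: in_cbox_complex_iff)
    have "cmod (f (of_real \<theta>) * h (of_real \<theta>)) \<le> 1"
    proof (rule maximum_modulus_frontier[where f = "\<lambda>z. f z * h z" and S = ?S])
      have "interior ?S \<subseteq> strip" by (auto simp: strip_def in_box_complex_iff)
      then show "(\<lambda>z. f z * h z) holomorphic_on interior ?S"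
        unfolding h_def by (intro holomorphic_intros holomorphic_on_subset[OF hol])
      show "continuous_on (closure ?S) (\<lambda>z. f z * h z)"
        unfolding h_def by (intro continuous_intros continuous_on_subset[OF cont]) (auto simp: closure_strip S)
      fix z assume "z \<in> frontier ?S"
      then have z: "z \<in> ?S" "z \<notin> box (Complex 0 (-R)) (Complex 1 R)" by (auto simp: frontier_cbox)
      then have zc: "z \<in> closure strip" by (simp add: S closure_strip)
      consider "Re z = 0" | "Re z = 1" | "\<bar>Im z\<bar> = R"
        using z by (auto simp: S in_box_complex_iff)
      then show "cmod (f z * h z) \<le> 1"
      proof cases
        case 1
        then have "z = \<i> * of_real (Im z)" by (simp add: complex_eq_iff)
        then have "cmod (f z) \<le> a" using a(2) by metis
        moreover have "cmod (h z) \<le> exp (- ln a)" unfolding nh using 1 \<delta> by (simp add: algebra_simps)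
        ultimately have "cmod (f z) * cmod (h z) \<le> a * exp (- ln a)" using a by (intro mult_mono) auto
        then show ?thesis using a by (simp add: norm_mult exp_minus)
      next
        case 2
        then have "z = 1 + \<i> * of_real (Im z)" by (simp add: complex_eq_iff)
        then have "cmod (f z) \<le> b" using b(2) by metis
        moreover have "cmod (h z) \<le> exp (- ln b)" unfolding nh using 2 \<delta> by (simp add: algebra_simps)
        ultimately have "cmod (f z) * cmod (h z) \<le> b * exp (- ln b)" using b by (intro mult_mono) auto
        then show ?thesis using b by (simp add: norm_mult exp_minus)
      next
        case 3
        have x: "0 \<le> Re z" "Re z \<le> 1" using z by (auto simp: S)
        have "\<bar>Re z - 1\<bar> * \<bar>ln a\<bar> \<le> 1 * \<bar>ln a\<bar>" "\<bar>Re z\<bar> * \<bar>ln b\<bar> \<le> 1 * \<bar>ln b\<bar>"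
          using x by (intro mult_right_mono; simp)+
        then have "(Re z - 1) * ln a \<le> \<bar>ln a\<bar>" "- (Re z * ln b) \<le> \<bar>ln b\<bar>"
          using abs_ge_self[of "(Re z - 1) * ln a"] abs_ge_minus_self[of "Re z * ln b"]
          unfolding abs_mult by linarith+
        moreover have "\<delta> * ((Re z)\<^sup>2 - (Im z)\<^sup>2 - 1) \<le> \<delta> * (- R\<^sup>2)"
        proof -
          have "(Re z)\<^sup>2 \<le> 1" using x by (simp add: power_le_one)
          moreover have "(Im z)\<^sup>2 = R\<^sup>2" using 3 by (metis power2_abs)
          ultimately show ?thesis using \<delta> by (intro mult_left_mono) auto
        qed
        ultimately have "cmod (h z) \<le> exp (\<bar>ln a\<bar> + \<bar>ln b\<bar> + - (\<delta> * R\<^sup>2))"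
          unfolding nh exp_le_cancel_iff by linarith
        then have "cmod (h z) \<le> A * exp (- (\<delta> * R\<^sup>2))" unfolding A_def by (simp only: exp_add)
        then have "cmod (f z) * cmod (h z) \<le> M * (A * exp (- (\<delta> * R\<^sup>2)))"
          using M zc by (intro mult_mono) auto
        then show ?thesis using R2 by (simp add: norm_mult)
      qed
    qed (use \<theta> R in \<open>auto simp: S\<close>)
    then have *: "cmod (f (of_real \<theta>)) * exp ((\<theta> - 1) * ln a - \<theta> * ln b + \<delta> * (\<theta>\<^sup>2 - 1)) \<le> 1"
      by (simp add: norm_mult nh)
    have "exp ((\<theta> - 1) * ln a - \<theta> * ln b + \<delta> * (\<theta>\<^sup>2 - 1)) * exp ((1 - \<theta>) * ln a + \<theta> * ln b + \<delta> * (1 - \<theta>\<^sup>2)) = 1"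
      by (subst exp_add[symmetric]) (simp add: algebra_simps)
    then have "cmod (f (of_real \<theta>)) = cmod (f (of_real \<theta>)) * exp ((\<theta> - 1) * ln a - \<theta> * ln b + \<delta> * (\<theta>\<^sup>2 - 1))
       * exp ((1 - \<theta>) * ln a + \<theta> * ln b + \<delta> * (1 - \<theta>\<^sup>2))"
      by (simp only: mult.assoc mult_1_right)
    also have "\<dots> \<le> 1 * exp ((1 - \<theta>) * ln a + \<theta> * ln b + \<delta> * (1 - \<theta>\<^sup>2))"
      using * by (intro mult_right_mono) auto
    also have "\<dots> = a powr (1 - \<theta>) * b powr \<theta> * exp (\<delta> * (1 - \<theta>\<^sup>2))"
      using a b by (simp add: powr_def exp_add)
    finally show ?thesis .
  qed
  have "((\<lambda>\<delta>. a powr (1 - \<theta>) * b powr \<theta> * exp (\<delta> * (1 - \<theta>\<^sup>2))) \<longlongrightarrow> a powr (1 - \<theta>) * b powr \<theta> * exp (0 * (1 - \<theta>\<^sup>2))) (at_right 0)"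
    by (intro tendsto_intros)
  moreover have "eventually (\<lambda>\<delta>. cmod (f (of_real \<theta>)) \<le> a powr (1 - \<theta>) * b powr \<theta> * exp (\<delta> * (1 - \<theta>\<^sup>2))) (at_right 0)"
    using eventually_at_right_less[of 0] by eventually_elim (rule bound)
  ultimately have "cmod (f (of_real \<theta>)) \<le> a powr (1 - \<theta>) * b powr \<theta> * exp (0 * (1 - \<theta>\<^sup>2))"
    by (intro tendsto_lowerbound) auto
  then show ?thesis by simp
qed

definition cinner :: "complex ^ 'n \<Rightarrow> complex ^ 'n \<Rightarrow> complex" where
  "cinner x y = (\<Sum>i\<in>UNIV. x $ i * cnj (y $ i))"

text \<open>Complex linear and conjugate linear maps are treated together: \<open>\<sigma>\<close> is the identity or the
conjugation.\<close>

definition semilinear :: "(complex \<Rightarrow> complex) \<Rightarrow> (complex ^ 'n \<Rightarrow> complex ^ 'n) \<Rightarrow> bool" where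
  "semilinear \<sigma> g \<longleftrightarrow> \<sigma> \<in> {id, cnj} \<and> linear g \<and> (\<forall>c x. g (c *s x) = \<sigma> c *s g x)"

lemma semilinear_expand:
  assumes "semilinear \<sigma> g"
  shows "g x $ i = (\<Sum>j\<in>UNIV. \<sigma> (x $ j) * g (axis j 1) $ i)"
proof -
  have "g x = g (\<Sum>j\<in>UNIV. x $ j *s axis j 1)" by (simp add: basis_expansion)
  also have "\<dots> = (\<Sum>j\<in>UNIV. \<sigma> (x $ j) *s g (axis j 1))"
    using assms by (simp add: semilinear_def linear_sum)
  finally show ?thesis by simp
qed

text \<open>Conjugation of the argument compensates a conjugate linear \<open>g\<close>, so holomorphy is preserved in both
cases; the strip is symmetric.\<close>

lemma strip_functions_semilinear:
  assumes g: "semilinear \<sigma> g" and f: "f \<in> strip_functions"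
  shows "(\<lambda>z. g (f (\<sigma> z))) \<in> strip_functions"
proof -
  have \<sigma>: "\<sigma> = id \<or> \<sigma> = cnj" and lin: "linear g" using g by (auto simp: semilinear_def)
  have cs: "\<sigma> z \<in> closure strip" if "z \<in> closure strip" for z using \<sigma> that by (auto simp: closure_strip)
  have b: "bounded (f ` closure strip)" and c: "continuous_on (closure strip) f" 
    and h: "\<And>i. (\<lambda>z. f z $ i) holomorphic_on strip"
    using f by (auto simp: strip_functions_def)
  have "bounded (g ` (f ` closure strip))"
    using b lin by (intro bounded_linear_image[of "f ` closure strip"]) (simp_all add: linear_conv_bounded_linear)
  then have 1: "bounded ((\<lambda>z. g (f (\<sigma> z))) ` closure strip)"
    by (rule bounded_subset) (use cs in auto)
  have "continuous_on UNIV \<sigma>" using \<sigma> by (auto intro: continuous_intros simp: id_def)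
  then have "continuous_on (closure strip) (\<lambda>z. f (\<sigma> z))"
    using cs by (intro continuous_on_compose2[OF c]) (auto intro: continuous_on_subset)
  then have 2: "continuous_on (closure strip) (\<lambda>z. g (f (\<sigma> z)))"
    using linear_continuous_on_compose[OF _ lin] by blast
  have 3: "(\<lambda>z. \<sigma> (f (\<sigma> z) $ j)) holomorphic_on strip" for j
    using \<sigma>
  proof
    assume "\<sigma> = cnj"
    moreover have "cnj ` strip = strip"
      by (auto simp: strip_def intro!: image_eqI[of _ cnj "cnj _"])
    ultimately show ?thesis
      using holomorphic_on_compose_cnj_cnj[of "\<lambda>z. f z $ j" strip] h[of j] open_strip by (simp add: o_def)
  qed (use h in simp)
  have "(\<lambda>z. g (f (\<sigma> z)) $ i) holomorphic_on strip" for i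
  proof -
    have "(\<lambda>z. g (f (\<sigma> z)) $ i) = (\<lambda>z. \<Sum>j\<in>UNIV. \<sigma> (f (\<sigma> z) $ j) * g (axis j 1) $ i)"
      by (rule ext, rule semilinear_expand[OF g])
    then show ?thesis by (simp only:) (intro holomorphic_intros 3)
  qed
  with 1 2 show ?thesis by (simp add: strip_functions_def)
qed

text \<open>The real point \<open>\<theta>\<close> is fixed by \<open>\<sigma>\<close>, and the boundary lines are mapped to themselves.\<close>

lemma interp_semilinear_image:
  assumes g: "semilinear \<sigma> g" and K: "g ` K0 \<subseteq> L0" "g ` K1 \<subseteq> L1"
  shows "g ` interp K0 K1 \<theta> \<subseteq> interp L0 L1 \<theta>"
proof
  fix y assume "y \<in> g ` interp K0 K1 \<theta>"
  then obtain f where f: "f \<in> strip_functions" "y = g (f (of_real \<theta>))"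
    "\<And>t::real. f (\<i> * of_real t) \<in> K0" "\<And>t::real. f (1 + \<i> * of_real t) \<in> K1"
    by (auto simp: interp_def)
  have \<sigma>: "\<sigma> = id \<or> \<sigma> = cnj" using g by (auto simp: semilinear_def)
  have \<sigma>t: "\<exists>s::real. \<sigma> (\<i> * of_real t) = \<i> * of_real s \<and> \<sigma> (1 + \<i> * of_real t) = 1 + \<i> * of_real s" for t :: real
    using \<sigma> by (auto intro: exI[of _ t] exI[of _ "- t"])
  have "g (f (\<sigma> (\<i> * of_real t))) \<in> L0 \<and> g (f (\<sigma> (1 + \<i> * of_real t))) \<in> L1" for t :: real
  proof -
    obtain s :: real where s: "\<sigma> (\<i> * of_real t) = \<i> * of_real s" "\<sigma> (1 + \<i> * of_real t) = 1 + \<i> * of_real s"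
      using \<sigma>t by blast
    show ?thesis unfolding s using f(3,4)[of s] K by blast
  qed
  moreover have "y = g (f (\<sigma> (of_real \<theta>)))" using f(2) \<sigma> by auto
  ultimately show "y \<in> interp L0 L1 \<theta>"
    unfolding interp_def using strip_functions_semilinear[OF g f(1)] by (intro CollectI exI[of _ "\<lambda>z. g (f (\<sigma> z))"]) auto
qed

lemma semilinear_id: "semilinear id (\<lambda>x. x)"
  by (auto simp: semilinear_def linear_id[unfolded id_def])

lemma interp_mono: "K0 \<subseteq> L0 \<Longrightarrow> K1 \<subseteq> L1 \<Longrightarrow> interp K0 K1 \<theta> \<subseteq> interp L0 L1 \<theta>"
  using interp_semilinear_image[OF semilinear_id] by simp

lemma semilinear_scaleR: "semilinear id ((*\<^sub>R) r)"
  by (auto simp: semilinear_def vec_eq_iff scaleR_conv_of_real[where 'a=complex] ac_simps linear_scaleR)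

lemma semilinear_vector_smult: "semilinear id ((*s) c)"
  by (auto simp: semilinear_def vec_eq_iff algebra_simps intro!: linearI)

lemma semilinear_matrix: "semilinear id ((*v) A)"
proof -
  have "A *v (x + y) = A *v x + A *v y" for x y by (simp add: matrix_vector_right_distrib)
  moreover have "A *v (c *s x) = c *s (A *v x)" for c x
    by (simp add: vec_eq_iff matrix_vector_mult_def sum_distrib_left ac_simps)
  moreover have "A *v (r *\<^sub>R x) = r *\<^sub>R (A *v x)" for r x
    by (simp add: vec_eq_iff matrix_vector_mult_def scaleR_sum_right)
  ultimately show ?thesis by (auto simp: semilinear_def intro!: linearI)
qed

text \<open>Constant functions are competitors.\<close>

lemma Int_subset_interp: "K0 \<inter> K1 \<subseteq> interp K0 K1 \<theta>"
  unfolding interp_def strip_functions_def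
  by (auto intro!: exI[of _ "\<lambda>_. _"] intro: bounded_subset[of "{_}"] holomorphic_on_const)

lemma convex_interp:
  assumes K: "convex K0" "convex K1"
  shows "convex (interp K0 K1 \<theta>)"
proof (rule convexI)
  fix x y and u v :: real
  assume xy: "x \<in> interp K0 K1 \<theta>" "y \<in> interp K0 K1 \<theta>" and uv: "0 \<le> u" "0 \<le> v" "u + v = 1"
  obtain f where f: "f \<in> strip_functions" "x = f (of_real \<theta>)"
    "\<And>t::real. f (\<i> * of_real t) \<in> K0" "\<And>t::real. f (1 + \<i> * of_real t) \<in> K1"
    using xy by (auto simp: interp_def)
  obtain h where h: "h \<in> strip_functions" "y = h (of_real \<theta>)"
    "\<And>t::real. h (\<i> * of_real t) \<in> K0" "\<And>t::real. h (1 + \<i> * of_real t) \<in> K1"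
    using xy by (auto simp: interp_def)
  have "bounded ((\<lambda>z. u *\<^sub>R f z + v *\<^sub>R h z) ` closure strip)"
  proof -
    have "bounded ((\<lambda>z. u *\<^sub>R f z) ` closure strip)" "bounded ((\<lambda>z. v *\<^sub>R h z) ` closure strip)"
      using f(1) h(1) bounded_scaling[of "f ` closure strip" u] bounded_scaling[of "h ` closure strip" v]
      by (simp_all add: strip_functions_def image_image)
    then show ?thesis by (rule bounded_plus_comp)
  qed
  then have "(\<lambda>z. u *\<^sub>R f z + v *\<^sub>R h z) \<in> strip_functions"
    using f(1) h(1) by (auto simp: strip_functions_def scaleR_conv_of_real[where 'a=complex] intro!: continuous_intros holomorphic_intros)
  then show "u *\<^sub>R x + v *\<^sub>R y \<in> interp K0 K1 \<theta>"
    unfolding interp_def using f h uv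
    by (intro CollectI exI[of _ "\<lambda>z. u *\<^sub>R f z + v *\<^sub>R h z"]) (auto intro!: convexD[OF K(1)] convexD[OF K(2)])
qed

text \<open>A complex functional that is bounded on both bodies is bounded on the interpolated body with the
geometric mean of the bounds: the three lines theorem, applied to the functional along an analytic
curve.\<close>

lemma interp_cinner_bound:
  assumes x: "x \<in> interp K0 K1 \<theta>" and \<theta>: "0 \<le> \<theta>" "\<theta> \<le> 1"
    and a: "a > 0" "\<And>k. k \<in> K0 \<Longrightarrow> cmod (cinner k v) \<le> a"
    and b: "b > 0" "\<And>k. k \<in> K1 \<Longrightarrow> cmod (cinner k v) \<le> b"
  shows "cmod (cinner x v) \<le> a powr (1 - \<theta>) * b powr \<theta>"
proof -
  obtain f where f: "f \<in> strip_functions" "x = f (of_real \<theta>)"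
    "\<And>t::real. f (\<i> * of_real t) \<in> K0" "\<And>t::real. f (1 + \<i> * of_real t) \<in> K1"
    using x by (auto simp: interp_def)
  have lin: "linear (\<lambda>x. cinner x v)"
    by (auto intro!: linearI simp: cinner_def sum.distrib algebra_simps scaleR_sum_right)
  have "cmod ((\<lambda>z. cinner (f z) v) (of_real \<theta>)) \<le> a powr (1 - \<theta>) * b powr \<theta>"
  proof (rule three_lines)
    show "(\<lambda>z. cinner (f z) v) holomorphic_on strip"
      using f(1) unfolding cinner_def strip_functions_def by (auto intro!: holomorphic_intros)
    show "continuous_on (closure strip) (\<lambda>z. cinner (f z) v)"
      using f(1) linear_continuous_on_compose[OF _ lin] by (auto simp: strip_functions_def)
    have "bounded ((\<lambda>x. cinner x v) ` f ` closure strip)"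
      using f(1) lin
      by (intro bounded_linear_image[of "f ` closure strip"]) (simp_all add: strip_functions_def linear_conv_bounded_linear)
    then show "bounded ((\<lambda>z. cinner (f z) v) ` closure strip)" by (simp add: image_image)
  qed (use a b f \<theta> in auto)
  then show ?thesis using f(2) by simp
qed

section \<open>Unitary triangularization\<close>

lemma cinner_add_left: "cinner (x + y) z = cinner x z + cinner y z"
  and cinner_diff_left: "cinner (x - y) z = cinner x z - cinner y z"
  and cinner_smult_left: "cinner (c *s x) z = c * cinner x z"
  and cinner_smult_right: "cinner x (c *s z) = cnj c * cinner x z"
  and cnj_cinner: "cnj (cinner x y) = cinner y x"
  by (simp_all add: cinner_def sum.distrib sum_subtractf sum_distrib_left algebra_simps)

lemma cinner_sum_left: "cinner (\<Sum>i\<in>I. f i) z = (\<Sum>i\<in>I. cinner (f i) z)"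
  by (induction I rule: infinite_finite_induct) (simp_all add: cinner_add_left, simp_all add: cinner_def)

lemma inner_eq_Re_cinner: "x \<bullet> y = Re (cinner x y)"
  by (simp add: inner_vec_def cinner_def inner_complex_def)

lemma cinner_self: "cinner x x = of_real ((norm x)\<^sup>2)"
proof -
  have "Im (cinner x x) = 0" by (simp add: cinner_def)
  then show ?thesis
    by (simp add: complex_eq_iff inner_eq_Re_cinner[symmetric] power2_norm_eq_inner)
qed

text \<open>Orthonormalization of the columns \<open>m k\<close> of an injective matrix in the order in which the indices are
processed; \<open>r\<close> records this order, since the index type carries none. The expansion of \<open>m i\<close> in the
vectors found so far makes the later vectors orthogonal to \<open>m i\<close>, and writing the vectors as images
of \<open>N\<close> shows that the next remainder does not vanish.\<close>

lemma gram_schmidt: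
  fixes N :: "complex ^ 'n ^ 'n"
  assumes inj: "\<And>c. N *v c = 0 \<Longrightarrow> c = 0"
  defines "m \<equiv> \<lambda>k. N *v axis k 1"
  obtains u and r :: "'n \<Rightarrow> nat" where "inj r" 
    "\<And>i j. cinner (u i) (u j) = (if i = j then 1 else 0)"
    "\<And>i j. r i < r j \<Longrightarrow> cinner (u j) (m i) = 0"
    "\<And>i. \<exists>d>0. cinner (u i) (m i) = of_real d"
proof -
  define P where "P I u r \<longleftrightarrow> inj_on (r :: 'n \<Rightarrow> nat) I \<and> 
    (\<forall>i\<in>I. \<forall>j\<in>I. cinner (u i) (u j) = (if i = j then 1 else 0)) \<and>
    (\<forall>i\<in>I. \<forall>j\<in>I. r i < r j \<longrightarrow> cinner (u j) (m i) = 0) \<and>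
    (\<forall>i\<in>I. \<exists>d>0. cinner (u i) (m i) = of_real d) \<and>
    (\<forall>i\<in>I. m i = (\<Sum>j\<in>I. cinner (m i) (u j) *s u j)) \<and>
    (\<forall>i\<in>I. \<exists>c. u i = N *v c \<and> (\<forall>k. k \<notin> I \<longrightarrow> c $ k = 0))" for I u r
  have "\<exists>u r. P I u r" if "finite I" for I :: "'n set"
    using that
  proof (induction I rule: finite_induct)
    case empty
    then show ?case by (simp add: P_def)
  next
    case (insert k I)
    then obtain u r where P: "P I u r" by blast
    then obtain c where c: "\<And>i. i \<in> I \<Longrightarrow> u i = N *v c i" "\<And>i l. i \<in> I \<Longrightarrow> l \<notin> I \<Longrightarrow> c i $ l = 0"
      unfolding P_def by metis
    have on: "\<And>i j. i \<in> I \<Longrightarrow> j \<in> I \<Longrightarrow> cinner (u i) (u j) = (if i = j then 1 else 0)"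
      and ex: "\<And>i. i \<in> I \<Longrightarrow> m i = (\<Sum>j\<in>I. cinner (m i) (u j) *s u j)"
      using P unfolding P_def by blast+
    define w where "w = m k - (\<Sum>i\<in>I. cinner (m k) (u i) *s u i)"
    define cw where "cw = axis k 1 - (\<Sum>i\<in>I. cinner (m k) (u i) *s c i)"
    have linN: "linear ((*v) N)" using semilinear_matrix[of N] by (simp add: semilinear_def)
    have w: "w = N *v cw"
      using c(1) by (simp add: w_def cw_def m_def linear_diff[OF linN] linear_sum[OF linN] vector_scalar_commute)
    have "cw $ k = 1" using c(2) insert(2) by (simp add: cw_def)
    then have "w \<noteq> 0" using inj[of cw] w by auto
    then have nw: "norm w > 0" by simp
    have wu: "cinner w (u j) = 0" if "j \<in> I" for j
    proof -
      have "(\<Sum>i\<in>I. cinner (m k) (u i) * cinner (u i) (u j)) = (\<Sum>i\<in>I. if i = j then cinner (m k) (u i) else 0)"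
        using that by (intro sum.cong) (auto simp: on)
      also have "\<dots> = cinner (m k) (u j)" using insert(1) that by simp
      finally show ?thesis by (simp add: w_def cinner_diff_left cinner_sum_left cinner_smult_left)
    qed
    then have uw: "cinner (u j) w = 0" if "j \<in> I" for j
      using that cnj_cinner[of w "u j"] by simp
    define v where "v = complex_of_real (1 / norm w) *s w"
    have vu: "cinner v (u j) = 0" "cinner (u j) v = 0" if "j \<in> I" for j
      using wu uw that by (simp_all add: v_def cinner_smult_left cinner_smult_right)
    have vv: "cinner v v = 1" 
      using nw unfolding v_def cinner_smult_left cinner_smult_right unfolding cinner_self
      by (simp add: power2_eq_square)
    have mk: "m k = w + (\<Sum>i\<in>I. cinner (m k) (u i) *s u i)" by (simp add: w_def)
    have wv: "w = complex_of_real (norm w) *s v" using nw by (simp add: v_def)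
    have mkv: "cinner (m k) v = of_real (norm w)"
    proof -
      have "cinner (m k) v = cinner w v + (\<Sum>i\<in>I. cinner (m k) (u i) * cinner (u i) v)"
        by (subst mk) (simp only: cinner_add_left cinner_sum_left cinner_smult_left)
      also have "(\<Sum>i\<in>I. cinner (m k) (u i) * cinner (u i) v) = 0" by (simp add: vu)
      also have "cinner w v = of_real (norm w)" by (subst wv) (simp add: cinner_smult_left vv)
      finally show ?thesis by simp
    qed
    then have vmk: "cinner v (m k) = of_real (norm w)" using cnj_cinner[of "m k" v] by simp
    have miv: "cinner (m i) v = 0" if "i \<in> I" for i
      by (subst ex[OF that]) (simp add: cinner_sum_left cinner_smult_left vu)
    then have vmi: "cinner v (m i) = 0" if "i \<in> I" for i using cnj_cinner[of "m i" v] that by simp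
    define u' where "u' = u(k := v)"
    define r' where "r' = r(k := Suc (Max (insert 0 (r ` I))))"
    have r'k: "r' i < r' k" "r' i = r i" "u' i = u i" if "i \<in> I" for i
    proof -
      show "r' i = r i" "u' i = u i" using that insert(2) by (auto simp: r'_def u'_def)
      have "r i \<le> Max (insert 0 (r ` I))" using insert(1) that by (intro Max_ge) auto
      then show "r' i < r' k" using that insert(2) by (auto simp: r'_def le_imp_less_Suc)
    qed
    have u'k: "u' k = v" by (simp add: u'_def)
    have "P (insert k I) u' r'"
      unfolding P_def
    proof (intro conjI ballI impI)
      show "inj_on r' (insert k I)"
        using P r'k insert(2) unfolding P_def inj_on_def by (metis insertE less_irrefl)
      fix i assume i: "i \<in> insert k I"
      show "\<exists>d>0. cinner (u' i) (m i) = of_real d"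
        using i P r'k u'k vmk nw unfolding P_def by (metis insertE)
      show "m i = (\<Sum>j\<in>insert k I. cinner (m i) (u' j) *s u' j)"
      proof -
        have "(\<Sum>j\<in>insert k I. cinner (m i) (u' j) *s u' j) 
          = cinner (m i) v *s v + (\<Sum>j\<in>I. cinner (m i) (u j) *s u j)"
          using insert(1,2) r'k by (simp add: u'k)
        also have "\<dots> = m i"
        proof (cases "i = k")
          case True
          then show ?thesis using mkv wv mk by simp
        next
          case False
          then show ?thesis using i miv ex[of i] by simp
        qed
        finally show ?thesis ..
      qed
      show "\<exists>c. u' i = N *v c \<and> (\<forall>l. l \<notin> insert k I \<longrightarrow> c $ l = 0)"
      proof (cases "i = k")
        case True
        have "u' i = N *v (complex_of_real (1 / norm w) *s cw)"
          by (simp only: True u'k v_def w vector_scalar_commute)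
        moreover have "(complex_of_real (1 / norm w) *s cw) $ l = 0" if "l \<notin> insert k I" for l
          using that c(2) by (auto simp: cw_def axis_def)
        ultimately show ?thesis by blast
      next
        case False
        then show ?thesis using i r'k c by auto
      qed
      fix j assume j: "j \<in> insert k I"
      show "cinner (u' i) (u' j) = (if i = j then 1 else 0)"
        using i j insert(2) by (auto simp: u'k r'k on vu vv)
      assume "r' i < r' j"
      then show "cinner (u' j) (m i) = 0"
        using i j P r'k u'k vmi unfolding P_def by (metis insertE less_asym' less_irrefl)
    qed
    then show ?case by blast
  qed
  then obtain u r where "P UNIV u r" by (meson finite)
  then show thesis using that[of r u] unfolding P_def by auto
qed

text \<open>A permutation that never increases the rank is the identity, because the sum of all ranks is
preserved.\<close>

lemma det_triangular_rank:
  fixes A :: "'a::comm_ring_1 ^ 'n ^ 'n" and r :: "'n \<Rightarrow> nat"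
  assumes "inj r" and A: "\<And>i j. r i < r j \<Longrightarrow> A $ i $ j = 0"
  shows "det A = (\<Prod>i\<in>UNIV. A $ i $ i)"
proof -
  have z: "(\<Prod>i\<in>UNIV. A $ i $ p i) = 0" if p: "p permutes UNIV" "p \<noteq> id" for p :: "'n \<Rightarrow> 'n"
  proof -
    have "\<exists>i. r i < r (p i)"
    proof (rule ccontr)
      assume "\<nexists>i. r i < r (p i)"
      then have le: "r (p i) \<le> r i" for i by (meson not_less)
      have "(\<Sum>i\<in>UNIV. r (p i)) = (\<Sum>i\<in>UNIV. r i)"
        using sum.permute[OF p(1), of r] by (simp add: o_def)
      then have "r (p i) = r i" for i
        using sum_mono_inv[of "\<lambda>i. r (p i)" UNIV r i] le by auto
      then have "p = id" using assms(1) by (auto simp: fun_eq_iff inj_eq)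
      with p show False by simp
    qed
    then obtain i where "A $ i $ p i = 0" using A by blast
    then show ?thesis by (meson UNIV_I finite prod_zero)
  qed
  have "det A = (\<Sum>p\<in>{p :: 'n \<Rightarrow> 'n. p permutes UNIV}. if p = id then (\<Prod>i\<in>UNIV. A $ i $ i) else 0)"
    unfolding det_def by (intro sum.cong) (auto simp: z sign_id)
  then show ?thesis by (simp add: permutes_id finite_permutations)
qed

lemma det_conj_transpose: "det (conj_transpose A) = cnj (det A)"
proof -
  have "det (conj_transpose A) = det (\<chi> i j. cnj (A $ i $ j))"
    by (subst det_transpose[symmetric]) (simp add: transpose_def conj_transpose_def)
  also have "\<dots> = cnj (det A)" by (simp add: det_def)
  finally show ?thesis .
qed

lemma conj_transpose_mult: "conj_transpose (A ** B) = conj_transpose B ** conj_transpose A"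
  by (simp add: conj_transpose_def matrix_matrix_mult_def vec_eq_iff mult.commute)

lemma conj_transpose_mat_1 [simp]: "conj_transpose (mat 1) = mat 1"
  by (simp add: conj_transpose_def mat_def vec_eq_iff)

text \<open>Gram-Schmidt for the rows of \<open>M\<close> yields a unitary \<open>U\<close> for which \<open>M U\<close> is triangular with positive
diagonal. The product of the diagonal entries is \<open>\<bar>det M\<bar> = 1\<close>, so their sum is at least \<open>n\<close>.\<close>

lemma exists_unitary_trace_ge:
  fixes M :: "complex ^ 'n ^ 'n"
  assumes "invertible M" "det M = 1"
  obtains U where "U ** conj_transpose U = mat 1" "conj_transpose U ** U = mat 1"
    "Re (trace (M ** U)) \<ge> CARD('n)"
proof -
  let ?N = "conj_transpose M"
  obtain M' where "M ** M' = mat 1" using assms(1) by (auto simp: invertible_def)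
  then have inv: "conj_transpose M' ** ?N = mat 1" by (metis conj_transpose_mult conj_transpose_mat_1)
  have inj: "c = 0" if "?N *v c = 0" for c
  proof -
    have "c = conj_transpose M' *v (?N *v c)" by (simp add: matrix_vector_mul_assoc inv)
    then show ?thesis using that by simp
  qed
  obtain u and r :: "'n \<Rightarrow> nat" where r: "inj r" 
    and on: "\<And>i j. cinner (u i) (u j) = (if i = j then 1 else 0)"
    and tri: "\<And>i j. r i < r j \<Longrightarrow> cinner (u j) (?N *v axis i 1) = 0"
    and pos: "\<And>i. \<exists>d>0. cinner (u i) (?N *v axis i 1) = of_real d"
    using gram_schmidt[OF inj] by metis
  define U where "U = (\<chi> i j. u j $ i)"
  have 1: "conj_transpose U ** U = mat 1"
  proof -
    have "(conj_transpose U ** U) $ i $ j = cinner (u j) (u i)" for i j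
      by (simp add: U_def conj_transpose_def matrix_matrix_mult_def cinner_def mult.commute)
    then show ?thesis by (auto simp: vec_eq_iff mat_def on)
  qed
  then have 2: "U ** conj_transpose U = mat 1" by (simp add: matrix_left_right_inverse)
  have MU: "(M ** U) $ i $ j = cinner (u j) (?N *v axis i 1)" for i j
  proof -
    have "(?N *v axis i 1) $ l = cnj (M $ i $ l)" for l
      by (simp add: conj_transpose_def matrix_vector_mult_def axis_def if_distrib cong: if_cong)
    then show ?thesis by (simp add: U_def matrix_matrix_mult_def cinner_def mult.commute)
  qed
  obtain d where d: "\<And>i. d i > 0" "\<And>i. (M ** U) $ i $ i = of_real (d i)"
    unfolding MU using pos by metis
  have "det (M ** U) = (\<Prod>i\<in>UNIV. (M ** U) $ i $ i)"
    by (rule det_triangular_rank[OF r]) (use tri MU in auto)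
  then have "det U = of_real (\<Prod>i\<in>UNIV. d i)" using assms(2) d(2) by (simp add: det_mul)
  moreover have "cmod (det U) = 1"
  proof -
    have "det U * cnj (det U) = 1" by (metis 2 det_mul det_conj_transpose det_I)
    then have "(cmod (det U))\<^sup>2 = 1" by (metis complex_norm_square of_real_eq_1_iff)
    then show ?thesis by (simp add: power2_eq_1_iff) (smt (verit) norm_ge_zero)
  qed
  moreover have "(\<Prod>i\<in>UNIV. d i) > 0" using d by (intro prod_pos) auto
  ultimately have prod: "(\<Prod>i\<in>UNIV. d i) = 1" by (simp only: norm_of_real)
  have "(\<Prod>i\<in>UNIV. d i) powr (1 / CARD('n)) \<le> (\<Sum>i\<in>UNIV. d i / CARD('n))"
    using d(1) by (intro arith_geom_mean) (auto intro: less_imp_le)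
  then have "CARD('n) \<le> (\<Sum>i\<in>UNIV. d i)"
    unfolding prod sum_divide_distrib[symmetric] by (simp add: field_simps)
  also have "\<dots> = Re (trace (M ** U))" by (simp add: trace_def d(2))
  finally show thesis using that 1 2 by blast
qed

section \<open>The first variation of the Gaussian second moment\<close>

definition outer :: "complex ^ 'n \<Rightarrow> complex ^ 'n ^ 'n" where
  "outer z = (\<chi> i j. z $ i * cnj (z $ j))"

lemma norm_vector_smult: "norm (c *s (x :: complex ^ 'n)) = cmod c * norm x"
  by (simp add: norm_vec_def norm_mult L2_set_right_distrib)

lemma cmod_cinner_le: "cmod (cinner (x :: complex ^ 'n) y) \<le> real CARD('n) * norm x * norm y"
proof -
  have "cmod (cinner x y) \<le> (\<Sum>i\<in>(UNIV::'n set). norm x * norm y)"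
    unfolding cinner_def by (rule sum_norm_le) (auto simp: norm_mult intro!: mult_mono Finite_Cartesian_Product.norm_nth_le)
  then show ?thesis by (simp add: mult.assoc)
qed

lemma inner_outer: "X \<bullet> outer z = (X *v z) \<bullet> z"
  by (simp add: inner_vec_def outer_def matrix_vector_mult_def inner_complex_def sum_distrib_right sum_distrib_left algebra_simps
      sum.distrib sum_subtractf)

lemma outer_mult: "outer z *v x = cinner x z *s z"
  by (simp add: outer_def matrix_vector_mult_def cinner_def vec_eq_iff sum_distrib_right sum_distrib_left algebra_simps)

lemma norm_matrix_le_sum_entries: "norm (A :: complex ^ 'n ^ 'n) \<le> (\<Sum>i\<in>UNIV. \<Sum>j\<in>UNIV. norm (A $ i $ j))"
proof -
  have "norm A \<le> (\<Sum>i\<in>UNIV. norm (A $ i))"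
    unfolding norm_vec_def[of A] by (rule L2_set_le_sum) simp
  also have "\<dots> \<le> (\<Sum>i\<in>UNIV. \<Sum>j\<in>UNIV. norm (A $ i $ j))"
    unfolding norm_vec_def[of "A $ _"] by (intro sum_mono L2_set_le_sum) simp
  finally show ?thesis .
qed

lemma norm_axis_one [simp]: "norm (axis i 1 :: complex ^ 'n) = 1"
  by (simp add: norm_eq_sqrt_inner inner_axis)

lemma linear_matrix_apply: "linear (\<lambda>A :: complex ^ 'n ^ 'n. A *v x)"
  by (auto intro!: linearI simp: matrix_vector_mult_def vec_eq_iff sum.distrib algebra_simps scaleR_sum_right)

lemma norm_outer_le: "norm (outer (z :: complex ^ 'n)) \<le> (real CARD('n))\<^sup>2 * (norm z)\<^sup>2"
proof -
  have "norm (outer z) \<le> (\<Sum>i\<in>UNIV. \<Sum>j\<in>UNIV. norm (outer z $ i $ j))"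
    by (rule norm_matrix_le_sum_entries)
  also have "\<dots> \<le> (\<Sum>i\<in>(UNIV::'n set). \<Sum>j\<in>(UNIV::'n set). norm z * norm z)"
    by (intro sum_mono) (auto simp: outer_def norm_mult intro!: mult_mono Finite_Cartesian_Product.norm_nth_le)
  finally show ?thesis by (simp add: power2_eq_square ac_simps)
qed

lemma mat_1_inner: "mat 1 \<bullet> (X :: complex ^ 'n ^ 'n) = Re (trace X)"
proof -
  have "mat 1 \<bullet> X = (\<Sum>i\<in>UNIV. \<Sum>j\<in>UNIV. if i = j then Re (X $ i $ j) else 0)"
    unfolding inner_vec_def by (intro sum.cong) (auto simp: mat_def inner_complex_def)
  then show ?thesis by (simp add: trace_def)
qed

text \<open>The covariance of the scalar \<open>F(G)\<close> with the random matrix \<open>G G\<^sup>*\<close>; it is the gradient of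
\<open>M \<mapsto> E F(M G)\<close> at the identity.\<close>

definition cov_matrix :: "(complex ^ 'n \<Rightarrow> real) \<Rightarrow> complex ^ 'n ^ 'n" where
  "cov_matrix F = (\<integral>z. (F z - (\<integral>x. F x \<partial>std_gaussian)) *\<^sub>R outer z \<partial>std_gaussian)"

text \<open>The properties of squared norms that are used for the Gaussian integrals.\<close>

definition convex_homogeneous2 :: "real \<Rightarrow> ('a::euclidean_space \<Rightarrow> real) \<Rightarrow> bool" where
  "convex_homogeneous2 C F \<longleftrightarrow> convex_on UNIV F \<and> (\<forall>x. 0 \<le> F x \<and> F x \<le> C * (norm x)\<^sup>2) \<and> (\<forall>c>0. \<forall>x. F (c *\<^sub>R x) = c\<^sup>2 * F x)"

lemma convex_homogeneous2_measurable: "convex_homogeneous2 C F \<Longrightarrow> F \<in> borel_measurable borel"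
  using convex_on_continuous[of UNIV F] by (auto simp: convex_homogeneous2_def intro: borel_measurable_continuous_onI)

lemma convex_homogeneous2_weighted_integrable:
  fixes F :: "'a::euclidean_space \<Rightarrow> real" and h :: "'a \<Rightarrow> 'b::{banach, second_countable_topology}"
  assumes F: "convex_homogeneous2 C F" and [measurable]: "h \<in> borel_measurable borel" and h: "\<And>x. norm (h x) \<le> D * (norm x)\<^sup>2"
  shows "integrable std_gaussian (\<lambda>x. (F x - m) *\<^sub>R h x)"
proof (rule std_gaussian_integrable_poly[where C="(\<bar>C\<bar> + \<bar>m\<bar>) * \<bar>D\<bar>"])
  have [measurable]: "F \<in> borel_measurable borel" by (rule convex_homogeneous2_measurable[OF F])
  show "(\<lambda>x. (F x - m) *\<^sub>R h x) \<in> borel_measurable borel" by measurable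
  fix x :: 'a
  have "F x \<le> \<bar>C\<bar> * (norm x)\<^sup>2" "0 \<le> F x" using F mult_right_mono[OF abs_ge_self[of C], of "(norm x)\<^sup>2"]
    by (auto simp: convex_homogeneous2_def intro: order_trans)
  then have 1: "\<bar>F x - m\<bar> \<le> \<bar>C\<bar> * (norm x)\<^sup>2 + \<bar>m\<bar>" by linarith
  have 2: "norm (h x) \<le> \<bar>D\<bar> * (norm x)\<^sup>2" using h[of x] mult_right_mono[OF abs_ge_self[of D], of "(norm x)\<^sup>2"] by simp
  have "norm ((F x - m) *\<^sub>R h x) \<le> (\<bar>C\<bar> * (norm x)\<^sup>2 + \<bar>m\<bar>) * (\<bar>D\<bar> * (norm x)\<^sup>2)"
    unfolding norm_scaleR by (intro mult_mono 1 2) auto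
  also have "\<dots> = (\<bar>C\<bar> * \<bar>D\<bar>) * norm x ^ 4 + (\<bar>m\<bar> * \<bar>D\<bar>) * (norm x)\<^sup>2"
    by (simp add: algebra_simps flip: power_add)
  also have "\<dots> \<le> (\<bar>C\<bar> * \<bar>D\<bar>) * (1 + norm x ^ 4) + (\<bar>m\<bar> * \<bar>D\<bar>) * (1 + norm x ^ 4)"
    using norm_sq_le_one_plus_pow4[of x] by (intro add_mono mult_left_mono) auto
  finally show "norm ((F x - m) *\<^sub>R h x) \<le> (\<bar>C\<bar> + \<bar>m\<bar>) * \<bar>D\<bar> * (1 + norm x ^ 4)"
    by (simp add: algebra_simps)
qed

lemma outer_measurable [measurable]: "outer \<in> borel_measurable borel"
  unfolding outer_def by (intro borel_measurable_continuous_onI continuous_intros)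

lemma convex_homogeneous2_outer_integrable:
  assumes "convex_homogeneous2 C F"
  shows "integrable std_gaussian (\<lambda>z. (F z - m) *\<^sub>R outer z)"
  by (rule convex_homogeneous2_weighted_integrable[OF assms outer_measurable norm_outer_le])

lemma inner_cov_matrix:
  assumes "convex_homogeneous2 C F"
  shows "X \<bullet> cov_matrix F = (\<integral>z. (F z - (\<integral>x. F x \<partial>std_gaussian)) * ((X *v z) \<bullet> z) \<partial>std_gaussian)"
  unfolding cov_matrix_def 
  using integral_inner_right[of X std_gaussian, OF convex_homogeneous2_outer_integrable[OF assms]]
  by (simp add: inner_outer)

lemma cov_matrix_mult:
  assumes "convex_homogeneous2 C F"
  shows "cov_matrix F *v x = (\<integral>z. (F z - (\<integral>x. F x \<partial>std_gaussian)) *\<^sub>R (cinner x z *s z) \<partial>std_gaussian)"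
proof -
  have "bounded_linear (\<lambda>A :: complex ^ 'a ^ 'a. A *v x)"
    using linear_matrix_apply by (simp add: linear_conv_bounded_linear)
  from integral_bounded_linear[OF this convex_homogeneous2_outer_integrable[OF assms]]
  have "cov_matrix F *v x = (\<integral>z. ((F z - (\<integral>x. F x \<partial>std_gaussian)) *\<^sub>R outer z) *v x \<partial>std_gaussian)"
    by (simp add: cov_matrix_def)
  moreover have "(c *\<^sub>R outer z) *v x = c *\<^sub>R (cinner x z *s z)" for c z
    by (simp add: outer_mult[symmetric] matrix_vector_mult_def vec_eq_iff scaleR_sum_right)
  ultimately show ?thesis by simp
qed

lemma conj_transpose_cov_matrix:
  assumes F: "convex_homogeneous2 C F"
  shows "conj_transpose (cov_matrix F) = cov_matrix F"
proof -
  have "linear (conj_transpose :: complex ^ 'a ^ 'a \<Rightarrow> _)"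
    by (auto intro!: linearI simp: conj_transpose_def vec_eq_iff)
  then have "bounded_linear (conj_transpose :: complex ^ 'a ^ 'a \<Rightarrow> _)" by (simp add: linear_conv_bounded_linear)
  from integral_bounded_linear[OF this convex_homogeneous2_outer_integrable[OF F]]
  have "conj_transpose (cov_matrix F) = (\<integral>z. conj_transpose ((F z - (\<integral>x. F x \<partial>std_gaussian)) *\<^sub>R outer z) \<partial>std_gaussian)"
    by (simp add: cov_matrix_def)
  moreover have "conj_transpose (c *\<^sub>R outer z) = c *\<^sub>R outer z" for c and z :: "complex ^ 'a"
    by (simp add: conj_transpose_def outer_def vec_eq_iff)
  ultimately show ?thesis by (simp add: cov_matrix_def)
qed

lemma linear_matrix_vector_mult: "linear ((*v) (A :: complex ^ 'n ^ 'n))"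
  using semilinear_matrix[of A] by (simp add: semilinear_def)

lemma convex_homogeneous2_supporting_line:
  assumes F: "convex_homogeneous2 C F"
  shows "(\<integral>x. F (M *v x) \<partial>std_gaussian) \<ge> (\<integral>x. F x \<partial>std_gaussian) + (M - mat 1) \<bullet> cov_matrix F"
proof -
  have "(\<integral>x. F x \<partial>std_gaussian) + (\<integral>x. (F x - (\<integral>z. F z \<partial>std_gaussian)) * ((M *v x - x) \<bullet> x) \<partial>std_gaussian)
    \<le> (\<integral>x. F (M *v x) \<partial>std_gaussian)"
    using F by (intro std_gaussian_convex_supporting_line[OF linear_matrix_vector_mult, where C=C]) (auto simp: convex_homogeneous2_def)
  then show ?thesis
    unfolding inner_cov_matrix[OF F] by (simp add: matrix_vector_mult_diff_rdistrib)
qed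

text \<open>Euler's identity. Along \<open>M = (1 + s) I\<close> the function \<open>E F(M G)\<close> equals \<open>(1 + s)\<^sup>2 E F(G)\<close>, and its
slope at \<open>s = 0\<close> is squeezed by the supporting lines for \<open>s > 0\<close> and \<open>s < 0\<close>.\<close>

lemma mat_1_inner_cov_matrix:
  assumes F: "convex_homogeneous2 C F"
  shows "mat 1 \<bullet> cov_matrix F = 2 * (\<integral>x. F x \<partial>std_gaussian)"
proof -
  define E where "E = (\<integral>x. F x \<partial>std_gaussian)"
  define w where "w = mat 1 \<bullet> cov_matrix F"
  have *: "(1 + s)\<^sup>2 * E \<ge> E + s * w" if "s > -1" for s
  proof -
    have sm: "((1 + s) *\<^sub>R mat 1) *v x = (1 + s) *\<^sub>R x" for x :: "complex ^ 'a"
    proof -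
      have "((1 + s) *\<^sub>R mat 1) *v x = (1 + s) *\<^sub>R (mat 1 *v x)"
        unfolding matrix_vector_mult_def by (simp add: vec_eq_iff scaleR_sum_right)
      then show ?thesis by simp
    qed
    have "(\<integral>x. F (((1 + s) *\<^sub>R mat 1) *v x) \<partial>std_gaussian) = (\<integral>x. (1 + s)\<^sup>2 * F x \<partial>std_gaussian)"
      unfolding sm using F that by (simp add: convex_homogeneous2_def)
    moreover have "((1 + s) *\<^sub>R mat 1 - mat 1) \<bullet> cov_matrix F = s * w"
      by (simp add: w_def algebra_simps)
    ultimately show ?thesis using convex_homogeneous2_supporting_line[OF F, of "(1 + s) *\<^sub>R mat 1"] by (simp add: E_def)
  qed
  have lim: "a \<le> 0" if "\<And>s. 0 < s \<Longrightarrow> s < 1 \<Longrightarrow> a \<le> s * b" for a b :: real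
  proof -
    have "eventually (\<lambda>s. s \<in> {0<..<1}) (at_right (0::real))"
      by (intro eventually_at_right_real) auto
    then have "eventually (\<lambda>s. a \<le> s * b) (at_right (0::real))"
      by eventually_elim (use that in auto)
    moreover have "((\<lambda>s. s * b) \<longlongrightarrow> 0 * b) (at_right 0)" by (intro tendsto_intros)
    ultimately have "a \<le> 0 * b" by (intro tendsto_lowerbound) auto
    then show ?thesis by simp
  qed
  have "w - 2 * E \<le> 0"
  proof (rule lim[of _ E])
    fix s :: real assume s: "0 < s" "s < 1"
    have "s * w \<le> s * (2 * E + s * E)" using *[of s] s by (simp add: power2_eq_square algebra_simps)
    then have "w \<le> 2 * E + s * E" using s by simp
    then show "w - 2 * E \<le> s * E" by simp
  qed
  moreover have "2 * E - w \<le> 0"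
  proof (rule lim[of _ E])
    fix s :: real assume s: "0 < s" "s < 1"
    have "s * (2 * E - s * E) \<le> s * w" using *[of "-s"] s by (simp add: power2_eq_square algebra_simps)
    then have "2 * E - s * E \<le> w" using s by simp
    then show "2 * E - w \<le> s * E" by simp
  qed
  ultimately show ?thesis by (simp add: E_def w_def)
qed

lemma convex_homogeneous2_integral_nonneg: "convex_homogeneous2 C F \<Longrightarrow> 0 \<le> (\<integral>x. F x \<partial>std_gaussian)"
  by (intro integral_nonneg_AE) (auto simp: convex_homogeneous2_def)

lemma cinner_matrix_left: "cinner (A *v x) y = cinner x (conj_transpose A *v y)"
proof -
  have "cinner (A *v x) y = (\<Sum>i\<in>UNIV. \<Sum>j\<in>UNIV. A $ i $ j * x $ j * cnj (y $ i))"
    by (simp add: cinner_def matrix_vector_mult_def sum_distrib_right)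
  also have "\<dots> = (\<Sum>j\<in>UNIV. \<Sum>i\<in>UNIV. A $ i $ j * x $ j * cnj (y $ i))" by (rule sum.swap)
  also have "\<dots> = cinner x (conj_transpose A *v y)"
    by (simp add: cinner_def matrix_vector_mult_def conj_transpose_def sum_distrib_left ac_simps)
  finally show ?thesis .
qed

lemma orthogonal_transformation_unitary:
  assumes "conj_transpose U ** U = mat 1"
  shows "orthogonal_transformation ((*v) U)"
  unfolding orthogonal_transformation_def
proof (intro conjI allI)
  show "linear ((*v) U)" by (rule linear_matrix_vector_mult)
  show "(U *v v) \<bullet> (U *v w) = v \<bullet> w" for v w
    by (simp add: inner_eq_Re_cinner cinner_matrix_left matrix_vector_mul_assoc assms)
qed

lemma convex_homogeneous2_body_norm:
  assumes "r > 0" "ball 0 r \<subseteq> K" "convex K"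
  shows "convex_homogeneous2 (1 / r\<^sup>2) (\<lambda>x. (body_norm K x)\<^sup>2)"
  unfolding convex_homogeneous2_def
proof (intro conjI allI impI)
  show "convex_on UNIV (\<lambda>x. (body_norm K x)\<^sup>2)" by (rule body_norm_convex[OF assms])
  show "(body_norm K x)\<^sup>2 \<le> 1 / r\<^sup>2 * (norm x)\<^sup>2" for x
    using power_mono[OF body_norm_le_norm[OF assms(1,2)] body_norm_nonneg[OF assms(1,2)], of x 2]
    by (simp add: power_divide)
  show "(body_norm K (c *\<^sub>R x))\<^sup>2 = c\<^sup>2 * (body_norm K x)\<^sup>2" if "c > 0" for c x
    using body_norm_scaleR[OF assms that] by (simp add: power_mult_distrib)
qed simp

text \<open>With \<open>M = T\<^sup>-\<^sup>1\<close> and \<open>U\<close> unitary such that \<open>Re tr (M U) \<ge> n\<close>, unitary invariance of the Gaussian measure and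
the supporting line at the identity give \<open>E F(M G) = E F(M U G) \<ge> E F(G) + c (Re tr (M U) - n)\<close>.\<close>

lemma ell2_minimal_if_cov_matrix_scalar:
  fixes K :: "(complex ^ 'n) set"
  assumes K: "r > 0" "ball 0 r \<subseteq> K" "convex K"
    and cov: "cov_matrix (\<lambda>x. (body_norm K x)\<^sup>2) = c *\<^sub>R mat 1"
    and T: "invertible T" "det T = 1"
  shows "ell2 K \<le> ell2 ((*v) T ` K)"
proof -
  define F where "F x = (body_norm K x)\<^sup>2" for x
  have F: "convex_homogeneous2 (1 / r\<^sup>2) F" unfolding F_def by (rule convex_homogeneous2_body_norm[OF K])
  obtain M where M: "T ** M = mat 1" "M ** T = mat 1" using T(1) by (auto simp: invertible_def)
  have dM: "det M = 1" using T(2) M(1) by (metis det_I det_mul mult_1)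
  have iM: "invertible M" using M by (auto simp: invertible_def)
  obtain U where U: "U ** conj_transpose U = mat 1" "conj_transpose U ** U = mat 1"
    "Re (trace (M ** U)) \<ge> CARD('n)" using exists_unitary_trace_ge[OF iM dM] by blast
  have "c * CARD('n) = 2 * (\<integral>x. F x \<partial>std_gaussian)"
    using mat_1_inner_cov_matrix[OF F] cov by (simp add: F_def[abs_def] mat_1_inner trace_I)
  then have c: "c \<ge> 0" using convex_homogeneous2_integral_nonneg[OF F]
    by (metis mult_nonneg_nonneg of_nat_0_less_iff zero_less_card_finite zero_le_mult_iff zero_le_numeral less_le_not_le)
  have "linear ((*v) M)" by (rule linear_matrix_vector_mult)
  then have [measurable]: "(\<lambda>x. F (M *v x)) \<in> borel_measurable borel"
    using measurable_compose[OF linear_borel_measurable convex_homogeneous2_measurable[OF F]] by blast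
  have bn: "body_norm ((*v) T ` K) x = body_norm K (M *v x)" for x
  proof -
    have "inj ((*v) T)" using M(2) by (metis injI matrix_vector_mul_assoc matrix_vector_mul_lid)
    from body_norm_linear_image[OF linear_matrix_vector_mult this, of K "M *v x"] show ?thesis
      by (simp add: matrix_vector_mul_assoc M)
  qed
  have "(\<integral>x. F x \<partial>std_gaussian) \<le> (\<integral>x. F x \<partial>std_gaussian) + ((M ** U) - mat 1) \<bullet> cov_matrix F"
  proof -
    have "((M ** U) - mat 1) \<bullet> cov_matrix F = c * (mat 1 \<bullet> ((M ** U) - mat 1))"
      using cov by (simp add: F_def[abs_def] inner_commute)
    also have "mat 1 \<bullet> ((M ** U) - mat 1) = Re (trace (M ** U)) - CARD('n)"
      by (simp add: mat_1_inner trace_sub trace_I)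
    finally show ?thesis using c U(3) by simp
  qed
  also have "\<dots> \<le> (\<integral>x. F ((M ** U) *v x) \<partial>std_gaussian)" by (rule convex_homogeneous2_supporting_line[OF F])
  also have "\<dots> = (\<integral>x. F (M *v (U *v x)) \<partial>std_gaussian)" by (simp add: matrix_vector_mul_assoc)
  also have "\<dots> = (\<integral>x. F (M *v x) \<partial>std_gaussian)"
    by (rule std_gaussian_integral_orthogonal[OF orthogonal_transformation_unitary[OF U(2)]]) measurable
  finally show ?thesis unfolding ell2_def bn F_def by (rule real_sqrt_le_mono)
qed

text \<open>The Hermitian product is determined by the real one: its imaginary part is \<open>x \<bullet> (\<i> y)\<close>.\<close>

lemma semilinear_cinner:
  assumes g: "semilinear \<sigma> g" "orthogonal_transformation g"
  shows "cinner (g x) (g y) = \<sigma> (cinner x y)"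
proof -
  have *: "cinner x y = Complex (x \<bullet> y) (x \<bullet> (\<i> *s y))" for x y :: "complex ^ 'a"
    by (simp add: inner_eq_Re_cinner cinner_smult_right complex_eq_iff)
  have \<sigma>: "\<sigma> = id \<or> \<sigma> = cnj" and gs: "g (\<i> *s y) = \<sigma> \<i> *s g y" using g(1) by (auto simp: semilinear_def)
  have on: "g v \<bullet> g w = v \<bullet> w" for v w using g(2) by (simp add: orthogonal_transformation_def)
  from \<sigma> show ?thesis
  proof
    assume s: "\<sigma> = id"
    have "g x \<bullet> (\<i> *s g y) = x \<bullet> (\<i> *s y)" using on[of x "\<i> *s y"] gs s by simp
    then show ?thesis by (simp add: *[of "g x"] *[of x] on s)
  next
    assume s: "\<sigma> = cnj"
    have "g (\<i> *s y) = - (\<i> *s g y)" using gs s by (simp add: vec_eq_iff)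
    then have "g x \<bullet> (\<i> *s g y) = - (x \<bullet> (\<i> *s y))" using on[of x "\<i> *s y"] by simp
    then show ?thesis by (simp add: *[of "g x"] *[of x] on s complex_eq_iff)
  qed
qed

text \<open>The identity \<open>g (\<langle>x, z\<rangle> z) = \<langle>g x, g z\<rangle> g z\<close> holds for conjugate linear \<open>g\<close> as well, since both
conjugations cancel. Then the orthogonal invariance of the Gaussian measure applies.\<close>

lemma cov_matrix_commute:
  assumes F: "convex_homogeneous2 C F" and g: "semilinear \<sigma> g" "orthogonal_transformation g"
    and inv: "\<And>x. F (g x) = F x"
  shows "g (cov_matrix F *v x) = cov_matrix F *v (g x)"
proof -
  have [measurable]: "F \<in> borel_measurable borel" by (rule convex_homogeneous2_measurable[OF F])
  define E where "E = (\<integral>x. F x \<partial>std_gaussian)"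
  have lin: "linear g" using g by (simp add: semilinear_def)
  have cm: "(\<lambda>z. cinner y z *s z) \<in> borel_measurable borel" for y :: "complex ^ 'a"
    unfolding cinner_def vector_scalar_mult_def
    by (intro borel_measurable_continuous_onI continuous_intros)
  have cb: "norm (cinner y z *s z) \<le> (real CARD('a) * norm y) * (norm z)\<^sup>2" for y z :: "complex ^ 'a"
  proof -
    have "norm (cinner y z *s z) \<le> (real CARD('a) * norm y * norm z) * norm z"
      unfolding norm_vector_smult by (intro mult_right_mono cmod_cinner_le) auto
    then show ?thesis by (simp add: power2_eq_square mult.assoc)
  qed
  have "g (cov_matrix F *v x) = (\<integral>z. g ((F z - E) *\<^sub>R (cinner x z *s z)) \<partial>std_gaussian)"
    unfolding cov_matrix_mult[OF F] E_def
    using lin convex_homogeneous2_weighted_integrable[OF F cm cb]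
    by (intro integral_bounded_linear[symmetric]) (auto simp: linear_conv_bounded_linear)
  also have "\<dots> = (\<integral>z. (F (g z) - E) *\<^sub>R (cinner (g x) (g z) *s g z) \<partial>std_gaussian)"
    using g(1) by (simp add: linear_cmul[OF lin] semilinear_cinner[OF g] inv semilinear_def)
  also have "\<dots> = (\<integral>z. (F z - E) *\<^sub>R (cinner (g x) z *s z) \<partial>std_gaussian)"
    using cm by (intro std_gaussian_integral_orthogonal[OF g(2)]) measurable
  also have "\<dots> = cov_matrix F *v (g x)" unfolding cov_matrix_mult[OF F] E_def ..
  finally show ?thesis .
qed

section \<open>Density matrices\<close>

lemma std_gaussian_second_moment_pos:
  "integrable std_gaussian (\<lambda>x::'a::euclidean_space. (norm x)\<^sup>2)" "0 < (\<integral>x. (norm (x::'a))\<^sup>2 \<partial>std_gaussian)"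
proof -
  show int: "integrable std_gaussian (\<lambda>x::'a. (norm x)\<^sup>2)"
    by (rule std_gaussian_integrable_poly[where C=1]) (use norm_sq_le_one_plus_pow4 in auto)
  have "(\<integral>x. (norm (x::'a))\<^sup>2 \<partial>std_gaussian) \<noteq> 0"
  proof
    assume "(\<integral>x. (norm (x::'a))\<^sup>2 \<partial>std_gaussian) = 0"
    then have "AE x::'a in std_gaussian. x = 0"
      using int by (subst (asm) integral_nonneg_eq_0_iff_AE) auto
    then have "AE x::'a in lborel. x = 0"
      unfolding std_gaussian_eq by (subst (asm) AE_density) (auto simp: gauss_density_pos)
    then have "AE x::'a in lborel. False" using AE_lborel_singleton[of "0::'a"] by eventually_elim simp
    then show False using AE_iff_null_sets[of UNIV "lborel :: 'a measure"] by (auto simp: null_sets_def)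
  qed
  moreover have "0 \<le> (\<integral>x. (norm (x::'a))\<^sup>2 \<partial>std_gaussian)" by simp
  ultimately show "0 < (\<integral>x. (norm (x::'a))\<^sup>2 \<partial>std_gaussian)" by linarith
qed

lemma orthogonal_transformation_between_unit_vectors:
  fixes v w :: "'a::euclidean_space"
  assumes "norm v = 1" "norm w = 1"
  obtains f where "orthogonal_transformation f" "f v = w"
proof -
  define u where "u = v - w"
  define f where "f x = x - (2 * (x \<bullet> u) / (u \<bullet> u)) *\<^sub>R u" for x
  have lin: "linear f" by (auto intro!: linearI simp: f_def inner_add_left algebra_simps add_divide_distrib)
  have "norm (f x) = norm x" for x
  proof (cases "u = 0")
    case False
    then have uu: "u \<bullet> u \<noteq> 0" by simp
    define c where "c = 2 * (x \<bullet> u) / (u \<bullet> u)"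
    have c: "c * (u \<bullet> u) = 2 * (x \<bullet> u)" using uu by (simp add: c_def)
    have "f x \<bullet> f x = x \<bullet> x - 2 * c * (x \<bullet> u) + c * (c * (u \<bullet> u))"
      unfolding f_def c_def[symmetric] inner_diff_left inner_diff_right inner_scaleR_left inner_scaleR_right inner_commute[of u x]
      by (simp add: algebra_simps)
    then have "f x \<bullet> f x = x \<bullet> x" unfolding c by simp
    then show ?thesis by (simp add: norm_eq_sqrt_inner)
  qed (simp add: f_def)
  then have "orthogonal_transformation f" using lin by (simp add: orthogonal_transformation)
  moreover have "f v = w"
  proof (cases "u = 0")
    case False
    have "v \<bullet> v = 1" "w \<bullet> w = 1" using assms by (simp_all add: norm_eq_sqrt_inner)
    then have "u \<bullet> u = 2 * (v \<bullet> u)" by (simp add: u_def inner_diff inner_commute)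
    then have "2 * (v \<bullet> u) / (u \<bullet> u) = 1" using False by (metis divide_self inner_eq_zero_iff)
    then show ?thesis unfolding f_def by (simp only: scaleR_one) (simp add: u_def)
  qed (simp add: f_def u_def)
  ultimately show thesis using that by blast
qed

text \<open>The moment is the same in all directions by rotation invariance, and it is positive because the sum over
a basis is \<open>E \<bar>G\<bar>\<^sup>2\<close>.\<close>

lemma std_gaussian_directional_moment:
  obtains \<kappa> :: real where "\<kappa> > 0" "\<And>v::'a::euclidean_space. norm v = 1 \<Longrightarrow> (\<integral>x. (x \<bullet> v)\<^sup>2 \<partial>std_gaussian) = \<kappa>"
proof -
  obtain b :: 'a where b: "b \<in> Basis" by (meson ex_in_conv nonempty_Basis)
  define \<kappa> where "\<kappa> = (\<integral>x. (x \<bullet> b)\<^sup>2 \<partial>std_gaussian)"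
  have eq: "(\<integral>x. (x \<bullet> v)\<^sup>2 \<partial>std_gaussian) = \<kappa>" if v: "norm v = 1" for v :: 'a
  proof -
    obtain f where f: "orthogonal_transformation f" "f v = b"
      using orthogonal_transformation_between_unit_vectors[of v b] v b by auto
    have "x \<bullet> v = f x \<bullet> b" for x using f by (metis orthogonal_transformation_def)
    then have "(\<integral>x. (x \<bullet> v)\<^sup>2 \<partial>std_gaussian) = (\<integral>x. (f x \<bullet> b)\<^sup>2 \<partial>std_gaussian)" by simp
    also have "\<dots> = \<kappa>" unfolding \<kappa>_def by (rule std_gaussian_integral_orthogonal[OF f(1)]) measurable
    finally show ?thesis .
  qed
  have int: "integrable std_gaussian (\<lambda>x::'a. (x \<bullet> c)\<^sup>2)" if "c \<in> Basis" for c
  proof (rule Bochner_Integration.integrable_bound[OF std_gaussian_second_moment_pos(1)])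
    have "(x \<bullet> c)\<^sup>2 \<le> (norm x)\<^sup>2" for x
      using power_mono[OF Basis_le_norm[OF that, of x], of 2] by simp
    then show "AE x in std_gaussian. norm ((x \<bullet> c)\<^sup>2) \<le> norm ((norm x)\<^sup>2)" by simp
  qed measurable
  have "(norm x)\<^sup>2 = (\<Sum>c\<in>Basis. (x \<bullet> c)\<^sup>2)" for x :: 'a
    unfolding power2_norm_eq_inner euclidean_inner[of x x] by (simp add: power2_eq_square)
  then have "(\<integral>x. (norm (x::'a))\<^sup>2 \<partial>std_gaussian) = (\<integral>x. (\<Sum>c\<in>Basis. ((x::'a) \<bullet> c)\<^sup>2) \<partial>std_gaussian)"
    by simp
  also have "\<dots> = (\<Sum>c\<in>(Basis::'a set). \<kappa>)"
    using int eq by (subst Bochner_Integration.integral_sum) auto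
  finally have "0 < real DIM('a) * \<kappa>" using std_gaussian_second_moment_pos(2)[where 'a='a] by simp
  then have "\<kappa> > 0" by (simp add: zero_less_mult_iff)
  with eq that show thesis by blast
qed

lemma norm_matrix_vector_le:
  fixes A :: "complex ^ 'n ^ 'n"
  shows "norm (A *v x) \<le> (real CARD('n))\<^sup>2 * norm A * norm x"
proof -
  have "norm (A *v x) \<le> (\<Sum>i\<in>UNIV. norm ((A *v x) $ i))"
    unfolding norm_vec_def[of "A *v x"] by (rule L2_set_le_sum) simp
  also have "\<dots> \<le> (\<Sum>i\<in>(UNIV::'n set). \<Sum>j\<in>(UNIV::'n set). norm A * norm x)"
  proof (intro sum_mono)
    fix i
    have "norm (A $ i $ j) \<le> norm A" for j
      using Finite_Cartesian_Product.norm_nth_le[of "A $ i" j] Finite_Cartesian_Product.norm_nth_le[of A i] by linarith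
    then show "norm ((A *v x) $ i) \<le> (\<Sum>j\<in>(UNIV::'n set). norm A * norm x)"
      unfolding matrix_vector_mult_def vec_lambda_beta
      by (intro sum_norm_le) (auto intro!: mult_mono simp: norm_mult Finite_Cartesian_Product.norm_nth_le)
  qed
  finally show ?thesis by (simp add: power2_eq_square ac_simps)
qed

lemma hermitian_symmetric:
  assumes "conj_transpose A = A"
  shows "(A *v x) \<bullet> y = x \<bullet> (A *v y)"
  using assms by (simp add: inner_eq_Re_cinner cinner_matrix_left)

lemma quadratic_expand:
  assumes "conj_transpose A = A"
  shows "(A *v (x + t *\<^sub>R y)) \<bullet> (x + t *\<^sub>R y) = (A *v x) \<bullet> x + 2 * t * ((A *v x) \<bullet> y) + t\<^sup>2 * ((A *v y) \<bullet> y)"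
  using hermitian_symmetric[OF assms, of y x]
  by (simp add: linear_add[OF linear_matrix_vector_mult] linear_cmul[OF linear_matrix_vector_mult] 
      inner_add inner_commute power2_eq_square algebra_simps)

text \<open>The trace condition is \<open>Re tr T = 1\<close>. The lower bound \<open>\<epsilon>\<close> keeps the set away from singular maps, for which
the interpolated body degenerates.\<close>

definition density_matrices :: "real \<Rightarrow> (complex ^ 'n ^ 'n) set" where
  "density_matrices \<epsilon> = {T. conj_transpose T = T \<and> mat 1 \<bullet> T = 1 \<and> (\<forall>x. \<epsilon> * (norm x)\<^sup>2 \<le> (T *v x) \<bullet> x)}"

lemma density_matrix_le_one:
  assumes "T \<in> (density_matrices \<epsilon> :: (complex ^ 'n ^ 'n) set)"
  shows "\<epsilon> \<le> 1"
proof -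
  have 1: "\<epsilon> \<le> Re (T $ i $ i)" for i
  proof -
    have "(T *v axis i 1) $ i = T $ i $ i"
      by (simp add: matrix_vector_mult_def axis_def if_distrib cong: if_cong)
    then have "(T *v axis i 1) \<bullet> axis i 1 = Re (T $ i $ i)" by (simp add: inner_axis inner_complex_def)
    moreover have "\<epsilon> * (norm (axis i 1 :: complex ^ 'n))\<^sup>2 \<le> (T *v axis i 1) \<bullet> axis i 1"
      using assms unfolding density_matrices_def by blast
    ultimately show ?thesis by simp
  qed
  have "real CARD('n) * \<epsilon> = (\<Sum>i\<in>(UNIV::'n set). \<epsilon>)" by simp
  also have "\<dots> \<le> (\<Sum>i\<in>UNIV. Re (T $ i $ i))" by (intro sum_mono 1)
  also have "\<dots> = 1" using assms by (simp add: density_matrices_def mat_1_inner trace_def)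
  finally have *: "real CARD('n) * \<epsilon> \<le> 1" .
  show ?thesis
  proof (rule ccontr)
    assume "\<not> \<epsilon> \<le> 1"
    moreover have "1 \<le> real CARD('n)" by (simp add: Suc_leI)
    ultimately have "1 * \<epsilon> \<le> real CARD('n) * \<epsilon>" by (intro mult_right_mono) auto
    with * \<open>\<not> \<epsilon> \<le> 1\<close> show False by simp
  qed
qed

context
  fixes T :: "complex ^ 'n ^ 'n" and \<epsilon> :: real
  assumes T: "T \<in> density_matrices \<epsilon>" and \<epsilon>: "\<epsilon> > 0"
begin

lemma density_matrix_lower: "\<epsilon> * norm x \<le> norm (T *v x)"
proof (cases "x = 0")
  case False
  have "\<epsilon> * (norm x)\<^sup>2 \<le> (T *v x) \<bullet> x" using T by (simp add: density_matrices_def)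
  also have "\<dots> \<le> norm (T *v x) * norm x" by (rule norm_cauchy_schwarz)
  finally have "(\<epsilon> * norm x) * norm x \<le> norm (T *v x) * norm x" by (simp add: power2_eq_square)
  then show ?thesis using False by simp
qed simp

lemma density_matrix_inj: "inj ((*v) T)"
proof (rule injI)
  fix x y assume "T *v x = T *v y"
  then have "\<epsilon> * norm (x - y) \<le> 0" using density_matrix_lower[of "x - y"] by (simp add: matrix_vector_mult_diff_distrib)
  then show "x = y" using \<epsilon> by (simp add: mult_le_0_iff)
qed

lemma density_matrix_ball_subset:
  assumes "ball 0 r \<subseteq> K"
  shows "ball 0 (\<epsilon> * r) \<subseteq> (*v) T ` K"
proof
  fix y :: "complex ^ 'n" assume y: "y \<in> ball 0 (\<epsilon> * r)"
  have "surj ((*v) T)"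
    by (rule linear_injective_imp_surjective[OF linear_matrix_vector_mult density_matrix_inj]) simp
  then obtain x where x: "y = T *v x" by (meson surjD)
  have "\<epsilon> * norm x < \<epsilon> * r" using density_matrix_lower[of x] y x by simp
  then have "x \<in> ball 0 r" using \<epsilon> by simp
  then show "y \<in> (*v) T ` K" using x assms by blast
qed

lemma density_matrix_quadratic_Cauchy_Schwarz:
  "((T *v x) \<bullet> y)\<^sup>2 \<le> ((T *v x) \<bullet> x) * ((T *v y) \<bullet> y)"
proof (cases "y = 0")
  case False
  have herm: "conj_transpose T = T" and pos: "\<epsilon> * (norm x)\<^sup>2 \<le> (T *v x) \<bullet> x" for x
    using T by (auto simp: density_matrices_def)
  define q where "q = (T *v y) \<bullet> y"
  have "0 < \<epsilon> * (norm y)\<^sup>2" using False \<epsilon> by simp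
  then have q: "q > 0" using pos[of y] unfolding q_def by linarith
  define t where "t = - ((T *v x) \<bullet> y) / q"
  have "0 \<le> \<epsilon> * (norm (x + t *\<^sub>R y))\<^sup>2" using \<epsilon> by simp
  also have "\<dots> \<le> (T *v (x + t *\<^sub>R y)) \<bullet> (x + t *\<^sub>R y)" by (rule pos)
  also have "\<dots> = (T *v x) \<bullet> x + 2 * t * ((T *v x) \<bullet> y) + t\<^sup>2 * q"
    unfolding quadratic_expand[OF herm] q_def ..
  also have "\<dots> = (T *v x) \<bullet> x - ((T *v x) \<bullet> y)\<^sup>2 / q"
    using q by (simp add: t_def power2_eq_square field_simps)
  finally show ?thesis using q by (simp add: q_def[symmetric] field_simps)
qed simp

text \<open>By the Cauchy-Schwarz inequality for the form of \<open>T\<close>, whose diagonal entries lie between 0 and 1, each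
real coordinate of \<open>T x\<close> has absolute value at most \<open>(T x \<bullet> x)\<^sup>1\<^sup>/\<^sup>2\<close>. The bound is independent of \<open>\<epsilon>\<close>.\<close>

lemma density_matrix_upper: "norm (T *v x) \<le> real DIM(complex ^ 'n) * norm x"
proof -
  have pos: "0 \<le> (T *v x) \<bullet> x" for x
    using T \<epsilon> by (auto simp: density_matrices_def intro: order_trans[of 0 "\<epsilon> * (norm x)\<^sup>2"])
  have tr: "(\<Sum>i\<in>UNIV. Re (T $ i $ i)) = 1" using T by (simp add: density_matrices_def mat_1_inner trace_def)
  have ax: "(T *v axis i u) \<bullet> axis i u = Re (T $ i $ i)" if "u \<in> {1, \<i>}" for i u
  proof -
    have "(T *v axis i u) $ i = T $ i $ i * u"
      by (simp add: matrix_vector_mult_def axis_def if_distrib cong: if_cong)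
    then show ?thesis using that by (auto simp: inner_axis inner_complex_def)
  qed
  have d0: "0 \<le> Re (T $ i $ i)" for i using pos[of "axis i 1"] ax[of 1 i] by simp
  have d1: "Re (T $ i $ i) \<le> 1" for i
    using tr member_le_sum[of i UNIV "\<lambda>i. Re (T $ i $ i)"] d0 by simp
  have b: "(T *v b) \<bullet> b \<le> 1" if "b \<in> Basis" for b
    using that d1 ax by (auto simp: Basis_vec_def Basis_complex_def)
  have "(norm (T *v x))\<^sup>2 = (\<Sum>b\<in>Basis. ((T *v x) \<bullet> b)\<^sup>2)"
    unfolding power2_norm_eq_inner euclidean_inner[of "T *v x" "T *v x"] by (simp add: power2_eq_square)
  also have "\<dots> \<le> (\<Sum>b\<in>(Basis :: (complex ^ 'n) set). (T *v x) \<bullet> x)"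
  proof (rule sum_mono)
    fix b :: "complex ^ 'n" assume "b \<in> Basis"
    have "((T *v x) \<bullet> b)\<^sup>2 \<le> ((T *v x) \<bullet> x) * ((T *v b) \<bullet> b)" by (rule density_matrix_quadratic_Cauchy_Schwarz)
    also have "\<dots> \<le> ((T *v x) \<bullet> x) * 1" using b[OF \<open>b \<in> Basis\<close>] pos by (intro mult_left_mono) auto
    finally show "((T *v x) \<bullet> b)\<^sup>2 \<le> (T *v x) \<bullet> x" by simp
  qed
  also have "\<dots> \<le> real DIM(complex ^ 'n) * (norm (T *v x) * norm x)"
    using norm_cauchy_schwarz[of "T *v x" x] by (simp del: DIM_cart add: mult_left_mono)
  finally have *: "norm (T *v x) * norm (T *v x) \<le> norm (T *v x) * (real DIM(complex ^ 'n) * norm x)"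
    by (simp only: power2_eq_square ac_simps)
  show ?thesis
  proof (cases "norm (T *v x) = 0")
    case False
    then show ?thesis using * by (simp del: DIM_cart)
  qed simp
qed

lemma density_matrix_norm_le: "norm T \<le> (real CARD('n))\<^sup>2 * real DIM(complex ^ 'n)"
proof -
  have e: "norm (T $ i $ j) \<le> real DIM(complex ^ 'n)" for i j
  proof -
    have "T $ i $ j = (T *v axis j 1) $ i"
      by (simp add: matrix_vector_mult_def axis_def if_distrib cong: if_cong)
    also have "norm \<dots> \<le> norm (T *v axis j 1)" by (rule Finite_Cartesian_Product.norm_nth_le)
    also have "\<dots> \<le> real DIM(complex ^ 'n) * norm (axis j 1 :: complex ^ 'n)" by (rule density_matrix_upper)
    finally show ?thesis by simp
  qed
  have "norm T \<le> (\<Sum>i\<in>UNIV. \<Sum>j\<in>UNIV. norm (T $ i $ j))" by (rule norm_matrix_le_sum_entries)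
  also have "\<dots> \<le> (\<Sum>i\<in>(UNIV::'n set). \<Sum>j\<in>(UNIV::'n set). real DIM(complex ^ 'n))"
    by (intro sum_mono e)
  finally show ?thesis by (simp add: power2_eq_square)
qed

lemma density_matrix_PD: "T \<in> PD"
proof -
  have "0 < (T *v x) \<bullet> x" if "x \<noteq> 0" for x
  proof -
    have "0 < \<epsilon> * (norm x)\<^sup>2" using that \<epsilon> by simp
    also have "\<dots> \<le> (T *v x) \<bullet> x" using T by (simp add: density_matrices_def)
    finally show ?thesis .
  qed
  then show ?thesis using T by (simp add: PD_def density_matrices_def)
qed

text \<open>A minimizer \<open>v\<close> of the Rayleigh quotient on the sphere decides: if the minimum is \<open>\<epsilon>\<close>, then the form of
\<open>T - \<epsilon> I\<close> is nonnegative and vanishes at \<open>v\<close>, so \<open>v\<close> is in the kernel of \<open>T - \<epsilon> I\<close>.\<close>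

lemma density_matrix_least_eigenvalue:
  obtains (interior) \<mu> where "\<mu> > \<epsilon>" "\<And>x. \<mu> * (norm x)\<^sup>2 \<le> (T *v x) \<bullet> x"
  | (eigenvector) v where "norm v = 1" "T *v v = \<epsilon> *\<^sub>R v"
proof -
  have herm: "conj_transpose T = T" and pos: "\<epsilon> * (norm x)\<^sup>2 \<le> (T *v x) \<bullet> x" for x
    using T by (auto simp: density_matrices_def)
  let ?S = "sphere (0::complex ^ 'n) 1"
  have "axis undefined 1 \<in> ?S" by simp
  then have ne: "?S \<noteq> {}" by blast
  have "continuous_on ?S ((*v) T)"
    by (rule linear_continuous_on[OF linear_conv_bounded_linear[THEN iffD1, OF linear_matrix_vector_mult]])
  then have cont: "continuous_on ?S (\<lambda>x. (T *v x) \<bullet> x)"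
    by (intro continuous_on_inner continuous_on_id)
  obtain v where v: "v \<in> ?S" "\<And>x. x \<in> ?S \<Longrightarrow> (T *v v) \<bullet> v \<le> (T *v x) \<bullet> x"
    using continuous_attains_inf[OF compact_sphere ne cont] by auto
  define \<mu> where "\<mu> = (T *v v) \<bullet> v"
  have nv: "norm v = 1" using v by simp
  have \<mu>: "\<mu> * (norm x)\<^sup>2 \<le> (T *v x) \<bullet> x" for x
  proof (cases "x = 0")
    case False
    have "\<mu> \<le> (T *v ((1 / norm x) *\<^sub>R x)) \<bullet> ((1 / norm x) *\<^sub>R x)"
      unfolding \<mu>_def using False by (intro v(2)) simp
    also have "\<dots> = ((T *v x) \<bullet> x) / (norm x)\<^sup>2"
      by (simp add: linear_cmul[OF linear_matrix_vector_mult] power2_eq_square)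
    finally show ?thesis using False by (simp add: pos_le_divide_eq)
  qed simp
  have "\<epsilon> \<le> \<mu>" using pos[of v] nv by (simp add: \<mu>_def)
  then consider "\<mu> > \<epsilon>" | "\<mu> = \<epsilon>" by linarith
  then show thesis
  proof cases
    case 1
    then show ?thesis using \<mu> interior by blast
  next
    case 2
    define y where "y = T *v v - \<epsilon> *\<^sub>R v"
    define a where "a = (norm y)\<^sup>2"
    define b where "b = (T *v y) \<bullet> y - \<epsilon> * (norm y)\<^sup>2"
    have nonneg: "0 \<le> 2 * t * a + t\<^sup>2 * b" for t
    proof -
      have "(norm (v + t *\<^sub>R y))\<^sup>2 = 1 + 2 * t * (v \<bullet> y) + t\<^sup>2 * (norm y)\<^sup>2"
      proof -
        have "v \<bullet> v = 1" using nv by (simp add: norm_eq_sqrt_inner)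
        then show ?thesis unfolding power2_norm_eq_inner
          by (simp add: inner_add_left inner_add_right inner_commute[of y v] power2_eq_square algebra_simps)
      qed
      moreover have "\<epsilon> * (norm (v + t *\<^sub>R y))\<^sup>2 \<le> (T *v v) \<bullet> v + 2 * t * ((T *v v) \<bullet> y) + t\<^sup>2 * ((T *v y) \<bullet> y)"
        using pos[of "v + t *\<^sub>R y"] unfolding quadratic_expand[OF herm] .
      moreover have "(T *v v) \<bullet> v = \<epsilon>" using 2 by (simp add: \<mu>_def)
      moreover have Tvy: "(T *v v) \<bullet> y = a + \<epsilon> * (v \<bullet> y)"
        unfolding a_def power2_norm_eq_inner by (subst (2) y_def) (simp add: inner_diff_left)
      ultimately have "\<epsilon> * (1 + 2 * t * (v \<bullet> y) + t\<^sup>2 * (norm y)\<^sup>2)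
          \<le> \<epsilon> + 2 * t * (a + \<epsilon> * (v \<bullet> y)) + t\<^sup>2 * ((T *v y) \<bullet> y)" by metis
      moreover have "2 * t * a + t\<^sup>2 * b = \<epsilon> + 2 * t * (a + \<epsilon> * (v \<bullet> y)) + t\<^sup>2 * ((T *v y) \<bullet> y)
          - \<epsilon> * (1 + 2 * t * (v \<bullet> y) + t\<^sup>2 * (norm y)\<^sup>2)"
        unfolding b_def by algebra
      ultimately show ?thesis by linarith
    qed
    have "a = 0"
    proof (rule ccontr)
      assume "a \<noteq> 0"
      then have a: "a > 0" by (simp add: a_def)
      \<comment> \<open>A quadratic function \<open>2 t a + t\<^sup>2 b\<close> with \<open>a > 0\<close> is negative at \<open>t = - a / c\<close>.\<close>
      define c where "c = \<bar>b\<bar> + 1"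
      have c: "c > 0" "b < c" by (auto simp: c_def)
      define s where "s = a / c"
      have s: "a = s * c" "s > 0" using c a by (simp_all add: s_def)
      have "0 \<le> 2 * (- s) * a + (- s)\<^sup>2 * b" by (rule nonneg)
      also have "\<dots> = s\<^sup>2 * (b - 2 * c)" unfolding s(1) by (simp add: power2_eq_square algebra_simps)
      also have "\<dots> < 0" using s c by (intro mult_pos_neg) auto
      finally show False by simp
    qed
    then have "T *v v = \<epsilon> *\<^sub>R v" by (simp add: a_def y_def)
    then show ?thesis using nv eigenvector by blast
  qed
qed

end

lemma convex_density_matrices: "convex (density_matrices \<epsilon>)"
proof (rule convexI)
  fix S T :: "complex ^ 'a ^ 'a" and u v :: real
  assume ST: "S \<in> density_matrices \<epsilon>" "T \<in> density_matrices \<epsilon>" and uv: "0 \<le> u" "0 \<le> v" "u + v = 1"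
  have "\<epsilon> * (norm x)\<^sup>2 \<le> ((u *\<^sub>R S + v *\<^sub>R T) *v x) \<bullet> x" for x
  proof -
    have "\<epsilon> * (norm x)\<^sup>2 = u * (\<epsilon> * (norm x)\<^sup>2) + v * (\<epsilon> * (norm x)\<^sup>2)"
      using uv(3) by (metis distrib_right mult_1)
    also have "\<dots> \<le> u * ((S *v x) \<bullet> x) + v * ((T *v x) \<bullet> x)"
      using ST uv by (intro add_mono mult_left_mono) (auto simp: density_matrices_def)
    finally show ?thesis
      by (simp add: linear_add[OF linear_matrix_apply] linear_cmul[OF linear_matrix_apply] inner_add_left)
  qed
  moreover have "conj_transpose (u *\<^sub>R S + v *\<^sub>R T) = u *\<^sub>R S + v *\<^sub>R T"
  proof -
    have "conj_transpose (u *\<^sub>R S + v *\<^sub>R T) = u *\<^sub>R conj_transpose S + v *\<^sub>R conj_transpose T"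
      by (simp add: conj_transpose_def vec_eq_iff)
    then show ?thesis using ST by (simp add: density_matrices_def)
  qed
  ultimately show "u *\<^sub>R S + v *\<^sub>R T \<in> density_matrices \<epsilon>"
    using ST uv by (simp add: density_matrices_def inner_add_right)
qed

lemma closed_density_matrices: "closed (density_matrices \<epsilon> :: (complex ^ 'n ^ 'n) set)"
proof -
  have "continuous_on UNIV (conj_transpose :: complex ^ 'n ^ 'n \<Rightarrow> _)"
    unfolding conj_transpose_def by (intro continuous_intros)
  moreover have "continuous_on UNIV (\<lambda>T :: complex ^ 'n ^ 'n. T *v x)" for x
    by (rule linear_continuous_on[OF linear_conv_bounded_linear[THEN iffD1, OF linear_matrix_apply]])
  ultimately show ?thesis
    unfolding density_matrices_def
    by (intro closed_Collect_conj closed_Collect_all closed_Collect_eq closed_Collect_le continuous_intros) auto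
qed

lemma compact_density_matrices:
  assumes "\<epsilon> > 0"
  shows "compact (density_matrices \<epsilon> :: (complex ^ 'n ^ 'n) set)"
  unfolding compact_eq_bounded_closed
  using closed_density_matrices density_matrix_norm_le assms by (auto simp: bounded_iff)

lemma scaled_identity_density_matrix:
  assumes "\<epsilon> \<le> 1 / real CARD('n)"
  shows "(1 / real CARD('n)) *\<^sub>R mat 1 \<in> (density_matrices \<epsilon> :: (complex ^ 'n ^ 'n) set)"
proof -
  have "conj_transpose ((1 / real CARD('n)) *\<^sub>R mat 1) = (1 / real CARD('n)) *\<^sub>R (mat 1 :: complex ^ 'n ^ 'n)"
    by (simp add: conj_transpose_def vec_eq_iff mat_def)
  moreover have "mat 1 \<bullet> ((1 / real CARD('n)) *\<^sub>R (mat 1 :: complex ^ 'n ^ 'n)) = 1"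
    by (simp add: mat_1_inner trace_I)
  moreover have "\<epsilon> * (norm x)\<^sup>2 \<le> (((1 / real CARD('n)) *\<^sub>R mat 1) *v x) \<bullet> x" for x :: "complex ^ 'n"
    using mult_right_mono[OF assms, of "(norm x)\<^sup>2"] 
    by (simp add: linear_cmul[OF linear_matrix_apply] power2_norm_eq_inner)
  ultimately show ?thesis unfolding density_matrices_def by blast
qed

section \<open>The interpolated bodies\<close>

locale two_bodies =
  fixes K0 K1 :: "(complex ^ 'n) set" and \<theta> r R :: real
  assumes convex: "convex K0" "convex K1"
    and r: "r > 0" "ball 0 r \<subseteq> K0" "ball 0 r \<subseteq> K1"
    and R: "R > 0" "K0 \<subseteq> cball 0 R" "K1 \<subseteq> cball 0 R"
    and \<theta>: "0 \<le> \<theta>" "\<theta> < 1"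
begin

definition body :: "complex ^ 'n ^ 'n \<Rightarrow> (complex ^ 'n) set" where
  "body T = interp ((*v) T ` K0) K1 \<theta>"

definition gauge_sq :: "complex ^ 'n ^ 'n \<Rightarrow> complex ^ 'n \<Rightarrow> real" where
  "gauge_sq T x = (body_norm (body T) x)\<^sup>2"

lemma convex_body: "convex (body T)"
  unfolding body_def by (intro convex_interp convex convex_linear_image linear_matrix_vector_mult)

context
  fixes T :: "complex ^ 'n ^ 'n" and \<epsilon> :: real
  assumes T: "T \<in> density_matrices \<epsilon>" and \<epsilon>: "\<epsilon> > 0"
begin

lemma ball_subset_body: "ball 0 (\<epsilon> * r) \<subseteq> body T"
proof -
  have "\<epsilon> * r \<le> 1 * r" using density_matrix_le_one[OF T] r(1) by (intro mult_right_mono) auto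
  then have "ball 0 (\<epsilon> * r) \<subseteq> K1" using r(3) by (force simp: subset_iff)
  then show ?thesis
    using Int_subset_interp[of "(*v) T ` K0" K1 \<theta>] density_matrix_ball_subset[OF T \<epsilon> r(2)]
    unfolding body_def by blast
qed

lemma body_inball: "\<epsilon> * r > 0" "ball 0 (\<epsilon> * r) \<subseteq> body T" "convex (body T)"
  using \<epsilon> r(1) ball_subset_body convex_body by auto

lemma convex_homogeneous2_gauge_sq: "convex_homogeneous2 (1 / (\<epsilon> * r)\<^sup>2) (gauge_sq T)"
  using convex_homogeneous2_body_norm[OF body_inball] by (simp add: gauge_sq_def[abs_def])

lemma bounded_body: "bounded (body T)"
proof -
  define a where "a = real CARD('n) * (real DIM(complex ^ 'n) * R)"
  define b where "b = real CARD('n) * R"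
  have ab: "a > 0" "b > 0" using R(1) by (auto simp: a_def b_def simp del: DIM_cart)
  have c: "cmod (cinner k (axis i 1)) \<le> real CARD('n) * norm k" for k :: "complex ^ 'n" and i
    using cmod_cinner_le[of k "axis i 1"] by simp
  have "norm x \<le> real CARD('n) * (a powr (1 - \<theta>) * b powr \<theta>)" if x: "x \<in> body T" for x
  proof -
    have "norm x \<le> (\<Sum>i\<in>UNIV. norm (x $ i))" unfolding norm_vec_def by (rule L2_set_le_sum) simp
    also have "\<dots> \<le> (\<Sum>i\<in>(UNIV :: 'n set). a powr (1 - \<theta>) * b powr \<theta>)"
    proof (rule sum_mono)
      fix i
      have "cmod (cinner x (axis i 1)) \<le> a powr (1 - \<theta>) * b powr \<theta>"
      proof (rule interp_cinner_bound[OF x[unfolded body_def] \<theta>(1) less_imp_le[OF \<theta>(2)] ab(1) _ ab(2)])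
        fix k assume "k \<in> (*v) T ` K0"
        then obtain l where l: "k = T *v l" "l \<in> K0" by blast
        then have "norm l \<le> R" using R(2) by auto
        then have "norm k \<le> real DIM(complex ^ 'n) * R"
          unfolding l(1) by (intro order_trans[OF density_matrix_upper[OF T \<epsilon>]] mult_left_mono) auto
        then have "real CARD('n) * norm k \<le> a" unfolding a_def by (intro mult_left_mono) auto
        then show "cmod (cinner k (axis i 1)) \<le> a" using c[of k i] by linarith
      next
        fix k assume "k \<in> K1"
        then have "norm k \<le> R" using R(3) by auto
        then have "real CARD('n) * norm k \<le> b" unfolding b_def by (intro mult_left_mono) auto
        then show "cmod (cinner k (axis i 1)) \<le> b" using c[of k i] by linarith
      qed
      moreover have "cinner x (axis i 1) = x $ i"
        by (simp add: cinner_def axis_def if_distrib cong: if_cong)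
      ultimately show "norm (x $ i) \<le> a powr (1 - \<theta>) * b powr \<theta>" by simp
    qed
    finally show ?thesis by simp
  qed
  then show ?thesis by (auto simp: bounded_iff)
qed

text \<open>A small ball, of radius independent of \<open>\<epsilon>\<close>, is mapped by \<open>T\<close> into \<open>T K\<^sub>0 \<inter> K\<^sub>1\<close> and hence into the
interpolated body.\<close>

lemma gauge_sq_image_bound:
  "(\<integral>x. gauge_sq T ((c *\<^sub>R T) *v x) \<partial>std_gaussian)
    \<le> (c * (real DIM(complex ^ 'n) + 1) / r)\<^sup>2 * (\<integral>x. (norm (x :: complex ^ 'n))\<^sup>2 \<partial>std_gaussian)"
  if c: "c > 0"
proof -
  define N where "N = real DIM(complex ^ 'n) + 1"
  have N: "N \<ge> 1" by (simp add: N_def)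
  have 1: "body_norm (body T) (T *v x) \<le> N / r * norm x" for x
  proof (rule dense_ge)
    fix s assume "N / r * norm x < s"
    then have s: "N * norm x < s * r" using r(1) by (simp add: field_simps)
    have "0 \<le> N * norm x" using N by simp
    with s have "0 < s * r" by linarith
    then have s0: "s > 0" using r(1) by (simp add: zero_less_mult_iff)
    define y where "y = (1 / s) *\<^sub>R x"
    have ny: "N * norm y < r" using s s0 by (simp add: y_def field_simps)
    have "norm y \<le> N * norm y" using N mult_right_mono[of 1 N "norm y"] by simp
    then have "y \<in> K0" using ny r(2) by auto
    moreover have "norm (T *v y) \<le> N * norm y"
    proof -
      have "norm (T *v y) \<le> (N - 1) * norm y"
        using density_matrix_upper[OF T \<epsilon>, of y] unfolding N_def by (simp del: DIM_cart)
      also have "\<dots> \<le> N * norm y" by (intro mult_right_mono) auto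
      finally show ?thesis .
    qed
    then have "T *v y \<in> K1" using ny r(3) by auto
    ultimately have "T *v y \<in> body T" using Int_subset_interp[of "(*v) T ` K0" K1 \<theta>] by (auto simp: body_def)
    then show "body_norm (body T) (T *v x) \<le> s"
      using s0 by (intro body_norm_le) (simp_all add: y_def linear_cmul[OF linear_matrix_vector_mult])
  qed
  have 2: "gauge_sq T ((c *\<^sub>R T) *v x) \<le> (c * N / r)\<^sup>2 * (norm x)\<^sup>2" for x
  proof -
    have "body_norm (body T) ((c *\<^sub>R T) *v x) = c * body_norm (body T) (T *v x)"
      using body_norm_scaleR[OF body_inball c] by (simp add: linear_cmul[OF linear_matrix_apply])
    also have "\<dots> \<le> c * (N / r * norm x)" using c 1 by (intro mult_left_mono) auto
    finally have "body_norm (body T) ((c *\<^sub>R T) *v x) \<le> (c * N / r) * norm x" by simp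
    then have "(body_norm (body T) ((c *\<^sub>R T) *v x))\<^sup>2 \<le> ((c * N / r) * norm x)\<^sup>2"
      by (intro power_mono body_norm_nonneg[OF body_inball(1,2)])
    then show ?thesis by (simp only: gauge_sq_def power_mult_distrib)
  qed
  have int: "integrable std_gaussian (\<lambda>x::complex ^ 'n. (c * N / r)\<^sup>2 * (norm x)\<^sup>2)"
    using std_gaussian_second_moment_pos(1)[where 'a="complex ^ 'n"] by simp
  have "(\<integral>x. gauge_sq T ((c *\<^sub>R T) *v x) \<partial>std_gaussian) \<le> (\<integral>x. (c * N / r)\<^sup>2 * (norm (x :: complex ^ 'n))\<^sup>2 \<partial>std_gaussian)"
  proof (rule integral_mono[OF _ int 2])
    have "(\<lambda>x. gauge_sq T ((c *\<^sub>R T) *v x)) \<in> borel_measurable borel"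
      using measurable_compose[OF linear_borel_measurable[OF linear_matrix_vector_mult] convex_homogeneous2_measurable[OF convex_homogeneous2_gauge_sq]] .
    then show "integrable std_gaussian (\<lambda>x. gauge_sq T ((c *\<^sub>R T) *v x))"
      using 2 by (intro Bochner_Integration.integrable_bound[OF int]) (auto simp: gauge_sq_def)
  qed
  then show ?thesis by (simp add: N_def)
qed

text \<open>In the direction of the eigenvector \<open>v\<close>, the body \<open>T K\<^sub>0\<close> has width of order \<open>\<epsilon>\<close> and \<open>K\<^sub>1\<close> has bounded width, so the
interpolated body has width of order \<open>\<epsilon>\<^sup>1\<^sup>-\<^sup>\<theta>\<close>.\<close>

lemma gauge_sq_lower_bound:
  assumes v: "norm v = 1" "T *v v = \<epsilon> *\<^sub>R v"
  shows "(\<integral>x. (x \<bullet> v)\<^sup>2 \<partial>std_gaussian) \<le> (real CARD('n) * R * \<epsilon> powr (1 - \<theta>))\<^sup>2 * (\<integral>x. gauge_sq T x \<partial>std_gaussian)"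
proof -
  define b where "b = real CARD('n) * R"
  have b: "b > 0" using R(1) by (simp add: b_def)
  have herm: "conj_transpose T = T" using T by (simp add: density_matrices_def)
  have c: "cmod (cinner k v) \<le> b" if "norm k \<le> R" for k
  proof -
    have "cmod (cinner k v) \<le> real CARD('n) * norm k" using cmod_cinner_le[of k v] v(1) by simp
    also have "\<dots> \<le> b" unfolding b_def using that by (intro mult_left_mono) auto
    finally show ?thesis .
  qed
  have k: "\<bar>k \<bullet> v\<bar> \<le> b * \<epsilon> powr (1 - \<theta>)" if "k \<in> body T" for k
  proof -
    have "cmod (cinner k v) \<le> (\<epsilon> * b) powr (1 - \<theta>) * b powr \<theta>"
    proof (rule interp_cinner_bound[OF that[unfolded body_def] \<theta>(1) less_imp_le[OF \<theta>(2)] _ _ b])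
      fix l assume "l \<in> (*v) T ` K0"
      then obtain m where m: "l = T *v m" "m \<in> K0" by blast
      have "\<epsilon> *\<^sub>R v = complex_of_real \<epsilon> *s v" by (simp add: vec_eq_iff scaleR_conv_of_real[where 'a=complex])
      then have "cinner l v = of_real \<epsilon> * cinner m v"
        by (simp add: m(1) cinner_matrix_left herm v(2) cinner_smult_right)
      then have "cmod (cinner l v) = \<epsilon> * cmod (cinner m v)" using \<epsilon> by (simp add: norm_mult)
      also have "\<dots> \<le> \<epsilon> * b" using c[of m] m R(2) \<epsilon> by (intro mult_left_mono) auto
      finally show "cmod (cinner l v) \<le> \<epsilon> * b" .
    next
      fix l assume "l \<in> K1"
      then show "cmod (cinner l v) \<le> b" using c R(3) by auto
    qed (use \<epsilon> b in simp)
    also have "\<dots> = b * \<epsilon> powr (1 - \<theta>)"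
      using \<epsilon> b by (simp add: powr_mult flip: powr_add)
    finally show ?thesis unfolding inner_eq_Re_cinner using abs_Re_le_cmod[of "cinner k v"] by linarith
  qed
  have 1: "\<bar>x \<bullet> v\<bar> \<le> b * \<epsilon> powr (1 - \<theta>) * body_norm (body T) x" for x
    by (rule body_norm_ge[OF body_inball(1,2) k]) (auto simp: abs_mult)
  have 2: "(x \<bullet> v)\<^sup>2 \<le> (b * \<epsilon> powr (1 - \<theta>))\<^sup>2 * gauge_sq T x" for x
    using power_mono[OF 1[of x], of 2] by (simp add: gauge_sq_def power_mult_distrib)
  have "integrable std_gaussian (gauge_sq T)"
  proof (rule std_gaussian_integrable_poly[where C="1 / (\<epsilon> * r)\<^sup>2"])
    show "gauge_sq T \<in> borel_measurable borel" by (rule convex_homogeneous2_measurable[OF convex_homogeneous2_gauge_sq])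
    fix x
    have "gauge_sq T x \<le> 1 / (\<epsilon> * r)\<^sup>2 * (norm x)\<^sup>2" using convex_homogeneous2_gauge_sq by (simp add: convex_homogeneous2_def)
    also have "\<dots> \<le> 1 / (\<epsilon> * r)\<^sup>2 * (1 + norm x ^ 4)"
      by (intro mult_left_mono norm_sq_le_one_plus_pow4) simp
    finally show "norm (gauge_sq T x) \<le> 1 / (\<epsilon> * r)\<^sup>2 * (1 + norm x ^ 4)"
      by (simp add: gauge_sq_def)
  qed
  then have int: "integrable std_gaussian (\<lambda>x. (b * \<epsilon> powr (1 - \<theta>))\<^sup>2 * gauge_sq T x)" by simp
  have "(\<integral>x. (x \<bullet> v)\<^sup>2 \<partial>std_gaussian) \<le> (\<integral>x. (b * \<epsilon> powr (1 - \<theta>))\<^sup>2 * gauge_sq T x \<partial>std_gaussian)"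
  proof (rule integral_mono[OF _ int 2])
    show "integrable std_gaussian (\<lambda>x. (x \<bullet> v)\<^sup>2)"
      using 2 by (intro Bochner_Integration.integrable_bound[OF int]) (auto simp: gauge_sq_def)
  qed
  then show ?thesis by (simp add: b_def)
qed

end

text \<open>If \<open>S\<close> is close to \<open>T\<close>, then \<open>S K\<^sub>0 \<subseteq> (1 + \<eta>) T K\<^sub>0\<close>, because \<open>T K\<^sub>0\<close> is convex and contains a ball of radius
\<open>\<epsilon> r\<close>. Enlarging \<open>K\<^sub>1\<close> by the same factor, the interpolated body is enlarged by this factor.\<close>

lemma body_comparison:
  assumes ST: "S \<in> density_matrices \<epsilon>" "T \<in> density_matrices \<epsilon>" and \<epsilon>: "\<epsilon> > 0" 
    and \<eta>: "\<eta> > 0" "(real CARD('n))\<^sup>2 * norm (S - T) * R < \<eta> * (\<epsilon> * r)"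
  shows "gauge_sq T x \<le> (1 + \<eta>)\<^sup>2 * gauge_sq S x"
proof -
  \<comment> \<open>Both inclusions between the bodies come from \<open>C + \<eta> C \<subseteq> (1 + \<eta>) C\<close> for convex \<open>C\<close>.\<close>
  have conv: "a + \<eta> *\<^sub>R b \<in> (*\<^sub>R) (1 + \<eta>) ` C" if "convex C" "a \<in> C" "b \<in> C" for a b :: "complex ^ 'n" and C
  proof -
    have "(1 / (1 + \<eta>)) *\<^sub>R a + (\<eta> / (1 + \<eta>)) *\<^sub>R b \<in> C"
      using \<eta>(1) that by (intro convexD) (auto simp: add_divide_distrib[symmetric])
    then show ?thesis
      using \<eta>(1) by (intro image_eqI[of _ _ "(1 / (1 + \<eta>)) *\<^sub>R a + (\<eta> / (1 + \<eta>)) *\<^sub>R b"]) (auto simp: scaleR_add_right)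
  qed
  have 0: "(*v) S ` K0 \<subseteq> (*\<^sub>R) (1 + \<eta>) ` (*v) T ` K0"
  proof
    fix y assume "y \<in> (*v) S ` K0"
    then obtain k where k: "y = S *v k" "k \<in> K0" by blast
    have "norm ((S - T) *v k) \<le> (real CARD('n))\<^sup>2 * norm (S - T) * norm k" by (rule norm_matrix_vector_le)
    also have "\<dots> \<le> (real CARD('n))\<^sup>2 * norm (S - T) * R" using k R(2) by (intro mult_left_mono) auto
    also have "\<dots> < \<eta> * (\<epsilon> * r)" by (rule \<eta>)
    finally have "(1 / \<eta>) *\<^sub>R ((S - T) *v k) \<in> ball 0 (\<epsilon> * r)" using \<eta>(1) by (simp add: field_simps)
    then have "(1 / \<eta>) *\<^sub>R ((S - T) *v k) \<in> (*v) T ` K0"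
      using density_matrix_ball_subset[OF ST(2) \<epsilon> r(2)] by blast
    moreover have "convex ((*v) T ` K0)" by (intro convex_linear_image convex linear_matrix_vector_mult)
    moreover have "T *v k \<in> (*v) T ` K0" using k by blast
    ultimately have "T *v k + \<eta> *\<^sub>R ((1 / \<eta>) *\<^sub>R ((S - T) *v k)) \<in> (*\<^sub>R) (1 + \<eta>) ` (*v) T ` K0"
      by (intro conv)
    moreover have "y = T *v k + \<eta> *\<^sub>R ((1 / \<eta>) *\<^sub>R ((S - T) *v k))"
      using \<eta>(1) by (simp add: k matrix_vector_mult_diff_rdistrib)
    ultimately show "y \<in> (*\<^sub>R) (1 + \<eta>) ` (*v) T ` K0" by simp
  qed
  have 1: "K1 \<subseteq> (*\<^sub>R) (1 + \<eta>) ` K1"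
  proof
    fix y assume "y \<in> K1"
    moreover have "0 \<in> K1" using r by (meson centre_in_ball subsetD)
    ultimately show "y \<in> (*\<^sub>R) (1 + \<eta>) ` K1" using conv[OF convex(2), of y 0] by simp
  qed
  have inv: "(*\<^sub>R) (1 / (1 + \<eta>)) ` (*\<^sub>R) (1 + \<eta>) ` C = C" for C :: "(complex ^ 'n) set"
    using \<eta>(1) by (simp add: image_image)
  have "(*\<^sub>R) (1 / (1 + \<eta>)) ` body S \<subseteq> (*\<^sub>R) (1 / (1 + \<eta>)) ` interp ((*\<^sub>R) (1 + \<eta>) ` (*v) T ` K0) ((*\<^sub>R) (1 + \<eta>) ` K1) \<theta>"
    unfolding body_def by (intro image_mono interp_mono 0 1)
  also have "\<dots> \<subseteq> body T"
    unfolding body_def by (rule interp_semilinear_image[OF semilinear_scaleR]) (simp_all only: inv order_refl)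
  finally have "(*\<^sub>R) (1 / (1 + \<eta>)) ` body S \<subseteq> body T" .
  then have sub: "body_norm (body T) x \<le> body_norm ((*\<^sub>R) (1 / (1 + \<eta>)) ` body S) x"
  proof (intro body_norm_antimono[of "1 / (1 + \<eta>) * (\<epsilon> * r)"])
    show "1 / (1 + \<eta>) * (\<epsilon> * r) > 0" using \<eta> \<epsilon> r by simp
    show "ball 0 (1 / (1 + \<eta>) * (\<epsilon> * r)) \<subseteq> (*\<^sub>R) (1 / (1 + \<eta>)) ` body S"
    proof
      fix y :: "complex ^ 'n" assume "y \<in> ball 0 (1 / (1 + \<eta>) * (\<epsilon> * r))"
      then have "(1 + \<eta>) * norm y < \<epsilon> * r" using \<eta>(1) by (simp add: field_simps)
      then have "norm ((1 + \<eta>) *\<^sub>R y) < \<epsilon> * r" unfolding norm_scaleR using \<eta>(1) by simp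
      then have "(1 + \<eta>) *\<^sub>R y \<in> body S" using ball_subset_body[OF ST(1) \<epsilon>] by auto
      then show "y \<in> (*\<^sub>R) (1 / (1 + \<eta>)) ` body S"
        using \<eta> by (intro image_eqI[of _ _ "(1 + \<eta>) *\<^sub>R y"]) auto
    qed
  qed
  also have "\<dots> = (1 + \<eta>) * body_norm (body S) x"
    using body_norm_scaled_body[OF body_inball[OF ST(1) \<epsilon>], of "1 / (1 + \<eta>)" x] \<eta> by simp
  finally have "body_norm (body T) x \<le> (1 + \<eta>) * body_norm (body S) x" .
  then have "(body_norm (body T) x)\<^sup>2 \<le> ((1 + \<eta>) * body_norm (body S) x)\<^sup>2"
    by (intro power_mono body_norm_nonneg[OF body_inball(1,2)[OF ST(2) \<epsilon>]])
  then show ?thesis by (simp add: gauge_sq_def power_mult_distrib)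
qed

lemma gauge_sq_tendsto:
  assumes \<epsilon>: "\<epsilon> > 0" and S: "\<And>k. S k \<in> density_matrices \<epsilon>" and T: "T \<in> density_matrices \<epsilon>"
    and lim: "S \<longlonglongrightarrow> T"
  shows "(\<lambda>k. gauge_sq (S k) x) \<longlonglongrightarrow> gauge_sq T x"
proof -
  define L where "L = ((real CARD('n))\<^sup>2 * R + 1) / (\<epsilon> * r)"
  have L: "L > 0" using R(1) \<epsilon> r(1) by (auto simp: L_def add_nonneg_pos)
  \<comment> \<open>The summand \<open>1 / (k + 1)\<close> keeps \<open>e k\<close> positive when \<open>S k = T\<close>.\<close>
  define e where "e k = L * (norm (S k - T) + 1 / real (Suc k))" for k
  have e: "e k > 0" for k using L by (simp add: e_def add_nonneg_pos)
  have lt: "(real CARD('n))\<^sup>2 * norm (S k - T) * R < e k * (\<epsilon> * r)" for k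
  proof -
    have "e k * (\<epsilon> * r) = ((real CARD('n))\<^sup>2 * R + 1) * (norm (S k - T) + 1 / real (Suc k))"
      using \<epsilon> r(1) by (simp add: e_def L_def)
    moreover have "((real CARD('n))\<^sup>2 * R + 1) * (norm (S k - T) + 1 / real (Suc k))
       > ((real CARD('n))\<^sup>2 * R) * norm (S k - T)"
      using R(1) by (intro mult_strict_mono) (auto simp: add_nonneg_pos)
    ultimately show ?thesis by (simp add: mult.assoc mult.left_commute mult.commute)
  qed
  have 1: "gauge_sq T x \<le> (1 + e k)\<^sup>2 * gauge_sq (S k) x" for k
    by (rule body_comparison[OF S T \<epsilon> e lt])
  have 2: "gauge_sq (S k) x \<le> (1 + e k)\<^sup>2 * gauge_sq T x" for k
    by (rule body_comparison[OF T S \<epsilon> e]) (use lt[of k] in \<open>simp add: norm_minus_commute\<close>)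
  have "(\<lambda>k. norm (S k - T)) \<longlonglongrightarrow> 0" using lim by (simp add: LIM_zero_iff tendsto_norm_zero_iff)
  then have "e \<longlonglongrightarrow> L * (0 + 0)" unfolding e_def
    by (intro tendsto_intros LIMSEQ_Suc[OF lim_1_over_n])
  then have e0: "e \<longlonglongrightarrow> 0" by simp
  have low: "(\<lambda>k. gauge_sq T x / (1 + e k)\<^sup>2) \<longlonglongrightarrow> gauge_sq T x / (1 + 0)\<^sup>2"
    by (intro tendsto_intros e0) auto
  have up: "(\<lambda>k. (1 + e k)\<^sup>2 * gauge_sq T x) \<longlonglongrightarrow> (1 + 0)\<^sup>2 * gauge_sq T x"
    by (intro tendsto_intros e0)
  have "gauge_sq T x / (1 + e k)\<^sup>2 \<le> gauge_sq (S k) x" for k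
    using 1[of k] e[of k] by (simp add: pos_divide_le_eq mult.commute add_pos_pos)
  then show ?thesis
    using tendsto_sandwich[OF always_eventually always_eventually, OF allI allI, OF _ 2 low[simplified] up[simplified]]
    by blast
qed

text \<open>The comparison of bodies gives pointwise convergence of the squared norms, and the ball contained in
all bodies gives the domination.\<close>

lemma continuous_on_cov_matrix_gauge_sq:
  assumes \<epsilon>: "\<epsilon> > 0"
  shows "continuous_on (density_matrices \<epsilon>) (\<lambda>T. cov_matrix (gauge_sq T))"
proof (unfold continuous_on_sequentially, intro ballI allI impI, elim conjE)
  fix S :: "nat \<Rightarrow> complex ^ 'n ^ 'n" and T
  assume T: "T \<in> density_matrices \<epsilon>" and S': "\<forall>k. S k \<in> density_matrices \<epsilon>" and lim: "S \<longlonglongrightarrow> T"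
  then have S: "S k \<in> density_matrices \<epsilon>" for k by blast
  note quad = convex_homogeneous2_gauge_sq[OF _ \<epsilon>]
  note pt = gauge_sq_tendsto[OF \<epsilon> S T lim]
  have meas: "gauge_sq (S k) \<in> borel_measurable borel" "gauge_sq T \<in> borel_measurable borel" for k
    using convex_homogeneous2_measurable[OF quad[OF S]] convex_homogeneous2_measurable[OF quad[OF T]] by auto
  note [measurable] = meas
  define C where "C = 1 / (\<epsilon> * r)\<^sup>2"
  have b: "0 \<le> gauge_sq (S k) x" "gauge_sq (S k) x \<le> C * (norm x)\<^sup>2" for k x
    using quad[OF S] by (auto simp: convex_homogeneous2_def C_def)
  have C: "C \<ge> 0" by (simp add: C_def)
  have mean: "(\<lambda>k. \<integral>x. gauge_sq (S k) x \<partial>std_gaussian) \<longlonglongrightarrow> (\<integral>x. gauge_sq T x \<partial>std_gaussian)"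
  proof (rule integral_dominated_convergence[where w="\<lambda>x. C * (norm x)\<^sup>2"])
    show "integrable std_gaussian (\<lambda>x :: complex ^ 'n. C * (norm x)\<^sup>2)"
      using std_gaussian_second_moment_pos(1)[where 'a="complex ^ 'n"] by simp
  qed (use b pt in auto)
  obtain M where M: "\<And>k. \<bar>\<integral>x. gauge_sq (S k) x \<partial>std_gaussian\<bar> \<le> M"
    using convergent_imp_Bseq[OF convergentI[OF mean]] by (auto simp: Bseq_def)
  have "(\<lambda>k. cov_matrix (gauge_sq (S k))) \<longlonglongrightarrow> cov_matrix (gauge_sq T)"
    unfolding cov_matrix_def
  proof (rule integral_dominated_convergence[where w="\<lambda>x. (C * (norm x)\<^sup>2 + M) * ((real CARD('n))\<^sup>2 * (norm x)\<^sup>2)"])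
    have M0: "M \<ge> 0" using M[of 0] by linarith
    show "integrable std_gaussian (\<lambda>x :: complex ^ 'n. (C * (norm x)\<^sup>2 + M) * ((real CARD('n))\<^sup>2 * (norm x)\<^sup>2))"
    proof (rule std_gaussian_integrable_poly[where C="(C + M) * (real CARD('n))\<^sup>2"])
      fix x :: "complex ^ 'n"
      have "(C * (norm x)\<^sup>2 + M) * ((real CARD('n))\<^sup>2 * (norm x)\<^sup>2)
        = (C * (real CARD('n))\<^sup>2) * norm x ^ 4 + (M * (real CARD('n))\<^sup>2) * (norm x)\<^sup>2"
        by (simp add: algebra_simps flip: power_add)
      also have "\<dots> \<le> (C * (real CARD('n))\<^sup>2) * (1 + norm x ^ 4) + (M * (real CARD('n))\<^sup>2) * (1 + norm x ^ 4)"
        using norm_sq_le_one_plus_pow4[of x] C M0 by (intro add_mono mult_left_mono) auto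
      also have "\<dots> = (C + M) * (real CARD('n))\<^sup>2 * (1 + norm x ^ 4)" by (simp add: algebra_simps)
      finally show "norm ((C * (norm x)\<^sup>2 + M) * ((real CARD('n))\<^sup>2 * (norm x)\<^sup>2))
          \<le> (C + M) * (real CARD('n))\<^sup>2 * (1 + norm x ^ 4)"
        using C M0 by simp
    qed measurable
    show "AE x in std_gaussian. (\<lambda>k. (gauge_sq (S k) x - (\<integral>x. gauge_sq (S k) x \<partial>std_gaussian)) *\<^sub>R outer x)
        \<longlonglongrightarrow> (gauge_sq T x - (\<integral>x. gauge_sq T x \<partial>std_gaussian)) *\<^sub>R outer x"
      by (intro AE_I2 tendsto_intros pt mean)
    show "AE x in std_gaussian. norm ((gauge_sq (S k) x - (\<integral>x. gauge_sq (S k) x \<partial>std_gaussian)) *\<^sub>R outer x)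
        \<le> (C * (norm x)\<^sup>2 + M) * ((real CARD('n))\<^sup>2 * (norm x)\<^sup>2)" for k
    proof (rule AE_I2)
      fix x :: "complex ^ 'n"
      have "\<bar>gauge_sq (S k) x - (\<integral>x. gauge_sq (S k) x \<partial>std_gaussian)\<bar> \<le> C * (norm x)\<^sup>2 + M"
        using b[of k x] M[of k] by linarith
      then show "norm ((gauge_sq (S k) x - (\<integral>x. gauge_sq (S k) x \<partial>std_gaussian)) *\<^sub>R outer x)
        \<le> (C * (norm x)\<^sup>2 + M) * ((real CARD('n))\<^sup>2 * (norm x)\<^sup>2)"
        unfolding norm_scaleR using C M0 by (intro mult_mono norm_outer_le) auto
    qed
  qed measurable
  then show "((\<lambda>T. cov_matrix (gauge_sq T)) \<circ> S) \<longlonglongrightarrow> cov_matrix (gauge_sq T)" by (simp add: o_def)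
qed

end

section \<open>A map with scalar first variation\<close>

lemma semilinear_inv:
  assumes g: "semilinear \<sigma> g" and inv: "\<And>x. g (h x) = x" "\<And>x. h (g x) = x"
  shows "semilinear \<sigma> h"
proof -
  have \<sigma>: "\<sigma> = id \<or> \<sigma> = cnj" and lin: "linear g" and gs: "\<And>c x. g (c *s x) = \<sigma> c *s g x"
    using g by (auto simp: semilinear_def)
  have inj: "x = y" if "g x = g y" for x y using inv(2) that by metis
  have "linear h"
  proof (rule linearI)
    show "h (x + y) = h x + h y" for x y by (rule inj) (simp add: inv linear_add[OF lin])
    show "h (c *\<^sub>R x) = c *\<^sub>R h x" for c x by (rule inj) (simp add: inv linear_cmul[OF lin])
  qed
  moreover have "h (c *s x) = \<sigma> c *s h x" for c x
    by (rule inj) (use \<sigma> in \<open>auto simp: inv gs\<close>)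
  ultimately show ?thesis using \<sigma> by (auto simp: semilinear_def)
qed

context two_bodies
begin

lemma body_invariant:
  assumes g: "semilinear \<sigma> g" "bij g" and K: "g ` K0 = K0" "g ` K1 = K1"
    and comm: "\<And>x. g (T *v x) = T *v g x"
  shows "g ` body T = body T"
proof -
  define h where "h = inv_into UNIV g"
  have gh: "g (h x) = x" "h (g x) = x" for x
    using g(2) by (simp_all add: h_def bij_is_surj surj_f_inv_f bij_is_inj)
  have h: "semilinear \<sigma> h" by (rule semilinear_inv[OF g(1) gh])
  have hg: "h ` g ` C = C" for C by (simp add: image_image gh)
  have hK: "h ` K0 = K0" "h ` K1 = K1" using hg[of K0] hg[of K1] K by simp_all
  have hcomm: "h (T *v x) = T *v h x" for x
    using comm[of "h x"] gh(1)[of x] gh(2)[of "T *v h x"] by simp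
  have "g ` (*v) T ` K0 = (*v) T ` g ` K0" "h ` (*v) T ` K0 = (*v) T ` h ` K0"
    by (simp_all add: image_image comm hcomm)
  then have "g ` body T \<subseteq> body T" "h ` body T \<subseteq> body T"
    unfolding body_def using K hK
    by (intro interp_semilinear_image[OF g(1)] interp_semilinear_image[OF h]; simp)+
  moreover have "body T = g ` h ` body T" by (simp add: image_image gh)
  ultimately show ?thesis by blast
qed

lemma gauge_sq_invariant:
  assumes g: "semilinear \<sigma> g" "bij g" and K: "g ` K0 = K0" "g ` K1 = K1"
    and comm: "\<And>x. g (T *v x) = T *v g x"
  shows "gauge_sq T (g x) = gauge_sq T x"
proof -
  have "linear g" using g(1) by (simp add: semilinear_def)
  then have "body_norm (g ` body T) (g x) = body_norm (body T) x"
    using g(2) by (intro body_norm_linear_image) (auto simp: bij_is_inj)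
  then show ?thesis by (simp add: gauge_sq_def body_invariant[OF assms])
qed

text \<open>The first integral is bounded independently of \<open>\<epsilon>\<close>, and the second one is at least a multiple of
\<open>\<epsilon>\<^sup>-\<^sup>2\<^sup>(\<^sup>1\<^sup>-\<^sup>\<theta>\<^sup>)\<close>, which is unbounded since \<open>\<theta> < 1\<close>.\<close>

lemma exists_small_threshold:
  obtains \<epsilon> where "\<epsilon> > 0" "\<epsilon> \<le> 1 / real CARD('n)" 
    "\<And>v T. T \<in> density_matrices \<epsilon> \<Longrightarrow> norm v = 1 \<Longrightarrow> T *v v = \<epsilon> *\<^sub>R v \<Longrightarrow>
      (\<integral>x. gauge_sq T ((real CARD('n) *\<^sub>R T) *v x) \<partial>std_gaussian) < (\<integral>x. gauge_sq T x \<partial>std_gaussian)"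
proof -
  obtain \<kappa> :: real where \<kappa>: "\<kappa> > 0" "\<And>v::complex ^ 'n. norm v = 1 \<Longrightarrow> (\<integral>x. (x \<bullet> v)\<^sup>2 \<partial>std_gaussian) = \<kappa>"
    using std_gaussian_directional_moment by blast
  define n where "n = real CARD('n)"
  have n: "n > 0" by (simp add: n_def)
  define A where "A = (n * (real DIM(complex ^ 'n) + 1) / r)\<^sup>2 * (\<integral>x. (norm (x :: complex ^ 'n))\<^sup>2 \<partial>std_gaussian)"
  have "n * (real DIM(complex ^ 'n) + 1) / r > 0" using n r(1) by (simp add: add_nonneg_pos)
  then have A: "A > 0" unfolding A_def using std_gaussian_second_moment_pos(2)[where 'a="complex ^ 'n"]
    by (intro mult_pos_pos zero_less_power) 
  define q where "q = sqrt (\<kappa> / A) / (n * R)"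
  have q: "q > 0" using \<kappa> A n R(1) by (simp add: q_def)
  define p where "p = 1 - \<theta>"
  have p: "p > 0" using \<theta> by (simp add: p_def)
  \<comment> \<open>Half of \<open>q\<^sup>1\<^sup>/\<^sup>p\<close> gives \<open>\<epsilon>\<^sup>p < q\<close>; the bound \<open>1 / n\<close> makes \<open>I/n\<close> admissible.\<close>
  define \<epsilon> where "\<epsilon> = min (1 / n) (q powr (1 / p) / 2)"
  have \<epsilon>: "\<epsilon> > 0" "\<epsilon> \<le> 1 / n" "\<epsilon> < q powr (1 / p)" using n q by (auto simp: \<epsilon>_def min_less_iff_disj)
  have "\<epsilon> powr p < (q powr (1 / p)) powr p" using \<epsilon> p by (intro powr_less_mono2) auto
  also have "\<dots> = q" using q p by (simp add: powr_powr)
  finally have "n * R * \<epsilon> powr p < n * R * q" using n R(1) by simp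
  also have "\<dots> = sqrt (\<kappa> / A)" using n R(1) by (simp add: q_def)
  finally have "(n * R * \<epsilon> powr p)\<^sup>2 < (sqrt (\<kappa> / A))\<^sup>2"
    using n R(1) by (intro power_strict_mono) auto
  then have lt: "(n * R * \<epsilon> powr p)\<^sup>2 * A < \<kappa>" using \<kappa> A by (simp add: field_simps)
  show thesis
  proof (rule that[OF \<epsilon>(1)])
    show "\<epsilon> \<le> 1 / real CARD('n)" using \<epsilon>(2) by (simp add: n_def)
    fix v and T :: "complex ^ 'n ^ 'n" assume T: "T \<in> density_matrices \<epsilon>" and v: "norm v = 1" "T *v v = \<epsilon> *\<^sub>R v"
    define E where "E = (\<integral>x. gauge_sq T x \<partial>std_gaussian)"
    have 1: "\<kappa> \<le> (n * R * \<epsilon> powr p)\<^sup>2 * E"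
      using gauge_sq_lower_bound[OF T \<epsilon>(1) v] \<kappa>(2)[OF v(1)] by (simp add: n_def p_def E_def)
    have 2: "(\<integral>x. gauge_sq T ((n *\<^sub>R T) *v x) \<partial>std_gaussian) \<le> A"
      using gauge_sq_image_bound[OF T \<epsilon>(1) n] by (simp add: A_def)
    have "(n * R * \<epsilon> powr p)\<^sup>2 * A < (n * R * \<epsilon> powr p)\<^sup>2 * E" using lt 1 by linarith
    then have "A < E" by (simp add: mult_less_cancel_left_pos mult_less_cancel_left)
    with 2 show "(\<integral>x. gauge_sq T ((real CARD('n) *\<^sub>R T) *v x) \<partial>std_gaussian) < (\<integral>x. gauge_sq T x \<partial>std_gaussian)"
      by (simp add: n_def E_def)
  qed
qed

text \<open>A variational inequality on the density matrices that commute with \<open>\<G>\<close>, solved by Brouwer's theorem.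
Its solution cannot touch the constraint \<open>T \<ge> \<epsilon> I\<close>, so the traceless part of the covariance matrix is an
admissible direction and must vanish.\<close>

lemma exists_scalar_cov_matrix:
  assumes \<G>: "\<And>g. g \<in> \<G> \<Longrightarrow> orthogonal_transformation g \<and> (\<exists>\<sigma>. semilinear \<sigma> g) \<and> g ` K0 = K0 \<and> g ` K1 = K1"
  obtains \<epsilon> T c where "\<epsilon> > 0" "T \<in> density_matrices \<epsilon>" "cov_matrix (gauge_sq T) = c *\<^sub>R mat 1"
    "\<And>g x. g \<in> \<G> \<Longrightarrow> g (T *v x) = T *v g x"
proof -
  obtain \<epsilon> where \<epsilon>: "\<epsilon> > 0" "\<epsilon> \<le> 1 / real CARD('n)" 
    and thr: "\<And>v T. T \<in> density_matrices \<epsilon> \<Longrightarrow> norm v = 1 \<Longrightarrow> T *v v = \<epsilon> *\<^sub>R v \<Longrightarrow>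
      (\<integral>x. gauge_sq T ((real CARD('n) *\<^sub>R T) *v x) \<partial>std_gaussian) < (\<integral>x. gauge_sq T x \<partial>std_gaussian)"
    using exists_small_threshold by metis
  define n where "n = real CARD('n)"
  have n: "n > 0" by (simp add: n_def)
  define W where "W T = cov_matrix (gauge_sq T)" for T
  define Z where "Z = {T :: complex ^ 'n ^ 'n. \<forall>g\<in>\<G>. \<forall>x. g (T *v x) = T *v g x}"
  define D where "D = density_matrices \<epsilon> \<inter> Z"
  have ling: "linear g" if "g \<in> \<G>" for g using \<G>[OF that] by (auto simp: orthogonal_transformation_def)
  have Zadd: "a *\<^sub>R S + b *\<^sub>R T \<in> Z" if "S \<in> Z" "T \<in> Z" for a b S T
    using that ling
    by (auto simp: Z_def linear_add[OF linear_matrix_apply] linear_cmul[OF linear_matrix_apply] linear_add linear_cmul)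
  have "convex Z" by (rule convexI) (rule Zadd)
  then have convD: "convex D" unfolding D_def by (intro convex_Int convex_density_matrices)
  have "closed Z"
  proof -
    have "continuous_on UNIV (\<lambda>T :: complex ^ 'n ^ 'n. T *v x)" for x
      by (rule linear_continuous_on[OF linear_conv_bounded_linear[THEN iffD1, OF linear_matrix_apply]])
    moreover have "continuous_on UNIV (\<lambda>T :: complex ^ 'n ^ 'n. g (T *v x))" if "g \<in> \<G>" for g x
      by (rule linear_continuous_on[OF linear_conv_bounded_linear[THEN iffD1]])
         (rule linear_compose[OF linear_matrix_apply ling[OF that], unfolded o_def])
    ultimately have "closed {T :: complex ^ 'n ^ 'n. g (T *v x) = T *v g x}" if "g \<in> \<G>" for g x
      using that by (intro closed_Collect_eq) auto
    then have "closed (\<Inter>g\<in>\<G>. \<Inter>x. {T :: complex ^ 'n ^ 'n. g (T *v x) = T *v g x})"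
      by (intro closed_INT ballI)
    also have "(\<Inter>g\<in>\<G>. \<Inter>x. {T :: complex ^ 'n ^ 'n. g (T *v x) = T *v g x}) = Z" by (auto simp: Z_def)
    finally show ?thesis .
  qed
  then have compD: "compact D" unfolding D_def by (intro compact_Int_closed compact_density_matrices \<epsilon>)
  then have closD: "closed D" by (rule compact_imp_closed)
  have IZ: "mat 1 \<in> Z" by (simp add: Z_def)
  have ID: "(1 / n) *\<^sub>R mat 1 \<in> D"
    using scaled_identity_density_matrix[OF \<epsilon>(2)] Zadd[OF IZ IZ, of "1 / n" 0] by (simp add: D_def n_def)
  then have neD: "D \<noteq> {}" by blast
  \<comment> \<open>A fixed point of \<open>f\<close> is a solution of the variational inequality: \<open>W T\<close> lies in the normal cone of \<open>D\<close> at \<open>T\<close>.\<close>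
  define f where "f T = closest_point D (T + W T)" for T
  have contW: "continuous_on D W"
    unfolding W_def by (rule continuous_on_subset[OF continuous_on_cov_matrix_gauge_sq[OF \<epsilon>(1)]]) (simp add: D_def)
  have "continuous_on D f"
    unfolding f_def
    by (rule continuous_on_compose2[OF continuous_on_closest_point[OF convD closD neD, of UNIV]])
       (intro continuous_intros contW, simp)
  moreover have "f \<in> D \<rightarrow> D" using closest_point_in_set[OF closD neD] by (auto simp: f_def)
  ultimately obtain T where T: "T \<in> D" "f T = T" using brouwer[OF compD convD neD] by metis
  have VI: "W T \<bullet> (S - T) \<le> 0" if "S \<in> D" for S
    using closest_point_dot[OF convD closD that, of "T + W T"] T(2) by (simp add: f_def)
  have TD: "T \<in> density_matrices \<epsilon>" and TZ: "T \<in> Z" using T by (auto simp: D_def)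
  note quad = convex_homogeneous2_gauge_sq[OF TD \<epsilon>(1)]
  define E where "E = (\<integral>x. gauge_sq T x \<partial>std_gaussian)"
  have IW: "mat 1 \<bullet> W T = 2 * E" using mat_1_inner_cov_matrix[OF quad] by (simp add: W_def E_def)
  have II: "mat 1 \<bullet> (mat 1 :: complex ^ 'n ^ 'n) = n" by (simp add: mat_1_inner trace_I n_def)
  define W0 where "W0 = W T - (2 * E / n) *\<^sub>R mat 1"
  have IW0: "mat 1 \<bullet> W0 = 0" using n by (simp add: W0_def inner_diff_right IW II)
  have commW: "g (W T *v x) = W T *v g x" if g: "g \<in> \<G>" for g x
  proof -
    obtain \<sigma> where \<sigma>: "semilinear \<sigma> g" using \<G>[OF g] by blast
    have "gauge_sq T (g y) = gauge_sq T y" for y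
      using \<G>[OF g] TZ g by (intro gauge_sq_invariant[OF \<sigma>]) (auto simp: orthogonal_transformation_bij Z_def)
    then show ?thesis unfolding W_def using \<G>[OF g] by (intro cov_matrix_commute[OF quad \<sigma>]) auto
  qed
  then have WZ: "W T \<in> Z" by (simp add: Z_def)
  show thesis
  proof (rule density_matrix_least_eigenvalue[OF TD \<epsilon>(1)])
    fix v assume eigenvector: "norm v = 1" "T *v v = \<epsilon> *\<^sub>R v"
    \<comment> \<open>Testing with \<open>I/n\<close> contradicts the choice of \<open>\<epsilon>\<close>.\<close>
    have "W T \<bullet> ((1 / n) *\<^sub>R mat 1 - T) \<le> 0" by (rule VI[OF ID])
    then have "2 * E / n \<le> T \<bullet> W T" by (simp add: inner_diff_right inner_commute[of "W T"] IW)
    then have "2 * E \<le> n * (T \<bullet> W T)" using n by (simp add: field_simps)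
    then have "0 \<le> (n *\<^sub>R T - mat 1) \<bullet> W T" by (simp add: inner_diff_left IW)
    then have "E \<le> (\<integral>x. gauge_sq T ((n *\<^sub>R T) *v x) \<partial>std_gaussian)"
      using convex_homogeneous2_supporting_line[OF quad, of "n *\<^sub>R T"] by (simp add: W_def E_def)
    then show thesis using thr[OF TD eigenvector] by (simp add: n_def E_def)
  next
    fix \<mu> assume interior: "\<mu> > \<epsilon>" "\<And>x. \<mu> * (norm x)\<^sup>2 \<le> (T *v x) \<bullet> x"
    \<comment> \<open>The number \<open>B\<close> bounds the form of \<open>W0\<close>, so a step of length \<open>(\<mu> - \<epsilon>) / B\<close> in the direction \<open>W0\<close> stays above \<open>\<epsilon>\<close>.\<close>
    define B where "B = (real CARD('n))\<^sup>2 * norm W0 + 1"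
    have B: "B > 0" by (simp add: B_def add_nonneg_pos)
    define \<delta> where "\<delta> = (\<mu> - \<epsilon>) / B"
    have \<delta>: "\<delta> > 0" using interior(1) B by (simp add: \<delta>_def)
    have "T + \<delta> *\<^sub>R W0 \<in> density_matrices \<epsilon>"
      unfolding density_matrices_def
    proof (intro CollectI conjI allI)
      have "conj_transpose (T + \<delta> *\<^sub>R W0) = conj_transpose T + \<delta> *\<^sub>R (conj_transpose (W T) - (2 * E / n) *\<^sub>R conj_transpose (mat 1))"
        by (simp add: W0_def conj_transpose_def vec_eq_iff)
      then show "conj_transpose (T + \<delta> *\<^sub>R W0) = T + \<delta> *\<^sub>R W0"
        using TD conj_transpose_cov_matrix[OF quad] by (simp add: W0_def W_def density_matrices_def)
      show "mat 1 \<bullet> (T + \<delta> *\<^sub>R W0) = 1"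
        using TD IW0 by (simp add: inner_add_right density_matrices_def)
      fix x
      have "\<bar>(W0 *v x) \<bullet> x\<bar> \<le> norm (W0 *v x) * norm x" by (rule Cauchy_Schwarz_ineq2)
      also have "\<dots> \<le> ((real CARD('n))\<^sup>2 * norm W0 * norm x) * norm x"
        by (intro mult_right_mono norm_matrix_vector_le) auto
      also have "\<dots> \<le> B * (norm x)\<^sup>2" by (simp add: B_def power2_eq_square distrib_right)
      finally have "\<delta> * \<bar>(W0 *v x) \<bullet> x\<bar> \<le> \<delta> * (B * (norm x)\<^sup>2)" using \<delta> by (intro mult_left_mono) auto
      also have "\<dots> = (\<mu> - \<epsilon>) * (norm x)\<^sup>2" using B by (simp add: \<delta>_def)
      finally have 1: "\<delta> * \<bar>(W0 *v x) \<bullet> x\<bar> \<le> \<mu> * (norm x)\<^sup>2 - \<epsilon> * (norm x)\<^sup>2" by (simp add: left_diff_distrib)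
      have "- (\<delta> * ((W0 *v x) \<bullet> x)) \<le> \<delta> * \<bar>(W0 *v x) \<bullet> x\<bar>"
        using mult_left_mono[OF abs_ge_minus_self[of "(W0 *v x) \<bullet> x"], of \<delta>] \<delta> by simp
      then have "\<epsilon> * (norm x)\<^sup>2 \<le> (T *v x) \<bullet> x + \<delta> * ((W0 *v x) \<bullet> x)" using 1 interior(2)[of x] by linarith
      then show "\<epsilon> * (norm x)\<^sup>2 \<le> ((T + \<delta> *\<^sub>R W0) *v x) \<bullet> x"
        by (simp add: linear_add[OF linear_matrix_apply] linear_cmul[OF linear_matrix_apply] inner_add_left)
    qed
    moreover have "T + \<delta> *\<^sub>R W0 \<in> Z"
    proof -
      have "W0 \<in> Z" using Zadd[OF WZ IZ, of 1 "- (2 * E / n)"] by (simp add: W0_def)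
      then show ?thesis using Zadd[OF TZ, of W0 1 \<delta>] by simp
    qed
    ultimately have "W T \<bullet> (\<delta> *\<^sub>R W0) \<le> 0" using VI[of "T + \<delta> *\<^sub>R W0"] by (simp add: D_def)
    then have "W T \<bullet> W0 \<le> 0" using \<delta> by (simp add: mult_le_0_iff)
    moreover have "W T \<bullet> W0 = W0 \<bullet> W0 + (2 * E / n) * (mat 1 \<bullet> W0)"
    proof -
      have "W T = W0 + (2 * E / n) *\<^sub>R mat 1" by (simp add: W0_def)
      then have "W T \<bullet> W0 = (W0 + (2 * E / n) *\<^sub>R mat 1) \<bullet> W0" by simp
      then show ?thesis by (simp only: inner_add_left inner_scaleR_left)
    qed
    ultimately have "W0 \<bullet> W0 \<le> 0" by (simp add: IW0)
    then have "W0 = 0" by (metis inner_ge_zero inner_eq_zero_iff antisym)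
    then have "cov_matrix (gauge_sq T) = (2 * E / n) *\<^sub>R mat 1" by (simp add: W0_def W_def)
    then show thesis using that[OF \<epsilon>(1) TD] TZ by (auto simp: Z_def)
  qed
qed

lemma in_ell_position_if_scalar_cov_matrix:
  assumes circ: "circled K0" "circled K1" and \<epsilon>: "\<epsilon> > 0" and T: "T \<in> density_matrices \<epsilon>"
    and cov: "cov_matrix (gauge_sq T) = c *\<^sub>R mat 1"
  shows "in_ell_position (interp ((*v) T ` K0) K1 \<theta>)"
proof -
  note ball = body_inball[OF T \<epsilon>]
  have "circled (closure (body T))"
    unfolding circled_def
  proof (intro ballI)
    fix t :: real assume t: "t \<in> {0..2*pi}"
    let ?c = "exp (\<i> * of_real t)"
    have bij: "bij ((*s) ?c :: complex ^ 'n \<Rightarrow> _)"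
    proof (rule o_bij)
      show "(*s) (exp (- (\<i> * of_real t))) \<circ> (*s) ?c = (id :: complex ^ 'n \<Rightarrow> _)"
        "(*s) ?c \<circ> (*s) (exp (- (\<i> * of_real t))) = (id :: complex ^ 'n \<Rightarrow> _)"
        by (auto simp: fun_eq_iff vector_smult_assoc exp_minus)
    qed
    have "(*s) ?c ` body T = body T"
      using circ t bij by (intro body_invariant[OF semilinear_vector_smult]) (auto simp: circled_def vector_scalar_commute)
    moreover have "linear ((*s) ?c :: complex ^ 'n \<Rightarrow> _)"
      using semilinear_vector_smult[of ?c] by (simp add: semilinear_def)
    ultimately show "(*s) ?c ` closure (body T) = closure (body T)"
      using closure_injective_linear_image[of "(*s) ?c" "body T"] bij by (simp add: bij_is_inj)
  qed
  moreover have "interior (closure (body T)) \<noteq> {}"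
  proof -
    have "ball 0 (\<epsilon> * r) \<subseteq> interior (closure (body T))"
      using ball(2) closure_subset by (intro interior_maximal) auto
    then show ?thesis using ball(1) by (metis centre_in_ball empty_iff subsetD)
  qed
  moreover have "compact (closure (body T))" using bounded_body[OF T \<epsilon>] by (simp add: compact_closure)
  moreover have "convex (closure (body T))" by (intro convex_closure convex_body)
  ultimately have "circled_convex_body (closure (body T))" by (simp add: circled_convex_body_def)
  then show ?thesis
    using ell2_minimal_if_cov_matrix_scalar[OF ball cov[unfolded gauge_sq_def[abs_def]]]
    by (simp add: in_ell_position_def body_def)
qed

end

section \<open>Circled bodies and their symmetries\<close>

text \<open>The body is symmetric about 0, so it contains the midpoints of a small ball and of its reflection.\<close>

lemma circled_convex_body_ball:
  fixes K :: "(complex ^ 'n) set"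
  assumes "circled_convex_body K"
  obtains r R where "r > 0" "ball 0 r \<subseteq> K" "K \<subseteq> cball 0 R"
proof -
  have K: "convex K" "compact K" "interior K \<noteq> {}" "circled K"
    using assms by (auto simp: circled_convex_body_def)
  obtain x e where e: "e > 0" "ball x e \<subseteq> K" using K(3) by (auto simp: mem_interior)
  have "(\<lambda>x. exp (\<i> * of_real pi) *s x) ` K = K" using K(4) unfolding circled_def by (rule bspec) simp
  moreover have "exp (\<i> * of_real pi) *s y = - y" for y :: "complex ^ 'n" by (simp add: vec_eq_iff)
  ultimately have neg: "uminus ` K = K" by simp
  have "ball 0 e \<subseteq> K"
  proof
    fix y :: "complex ^ 'n" assume "y \<in> ball 0 e"
    then have "x + y \<in> K" "x - y \<in> K" using e(2) by (auto simp: subset_iff dist_norm)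
    moreover from \<open>x - y \<in> K\<close> have "- (x - y) \<in> uminus ` K" by (rule imageI)
    ultimately have "x + y \<in> K" "y - x \<in> K" unfolding neg by simp_all
    then have "(1/2) *\<^sub>R (x + y) + (1/2) *\<^sub>R (y - x) \<in> K" by (intro convexD[OF K(1)]) auto
    moreover have "(1/2) *\<^sub>R (x + y) + (1/2) *\<^sub>R (y - x) = y"
      by (simp add: algebra_simps flip: scaleR_add_left)
    ultimately show "y \<in> K" by simp
  qed
  moreover obtain R where "K \<subseteq> cball 0 R" 
    using compact_imp_bounded[OF K(2)] by (auto simp: bounded_iff subset_iff)
  ultimately show thesis using that e(1) by blast
qed

text \<open>Both properties hold for the generators and are preserved by composition, and the set of generators is
closed under inverses.\<close>

lemma G_bar_semilinear:
  assumes "g \<in> carrier G_bar"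
  shows "orthogonal_transformation g \<and> (\<exists>\<sigma>. semilinear \<sigma> g)"
proof -
  have comp: "orthogonal_transformation (g \<circ> h) \<and> (\<exists>\<sigma>. semilinear \<sigma> (g \<circ> h))"
    if gh: "orthogonal_transformation g \<and> (\<exists>\<sigma>. semilinear \<sigma> g)" "orthogonal_transformation h \<and> (\<exists>\<sigma>. semilinear \<sigma> h)"
    for g h :: "complex ^ 'a \<Rightarrow> complex ^ 'a"
  proof -
    obtain \<sigma> \<tau> where s: "semilinear \<sigma> g" "semilinear \<tau> h" using gh by blast
    then have "semilinear (\<sigma> \<circ> \<tau>) (g \<circ> h)"
      unfolding semilinear_def by (auto simp: fun_eq_iff intro: linear_compose)
    then show ?thesis using gh orthogonal_transformation_compose by blast
  qed
  have gen: "orthogonal_transformation h \<and> (\<exists>\<sigma>. semilinear \<sigma> h) \<and> 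
     (\<exists>h'. h' \<in> unitary_maps \<union> {conj_map} \<and> h \<circ> h' = id \<and> h' \<circ> h = id)" 
    if hU: "h \<in> unitary_maps \<union> {conj_map}" for h :: "complex ^ 'a \<Rightarrow> complex ^ 'a"
    using hU
  proof
    assume "h \<in> unitary_maps"
    then obtain U where U: "h = (*v) U" "U ** conj_transpose U = mat 1" "conj_transpose U ** U = mat 1"
      by (auto simp: unitary_maps_def)
    have "conj_transpose (conj_transpose U) = U" by (simp add: conj_transpose_def vec_eq_iff)
    then have "(*v) (conj_transpose U) \<in> unitary_maps" using U by (auto simp: unitary_maps_def)
    moreover have "h \<circ> (*v) (conj_transpose U) = id" "(*v) (conj_transpose U) \<circ> h = id"
      using U by (auto simp: fun_eq_iff matrix_vector_mul_assoc)
    ultimately show ?thesis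
      using U orthogonal_transformation_unitary[OF U(3)] semilinear_matrix[of U] by blast
  next
    assume h: "h \<in> {conj_map}"
    have lin: "linear (conj_map :: complex ^ 'a \<Rightarrow> _)"
      by (auto intro!: linearI simp: conj_map_def vec_eq_iff)
    have "semilinear cnj (conj_map :: complex ^ 'a \<Rightarrow> _)"
      using lin by (auto simp: semilinear_def conj_map_def vec_eq_iff)
    moreover have "orthogonal_transformation (conj_map :: complex ^ 'a \<Rightarrow> _)"
      using lin by (simp add: orthogonal_transformation_def conj_map_def inner_vec_def inner_complex_def)
    moreover have "conj_map \<circ> conj_map = (id :: complex ^ 'a \<Rightarrow> _)"
      by (simp add: fun_eq_iff conj_map_def vec_eq_iff)
    ultimately show ?thesis using h by auto
  qed
  have grp: "group (orthogonal_group :: (complex ^ 'a \<Rightarrow> complex ^ 'a) monoid)"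
  proof (rule groupI)
    fix x :: "complex ^ 'a \<Rightarrow> complex ^ 'a" assume "x \<in> carrier orthogonal_group"
    then have x: "orthogonal_transformation x" by (simp add: orthogonal_group_def)
    show "\<exists>y\<in>carrier orthogonal_group. y \<otimes>\<^bsub>orthogonal_group\<^esub> x = \<one>\<^bsub>orthogonal_group\<^esub>"
      using orthogonal_transformation_inv[OF x] orthogonal_transformation_inj[OF x]
      by (intro bexI[of _ "inv_into UNIV x"]) (auto simp: orthogonal_group_def)
  qed (auto simp: orthogonal_group_def o_assoc id_def intro: orthogonal_transformation_compose)
  have "g \<in> generate orthogonal_group (unitary_maps \<union> {conj_map})" using assms by (simp add: G_bar_def)
  then show ?thesis
  proof (induction rule: generate.induct)
    case one
    show ?case using semilinear_id by (auto simp: orthogonal_group_def id_def)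
  next
    case (incl h)
    then show ?case using gen by blast
  next
    case (inv h)
    then obtain h' where h': "h' \<in> unitary_maps \<union> {conj_map}" "h \<circ> h' = id" "h' \<circ> h = id"
      using gen by blast
    have "inv\<^bsub>orthogonal_group\<^esub> h = h'"
      using inv h' gen by (intro group.inv_equality[OF grp]) (auto simp: orthogonal_group_def)
    then show ?case using gen h'(1) by auto
  next
    case (eng h1 h2)
    have "h1 \<otimes>\<^bsub>orthogonal_group\<^esub> h2 = h1 \<circ> h2" by (simp add: orthogonal_group_def)
    with comp[OF eng.IH] show ?case by (simp only:)
  qed
qed

theorem proposition3p2:
  fixes K0 K1 :: "(complex ^ 'n) set" and \<theta> :: real
  assumes "circled_convex_body K0" and "circled_convex_body K1"
    and "0 \<le> \<theta>" and "\<theta> < 1"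
  shows "(\<exists>T\<in>PD. in_ell_position (interp ((*v) T ` K0) K1 \<theta>)) \<and>
    (\<forall>\<G>. subgroup \<G> G_bar \<and> (\<forall>g\<in>\<G>. g ` K0 = K0 \<and> g ` K1 = K1) \<longrightarrow>
      (\<exists>T\<in>PD. in_ell_position (interp ((*v) T ` K0) K1 \<theta>) \<and>
        (\<forall>g\<in>\<G>. g \<circ> (*v) T = (*v) T \<circ> g) \<and>
        (\<forall>g\<in>\<G>. g ` interp ((*v) T ` K0) K1 \<theta> = interp ((*v) T ` K0) K1 \<theta>)))"
proof -
  obtain r0 R0 where 0: "r0 > 0" "ball 0 r0 \<subseteq> K0" "K0 \<subseteq> cball 0 R0"
    using circled_convex_body_ball[OF assms(1)] by blast
  obtain r1 R1 where 1: "r1 > 0" "ball 0 r1 \<subseteq> K1" "K1 \<subseteq> cball 0 R1"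
    using circled_convex_body_ball[OF assms(2)] by blast
  interpret two_bodies K0 K1 \<theta> "min r0 r1" "max 1 (max R0 R1)"
  proof
    show "convex K0" "convex K1" using assms by (auto simp: circled_convex_body_def)
    show "ball 0 (min r0 r1) \<subseteq> K0" "ball 0 (min r0 r1) \<subseteq> K1" using 0 1 by (auto simp: subset_iff)
    show "K0 \<subseteq> cball 0 (max 1 (max R0 R1))" "K1 \<subseteq> cball 0 (max 1 (max R0 R1))"
      using 0 1 by (auto simp: subset_iff le_max_iff_disj)
  qed (use 0 1 assms in auto)
  have circ: "circled K0" "circled K1" using assms by (auto simp: circled_convex_body_def)
  have main: "\<exists>T\<in>PD. in_ell_position (interp ((*v) T ` K0) K1 \<theta>) \<and>
        (\<forall>g\<in>\<G>. g \<circ> (*v) T = (*v) T \<circ> g) \<and>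
        (\<forall>g\<in>\<G>. g ` interp ((*v) T ` K0) K1 \<theta> = interp ((*v) T ` K0) K1 \<theta>)"
    if \<G>: "\<And>g. g \<in> \<G> \<Longrightarrow> orthogonal_transformation g \<and> (\<exists>\<sigma>. semilinear \<sigma> g) \<and> g ` K0 = K0 \<and> g ` K1 = K1" for \<G>
  proof -
    obtain \<epsilon> T c where T: "\<epsilon> > 0" "T \<in> density_matrices \<epsilon>" "cov_matrix (gauge_sq T) = c *\<^sub>R mat 1"
      "\<And>g x. g \<in> \<G> \<Longrightarrow> g (T *v x) = T *v g x"
      using exists_scalar_cov_matrix[OF \<G>] by metis
    have "T \<in> PD" by (rule density_matrix_PD[OF T(2,1)])
    moreover have "in_ell_position (interp ((*v) T ` K0) K1 \<theta>)"
      by (rule in_ell_position_if_scalar_cov_matrix[OF circ T(1-3)])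
    moreover have "g \<circ> (*v) T = (*v) T \<circ> g" if "g \<in> \<G>" for g using T(4)[OF that] by (simp add: fun_eq_iff)
    moreover have "g ` interp ((*v) T ` K0) K1 \<theta> = interp ((*v) T ` K0) K1 \<theta>" if g: "g \<in> \<G>" for g
    proof -
      obtain \<sigma> where "semilinear \<sigma> g" using \<G>[OF g] by blast
      then show ?thesis
        using body_invariant[of \<sigma> g T] \<G>[OF g] T(4)[OF g] by (simp add: orthogonal_transformation_bij body_def)
    qed
    ultimately show ?thesis by blast
  qed
  show ?thesis
  proof (intro conjI allI impI)
    show "\<exists>T\<in>PD. in_ell_position (interp ((*v) T ` K0) K1 \<theta>)" using main[of "{}"] by blast
  next
    fix \<G> assume \<G>: "subgroup \<G> G_bar \<and> (\<forall>g\<in>\<G>. g ` K0 = K0 \<and> g ` K1 = K1)"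
    then have "\<G> \<subseteq> carrier G_bar" by (simp add: subgroup.subset)
    with \<G> show "\<exists>T\<in>PD. in_ell_position (interp ((*v) T ` K0) K1 \<theta>) \<and>
        (\<forall>g\<in>\<G>. g \<circ> (*v) T = (*v) T \<circ> g) \<and>
        (\<forall>g\<in>\<G>. g ` interp ((*v) T ` K0) K1 \<theta> = interp ((*v) T ` K0) K1 \<theta>)"
      by (intro main) (auto dest: G_bar_semilinear)
  qed
qed

end
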